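(* Let $\varphi$ be real analytic on an open interval $I$, let $A,B:\,]-\varepsilon,\varepsilon[\to\mathbb{R}$ be real analytic with $A^2+B^2>0$, and let $(p_1,p_2,p_3)\in\mathbb{R}^3$ with $p_3\in I$. Consider the Cauchy problem, for $\psi=(x,y,z)$, $$\begin{cases}\Delta\psi=-\dot\varphi(z)\big(\langle\nabla x,\nabla z\rangle,\ \langle\nabla y,\nabla z\rangle,\ -|\nabla x|^2-|\nabla y|^2+|\nabla z|^2\big),\\ \psi(u,0)=(p_1,p_2,p_3)+\int_0^u(B(t)\sin t,B(t)\cos t,A(t))\,dt,\\ \psi_v(u,0)=(-A(u)\sin u,-A(u)\cos u,B(u)),\end{cases}$$ where $\Delta,\nabla$ are the Euclidean Laplacian and gradient in $(u,v)$. Then for $R$ small enough there exists a unique real analytic solution $\psi:D_R\to\mathbb{R}^3$ on the disk $D_R=\{(u,v):\|(u,v)\|<R\}$, and it defines a conformally immersed $[\varphi,\vec e_3]$-minimal surface in $\mathbb{R}^3$ whose angle function $\eta$ satisfies $\eta(u,v)\neq0$ if $v\neq0$, $\eta(u,0)=0$ and $\eta_v(u,0)=1$ for all $u$.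
   Context: $\vec e_3=(0,0,1)$. An immersion $\psi=(x,y,z)$ into $\mathbb{R}^3$ is $[\varphi,\vec e_3]$-minimal if its mean curvature vector is $\dot\varphi(z)\vec e_3^\perp$; equivalently, for every conformal parameter $\xi$: $2x_{\xi\bar\xi}+\dot\varphi(z)(z_\xi x_{\bar\xi}+z_{\bar\xi}x_\xi)=0$, $2y_{\xi\bar\xi}+\dot\varphi(z)(z_\xi y_{\bar\xi}+z_{\bar\xi}y_\xi)=0$, $2z_{\xi\bar\xi}-\dot\varphi(z)(|x_\xi|^2+|y_\xi|^2-|z_\xi|^2)=0$. The angle function is $\eta=\langle N,\vec e_3\rangle$ with $N=\frac{\psi_u\wedge\psi_v}{\|\psi_u\wedge\psi_v\|}$.
   Formalization: The third component −|∇x|²−|∇y|²+|∇z|² of the system is replaced by half of it, as the [φ,e₃]-minimal equations require; with the printed factor the solution cannot be minimal with η≠0 off v=0 unless φ̇ vanishes identically. *)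

theory Defs
  imports "HOL-Analysis.Analysis"
begin

text \<open>Points of the parameter plane are pairs (u,v) :: real \<times> real; the product metric on
  real \<times> real is the Euclidean one, so ball 0 R is the disk D_R.\<close>

definition real_analytic_on :: "(real \<Rightarrow> real) \<Rightarrow> real set \<Rightarrow> bool" where
  "real_analytic_on f S \<longleftrightarrow>
     (\<forall>a\<in>S. \<exists>c :: nat \<Rightarrow> real. \<exists>r>0.
        \<forall>t. \<bar>t - a\<bar> < r \<longrightarrow> (\<lambda>n. c n * (t - a) ^ n) sums f t)"

definition real_analytic2_on :: "(real \<times> real \<Rightarrow> real) \<Rightarrow> (real \<times> real) set \<Rightarrow> bool" where
  "real_analytic2_on f S \<longleftrightarrow>
     (\<forall>p\<in>S. \<exists>c :: nat \<Rightarrow> nat \<Rightarrow> real. \<exists>r>0.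
        \<forall>q. dist q p < r \<longrightarrow>
          ((\<lambda>(i, j). c i j * (fst q - fst p) ^ i * (snd q - snd p) ^ j) has_sum f q) UNIV)"

definition pu :: "(real \<times> real \<Rightarrow> real) \<Rightarrow> real \<times> real \<Rightarrow> real" where
  "pu f p = deriv (\<lambda>s. f (s, snd p)) (fst p)"

definition pv :: "(real \<times> real \<Rightarrow> real) \<Rightarrow> real \<times> real \<Rightarrow> real" where
  "pv f p = deriv (\<lambda>s. f (fst p, s)) (snd p)"

definition lap :: "(real \<times> real \<Rightarrow> real) \<Rightarrow> real \<times> real \<Rightarrow> real" where
  "lap f p = pu (pu f) p + pv (pv f) p"

definition gdot :: "(real \<times> real \<Rightarrow> real) \<Rightarrow> (real \<times> real \<Rightarrow> real) \<Rightarrow> real \<times> real \<Rightarrow> real" where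
  "gdot f g p = pu f p * pu g p + pv f p * pv g p"

definition conformal_immersion_on ::
  "(real \<times> real) set \<Rightarrow> (real \<times> real \<Rightarrow> real) \<Rightarrow> (real \<times> real \<Rightarrow> real) \<Rightarrow> (real \<times> real \<Rightarrow> real) \<Rightarrow> bool" where
  "conformal_immersion_on S x y z \<longleftrightarrow>
     (\<forall>p\<in>S. (\<lambda>s. x (s, snd p)) differentiable (at (fst p)) \<and>
             (\<lambda>s. y (s, snd p)) differentiable (at (fst p)) \<and>
             (\<lambda>s. z (s, snd p)) differentiable (at (fst p)) \<and>
             (\<lambda>s. x (fst p, s)) differentiable (at (snd p)) \<and>
             (\<lambda>s. y (fst p, s)) differentiable (at (snd p)) \<and>
             (\<lambda>s. z (fst p, s)) differentiable (at (snd p)) \<and>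
       (pu x p)\<^sup>2 + (pu y p)\<^sup>2 + (pu z p)\<^sup>2 = (pv x p)\<^sup>2 + (pv y p)\<^sup>2 + (pv z p)\<^sup>2 \<and>
       (pu x p)\<^sup>2 + (pu y p)\<^sup>2 + (pu z p)\<^sup>2 > 0 \<and>
       pu x p * pv x p + pu y p * pv y p + pu z p * pv z p = 0)"

text \<open>[phi,e3]-minimality, via the equations of the context written for the conformal parameter
  xi = u + i v: with x_xi = (x_u - i x_v)/2 one has x_{xi xibar} = lap x / 4,
  z_xi x_xibar + z_xibar x_xi = (z_u x_u + z_v x_v)/2 and |x_xi|^2 = (x_u^2 + x_v^2)/4.
  The points of S must have z in the domain I of phi.\<close>
definition phi_e3_minimal_on ::
  "(real \<Rightarrow> real) \<Rightarrow> real set \<Rightarrow> (real \<times> real) set \<Rightarrow>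
   (real \<times> real \<Rightarrow> real) \<Rightarrow> (real \<times> real \<Rightarrow> real) \<Rightarrow> (real \<times> real \<Rightarrow> real) \<Rightarrow> bool" where
  "phi_e3_minimal_on \<phi> I S x y z \<longleftrightarrow>
     conformal_immersion_on S x y z \<and>
     (\<forall>p\<in>S. z p \<in> I \<and>
        2 * (lap x p / 4) + deriv \<phi> (z p) * (gdot z x p / 2) = 0 \<and>
        2 * (lap y p / 4) + deriv \<phi> (z p) * (gdot z y p / 2) = 0 \<and>
        2 * (lap z p / 4) - deriv \<phi> (z p) * (gdot x x p / 4 + gdot y y p / 4 - gdot z z p / 4) = 0)"

text \<open>Angle function eta = <N, e3>, N = (psi_u \<times> psi_v)/|psi_u \<times> psi_v|.\<close>
definition angle_fn ::
  "(real \<times> real \<Rightarrow> real) \<Rightarrow> (real \<times> real \<Rightarrow> real) \<Rightarrow> (real \<times> real \<Rightarrow> real) \<Rightarrow> real \<times> real \<Rightarrow> real" where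
  "angle_fn x y z p =
     (pu x p * pv y p - pu y p * pv x p) /
     sqrt ((pu y p * pv z p - pu z p * pv y p)\<^sup>2 + (pu z p * pv x p - pu x p * pv z p)\<^sup>2
           + (pu x p * pv y p - pu y p * pv x p)\<^sup>2)"

definition cauchy_solution ::
  "(real \<Rightarrow> real) \<Rightarrow> real set \<Rightarrow> (real \<Rightarrow> real) \<Rightarrow> (real \<Rightarrow> real) \<Rightarrow> real \<Rightarrow> real \<Rightarrow> real \<Rightarrow> real \<Rightarrow>
   (real \<times> real \<Rightarrow> real) \<Rightarrow> (real \<times> real \<Rightarrow> real) \<Rightarrow> (real \<times> real \<Rightarrow> real) \<Rightarrow> bool" where
  "cauchy_solution \<phi> I A B p1 p2 p3 R x y z \<longleftrightarrow>
     real_analytic2_on x (ball 0 R) \<and> real_analytic2_on y (ball 0 R) \<and> real_analytic2_on z (ball 0 R) \<and>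
     (\<forall>q\<in>ball 0 R. z q \<in> I \<and>
        lap x q = - deriv \<phi> (z q) * gdot x z q \<and>
        lap y q = - deriv \<phi> (z q) * gdot y z q \<and>
        lap z q = - deriv \<phi> (z q) * ((- gdot x x q - gdot y y q + gdot z z q) / 2)) \<and>
     (\<forall>u. \<bar>u\<bar> < R \<longrightarrow>
        x (u, 0) = p1 + (LBINT t=ereal 0..ereal u. B t * sin t) \<and>
        y (u, 0) = p2 + (LBINT t=ereal 0..ereal u. B t * cos t) \<and>
        z (u, 0) = p3 + (LBINT t=ereal 0..ereal u. A t) \<and>
        pv x (u, 0) = - A u * sin u \<and>
        pv y (u, 0) = - A u * cos u \<and>
        pv z (u, 0) = B u)"

end

theory Submission
  imports Defs "HOL-Computational_Algebra.Formal_Power_Series"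
begin

text \<open>In the characteristic variables \<open>s = u + \<i> v\<close>, \<open>t = u - \<i> v\<close>, taken as independent complex
  variables, the system reads \<open>\<psi>\<^sub>s\<^sub>t = F(\<psi>, \<psi>\<^sub>s, \<psi>\<^sub>t)\<close> with \<open>\<psi>\<^sub>s\<close> and \<open>\<psi>\<^sub>t\<close> prescribed on the diagonal
  \<open>s = t\<close>. Integrating from the diagonal recovers \<open>\<psi>\<close> and its first derivatives from \<open>w = \<psi>\<^sub>s\<^sub>t\<close> without
  loss of derivatives, so \<open>w\<close> is a Banach fixed point in the algebra of absolutely summable double
  power series; since \<open>F\<close> is quadratic in the first derivatives, rescaling the coordinates makes the
  data small without changing the equation. The fixed point is sought among the series with
  \<open>w(s, t) = cnj w(cnj t, cnj s)\<close>, which makes \<open>\<psi>\<close> real for real \<open>u\<close>, \<open>v\<close>.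

  Conformality: \<open>h = \<psi>\<^sub>s \<bullet> \<psi>\<^sub>s\<close> satisfies a linear equation \<open>h\<^sub>t = - k h\<close> and vanishes on the diagonal.
  Uniqueness: the difference of two solutions has zero Cauchy data and its Laplacian is bounded by its
  1-jet, so no lowest power of \<open>v\<close> can occur in it; analytic continuation along rays does the rest.
  Angle function: by conformality \<open>\<eta>\<close> is the third component of \<open>\<psi>\<^sub>u \<times> \<psi>\<^sub>v\<close> divided by the square of
  \<open>|\<psi>\<^sub>u|\<close>; the \<open>v\<close>-derivative of that component is continuous and positive at the origin, so \<open>\<eta>\<close> has the
  sign of \<open>v\<close> nearby.\<close>

section \<open>Absolutely summable power series\<close>

text \<open>The obstacle is loss of derivatives: a Cauchy-Kovalevskaya iteration in
  \<open>u\<close>, \<open>v\<close> differentiates and shrinks the domain at every step. In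
  characteristic variables only integrations and restrictions act on the unknown, and they are
  contractions for one fixed norm, that of absolute summability on the closed unit bidisc. The
  radius therefore stays 1, and smallness has to come from the data alone. The algebra is built over
  an arbitrary commutative Banach algebra so that the construction can be iterated: a double series
  is a series of series, and a point of evaluation may itself be a series. Restriction to the
  diagonal, substitution, recentring and composition with \<open>deriv \<phi>\<close> all become
  instances of \<open>ev\<close>, and their rules reduce to homomorphisms commuting with
  \<open>ev\<close>. As for the angle, the data give the normal (cos u, - sin u, 0) along the axis.
  The gradients of x and y are orthogonal there to that of z, so the mixed derivatives of x and y
  vanish on the axis. This is why the derivative of the angle function on the axis can be computed
  from the data, whatever \<open>\<phi>\<close> is.\<close>

class comm_banach_algebra = real_normed_algebra_1 + banach + comm_ring_1

instance real :: comm_banach_algebra ..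
instance complex :: comm_banach_algebra ..

typedef (overloaded) 'a aps =
  "{f :: 'a::comm_banach_algebra fps. summable (\<lambda>n. norm (fps_nth f n))}"
  by (rule exI[of _ 0]) simp

setup_lifting type_definition_aps

lift_definition coef :: "'a::comm_banach_algebra aps \<Rightarrow> nat \<Rightarrow> 'a" is fps_nth .

lemma summable_norm_coef [simp, intro]: "summable (\<lambda>n. norm (coef f n))"
  by transfer simp

lemma summable_coef [simp, intro]: "summable (coef f)"
  by (rule summable_norm_cancel) simp

lemma aps_eqI: "(\<And>n. coef f n = coef g n) \<Longrightarrow> f = g"
  by transfer (simp add: fps_ext)

lemma summable_norm_fps_mult:
  fixes f g :: "'a::comm_banach_algebra fps"
  assumes "summable (\<lambda>n. norm (fps_nth f n))" "summable (\<lambda>n. norm (fps_nth g n))"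
  shows "summable (\<lambda>n. norm (fps_nth (f * g) n))"
proof (rule summable_comparison_test)
  have "summable (\<lambda>n. \<Sum>i\<le>n. norm (fps_nth f i) * norm (fps_nth g (n - i)))"
    using summable_Cauchy_product[of "\<lambda>n. norm (fps_nth f n)" "\<lambda>n. norm (fps_nth g n)"] assms by simp
  then show "summable (\<lambda>n. \<Sum>i=0..n. norm (fps_nth f i) * norm (fps_nth g (n - i)))"
    by (simp add: atMost_atLeast0)
  show "\<exists>N. \<forall>n\<ge>N. norm (norm (fps_nth (f * g) n)) \<le> (\<Sum>i=0..n. norm (fps_nth f i) * norm (fps_nth g (n - i)))"
    by (auto simp: fps_mult_nth intro!: sum_norm_le norm_mult_ineq)
qed

lemma summable_norm_add:
  fixes f g :: "nat \<Rightarrow> 'a::real_normed_vector"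
  assumes "summable (\<lambda>n. norm (f n))" "summable (\<lambda>n. norm (g n))"
  shows "summable (\<lambda>n. norm (f n + g n))"
  by (rule summable_comparison_test[OF _ summable_add[OF assms]])
     (simp add: norm_triangle_ineq)

lemma summable_norm_diff:
  fixes f g :: "nat \<Rightarrow> 'a::real_normed_vector"
  assumes "summable (\<lambda>n. norm (f n))" "summable (\<lambda>n. norm (g n))"
  shows "summable (\<lambda>n. norm (f n - g n))"
  using summable_norm_add[of f "\<lambda>n. - g n"] assms by simp

instantiation aps :: (comm_banach_algebra) comm_ring_1
begin
lift_definition zero_aps :: "'a aps" is 0 by simp
lift_definition one_aps :: "'a aps" is 1
  by (rule summable_finite[of "{0}"]) auto
lift_definition plus_aps :: "'a aps \<Rightarrow> 'a aps \<Rightarrow> 'a aps" is "(+)"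
  unfolding fps_add_nth by (rule summable_norm_add)
lift_definition minus_aps :: "'a aps \<Rightarrow> 'a aps \<Rightarrow> 'a aps" is "(-)"
  unfolding fps_sub_nth by (rule summable_norm_diff)
lift_definition uminus_aps :: "'a aps \<Rightarrow> 'a aps" is "uminus" by simp
lift_definition times_aps :: "'a aps \<Rightarrow> 'a aps \<Rightarrow> 'a aps" is "(*)"
  by (rule summable_norm_fps_mult)
instance
  by intro_classes (transfer; simp add: algebra_simps)+
end

instantiation aps :: (comm_banach_algebra) real_algebra_1
begin
lift_definition scaleR_aps :: "real \<Rightarrow> 'a aps \<Rightarrow> 'a aps" is "\<lambda>r f. Abs_fps (\<lambda>n. r *\<^sub>R fps_nth f n)"
  by (simp add: summable_mult)
instance
proof
  fix a b :: real and x y :: "'a aps"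
  show "a *\<^sub>R (x + y) = a *\<^sub>R x + a *\<^sub>R y"
    by transfer (simp add: fps_eq_iff scaleR_add_right)
  show "(a + b) *\<^sub>R x = a *\<^sub>R x + b *\<^sub>R x"
    by transfer (simp add: fps_eq_iff scaleR_add_left)
  show "a *\<^sub>R b *\<^sub>R x = (a * b) *\<^sub>R x" "1 *\<^sub>R x = x"
    by (transfer, simp add: fps_eq_iff)+
  show "a *\<^sub>R x * y = a *\<^sub>R (x * y)" "x * a *\<^sub>R y = a *\<^sub>R (x * y)"
    by (transfer, simp add: fps_eq_iff fps_mult_nth scaleR_right.sum)+
qed
end

lemma coef_simps [simp]:
  "coef 0 n = 0" "coef (f + g) n = coef f n + coef g n" "coef (f - g) n = coef f n - coef g n"
  "coef (- f) n = - coef f n" "coef (r *\<^sub>R f) n = r *\<^sub>R coef f n"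
  by (transfer, simp)+

lemma coef_one: "coef 1 n = (if n = 0 then 1 else 0)"
  by transfer simp

lemma coef_mult: "coef (f * g) n = (\<Sum>i\<le>n. coef f i * coef g (n - i))"
  by transfer (simp add: fps_mult_nth atMost_atLeast0)

instantiation aps :: (comm_banach_algebra) real_normed_algebra_1
begin
definition norm_aps :: "'a aps \<Rightarrow> real" where "norm_aps f = (\<Sum>n. norm (coef f n))"
definition sgn_aps :: "'a aps \<Rightarrow> 'a aps" where "sgn_aps f = inverse (norm f) *\<^sub>R f"
definition dist_aps :: "'a aps \<Rightarrow> 'a aps \<Rightarrow> real" where "dist_aps f g = norm (f - g)"
definition uniformity_aps :: "('a aps \<times> 'a aps) filter"
  where "uniformity_aps = (INF e\<in>{0 <..}. principal {(x, y). dist x y < e})"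
definition open_aps :: "'a aps set \<Rightarrow> bool"
  where "open_aps U = (\<forall>x\<in>U. eventually (\<lambda>(x', y). x' = x \<longrightarrow> y \<in> U) uniformity)"
instance
proof
  fix f g :: "'a aps" and r :: real and U :: "'a aps set"
  show "sgn f = f /\<^sub>R norm f" by (simp add: sgn_aps_def)
  show "dist f g = norm (f - g)" by (simp add: dist_aps_def)
  show "uniformity = (INF e\<in>{0<..}. principal {(x, y). dist (x::'a aps) y < e})"
    by (simp add: uniformity_aps_def)
  show "open U = (\<forall>x\<in>U. \<forall>\<^sub>F (x', y) in uniformity. x' = x \<longrightarrow> y \<in> U)"
    by (simp add: open_aps_def)
  have pos: "norm (coef f n) \<le> norm f" for n
    unfolding norm_aps_def using sum_le_suminf[of "\<lambda>n. norm (coef f n)" "{n}"] by simp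
  show "(norm f = 0) = (f = 0)"
  proof
    assume "norm f = 0" then show "f = 0" using pos by (intro aps_eqI) simp
  qed (simp add: norm_aps_def)
  show "norm (f + g) \<le> norm f + norm g"
    unfolding norm_aps_def suminf_add[OF summable_norm_coef summable_norm_coef]
    by (intro suminf_le summable_add summable_norm_coef) (simp add: norm_triangle_ineq)
  show "norm (r *\<^sub>R f) = \<bar>r\<bar> * norm f"
    by (simp add: norm_aps_def suminf_mult)
  have "norm (f * g) \<le> (\<Sum>n. \<Sum>i\<le>n. norm (coef f i) * norm (coef g (n - i)))"
    unfolding norm_aps_def
  proof (rule suminf_le)
    show "summable (\<lambda>n. \<Sum>i\<le>n. norm (coef f i) * norm (coef g (n - i)))"
      using summable_Cauchy_product[of "\<lambda>n. norm (coef f n)" "\<lambda>n. norm (coef g n)"] by simp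
    show "norm (coef (f * g) n) \<le> (\<Sum>i\<le>n. norm (coef f i) * norm (coef g (n - i)))" for n
      unfolding coef_mult by (intro sum_norm_le norm_mult_ineq)
  qed (rule summable_norm_coef)
  also have "\<dots> = norm f * norm g"
    unfolding norm_aps_def by (rule Cauchy_product[symmetric]) auto
  finally show "norm (f * g) \<le> norm f * norm g" .
  have "(\<Sum>n. norm (coef (1::'a aps) n)) = (\<Sum>n\<in>{0}. norm (coef (1::'a aps) n))"
    by (rule suminf_finite) (auto simp: coef_one)
  then show "norm (1::'a aps) = 1" by (simp add: norm_aps_def coef_one)
qed
end

lemma norm_coef_le: "norm (coef f n) \<le> norm f"
  unfolding norm_aps_def using sum_le_suminf[of "\<lambda>n. norm (coef f n)" "{n}"] by simp

lift_definition Aps :: "(nat \<Rightarrow> 'a::comm_banach_algebra) \<Rightarrow> 'a aps" is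
  "\<lambda>c. if summable (\<lambda>n. norm (c n)) then Abs_fps c else 0"
  by auto

lemma coef_Aps: "summable (\<lambda>n. norm (c n)) \<Longrightarrow> coef (Aps c) n = c n"
  by transfer simp

lemma norm_aps_leI:
  assumes "\<And>K. (\<Sum>n<K. norm (coef f n)) \<le> B"
  shows "norm f \<le> B"
  unfolding norm_aps_def by (rule suminf_le_const) (use assms in auto)

lemma sum_norm_coef_le: "(\<Sum>n<K. norm (coef f n)) \<le> norm f"
  unfolding norm_aps_def by (rule sum_le_suminf) auto

instance aps :: (comm_banach_algebra) banach
proof
  fix X :: "nat \<Rightarrow> 'a aps"
  assume C: "Cauchy X"
  define c where "c n = lim (\<lambda>m. coef (X m) n)" for n
  have "Cauchy (\<lambda>m. coef (X m) n)" for n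
  proof (rule metric_CauchyI)
    fix e :: real assume "e > 0"
    with C obtain M where M: "\<forall>m\<ge>M. \<forall>k\<ge>M. dist (X m) (X k) < e"
      unfolding Cauchy_def by blast
    have "dist (coef (X m) n) (coef (X k) n) \<le> dist (X m) (X k)" for m k
      using norm_coef_le[of "X m - X k" n] by (simp add: dist_norm)
    then show "\<exists>M. \<forall>m\<ge>M. \<forall>k\<ge>M. dist (coef (X m) n) (coef (X k) n) < e"
      using M by (meson le_less_trans)
  qed
  then have c: "(\<lambda>m. coef (X m) n) \<longlonglongrightarrow> c n" for n
    unfolding c_def by (simp add: Cauchy_convergent_iff convergent_LIMSEQ_iff)
  \<comment> \<open>The Cauchy bound is stated for finite partial sums because these pass to the
    coefficientwise limit; being uniform in \<open>K\<close>, it bounds the norm afterwards.\<close>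
  have est: "\<exists>M. \<forall>m\<ge>M. \<forall>K. (\<Sum>n<K. norm (coef (X m) n - c n)) \<le> e" if "e > 0" for e
  proof -
    from C that obtain M where M: "\<forall>m\<ge>M. \<forall>k\<ge>M. dist (X m) (X k) < e"
      unfolding Cauchy_def by blast
    have "(\<Sum>n<K. norm (coef (X m) n - c n)) \<le> e" if "m \<ge> M" for m K
    proof (rule tendsto_upperbound)
      show "(\<lambda>k. \<Sum>n<K. norm (coef (X m) n - coef (X k) n)) \<longlonglongrightarrow> (\<Sum>n<K. norm (coef (X m) n - c n))"
        by (intro tendsto_intros c)
      show "\<forall>\<^sub>F k in sequentially. (\<Sum>n<K. norm (coef (X m) n - coef (X k) n)) \<le> e"
        using eventually_ge_at_top[of M]
      proof eventually_elim
        case (elim k)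
        have "(\<Sum>n<K. norm (coef (X m - X k) n)) \<le> norm (X m - X k)"
          by (rule sum_norm_coef_le)
        also have "\<dots> \<le> e" using M[rule_format, OF that elim] by (simp add: dist_norm)
        finally show ?case by simp
      qed
    qed auto
    then show ?thesis by blast
  qed
  obtain M where M: "\<And>m K. m \<ge> M \<Longrightarrow> (\<Sum>n<K. norm (coef (X m) n - c n)) \<le> 1" using est[of 1] by auto
  have "summable (\<lambda>n. norm (coef (X M) n - c n))"
    by (rule summableI_nonneg_bounded[of _ 1]) (use M[of M] in auto)
  from summable_norm_diff[OF summable_norm_coef[of "X M"] this]
  have "summable (\<lambda>n. norm (c n))" by simp
  then have cc: "coef (Aps c) n = c n" for n by (rule coef_Aps)
  have "X \<longlonglongrightarrow> Aps c"
  proof (rule metric_LIMSEQ_I)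
    fix e :: real assume "e > 0"
    then obtain M where "\<And>m K. m \<ge> M \<Longrightarrow> (\<Sum>n<K. norm (coef (X m) n - c n)) \<le> e/2"
      using est[of "e/2"] by auto
    then have "norm (X m - Aps c) \<le> e / 2" if "m \<ge> M" for m
      by (intro norm_aps_leI) (use that cc in auto)
    moreover have "e / 2 < e" using \<open>e > 0\<close> by simp
    ultimately show "\<exists>no. \<forall>n\<ge>no. dist (X n) (Aps c) < e"
      unfolding dist_norm by (meson le_less_trans)
  qed
  then show "convergent X" by (auto simp: convergent_def)
qed

instance aps :: (comm_banach_algebra) comm_banach_algebra ..

section \<open>Contractive homomorphisms and evaluation\<close>

text \<open>Norm at most 1 rather than mere boundedness: applied to the coefficients of a series,
  such a map yields one of the same kind, so evaluations in several variables nest without constants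
  accumulating.\<close>

definition clin :: "('a::comm_banach_algebra \<Rightarrow> 'b::comm_banach_algebra) \<Rightarrow> bool" where
  "clin h \<longleftrightarrow> linear h \<and> (\<forall>x. norm (h x) \<le> norm x)"

definition chom :: "('a::comm_banach_algebra \<Rightarrow> 'b::comm_banach_algebra) \<Rightarrow> bool" where
  "chom h \<longleftrightarrow> clin h \<and> h 1 = 1 \<and> (\<forall>x y. h (x * y) = h x * h y)"

lemma clinI:
  assumes "\<And>x y. h (x + y) = h x + h y" "\<And>r x. h (r *\<^sub>R x) = r *\<^sub>R h x" "\<And>x. norm (h x) \<le> norm x"
  shows "clin h"
  using assms by (auto simp: clin_def intro!: linearI)

lemma chomI:
  assumes "clin h" "h 1 = 1" "\<And>x y. h (x * y) = h x * h y"
  shows "chom h"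
  using assms by (auto simp: chom_def)

lemma
  assumes "clin h"
  shows clin_add: "h (x + y) = h x + h y"
    and clin_diff: "h (x - y) = h x - h y"
    and clin_scaleR: "h (r *\<^sub>R x) = r *\<^sub>R h x"
    and clin_zero: "h 0 = 0"
    and clin_minus: "h (- x) = - h x"
    and clin_norm: "norm (h x) \<le> norm x"
    and clin_bounded_linear: "bounded_linear h"
  using assms
  by (auto simp: clin_def linear_add linear_diff linear_scale linear_0 linear_neg
        intro!: bounded_linear_intro[where K = 1])

lemma
  assumes "chom h"
  shows chom_clin: "clin h" and chom_one: "h 1 = 1" and chom_mult: "h (x * y) = h x * h y"
    and chom_power: "h (x ^ n) = h x ^ n"
proof -
  show "clin h" "h 1 = 1" "h (x * y) = h x * h y" using assms by (auto simp: chom_def)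
  show "h (x ^ n) = h x ^ n" using assms by (induction n) (auto simp: chom_def)
qed

lemmas chom_add = clin_add[OF chom_clin] and chom_diff = clin_diff[OF chom_clin]
  and chom_scaleR = clin_scaleR[OF chom_clin] and chom_zero = clin_zero[OF chom_clin]
  and chom_minus = clin_minus[OF chom_clin] and chom_norm = clin_norm[OF chom_clin]
  and chom_bounded_linear = clin_bounded_linear[OF chom_clin]

lemma clin_compose: "clin g \<Longrightarrow> clin h \<Longrightarrow> clin (\<lambda>x. g (h x))"
  by (rule clinI) (auto simp: clin_add clin_scaleR intro: order_trans[OF clin_norm clin_norm])

lemma chom_compose: "chom g \<Longrightarrow> chom h \<Longrightarrow> chom (\<lambda>x. g (h x))"
  by (rule chomI) (simp_all add: chom_one chom_mult clin_compose chom_clin)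

lemma chom_id: "chom (\<lambda>x. x)"
  by (rule chomI) (auto intro!: clinI)

definition mapA :: "('a::comm_banach_algebra \<Rightarrow> 'b::comm_banach_algebra) \<Rightarrow> 'a aps \<Rightarrow> 'b aps" where
  "mapA h f = Aps (\<lambda>n. h (coef f n))"

lemma summable_norm_clin:
  assumes "clin h" shows "summable (\<lambda>n. norm (h (coef f n)))"
  by (rule summable_comparison_test[OF _ summable_norm_coef[of f]]) (use assms in \<open>auto simp: clin_norm\<close>)

lemma coef_mapA: "clin h \<Longrightarrow> coef (mapA h f) n = h (coef f n)"
  unfolding mapA_def by (intro coef_Aps summable_norm_clin)

lemma clin_mapA: assumes "clin h" shows "clin (mapA h)"
proof (rule clinI)
  show "norm (mapA h f) \<le> norm f" for f
    unfolding norm_aps_def coef_mapA[OF assms]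
    by (intro suminf_le summable_norm_clin assms summable_norm_coef clin_norm)
qed (auto intro!: aps_eqI simp: coef_mapA[OF assms] clin_add[OF assms] clin_scaleR[OF assms])

lemma clin_sum: "clin h \<Longrightarrow> h (sum f A) = (\<Sum>x\<in>A. h (f x))"
  by (simp add: clin_def linear_sum)

lemma chom_mapA: assumes "chom h" shows "chom (mapA h)"
  by (rule chomI)
     (auto intro!: aps_eqI clin_mapA chom_clin[OF assms] simp: coef_mapA[OF chom_clin[OF assms]]
       coef_one coef_mult chom_one[OF assms] chom_zero[OF assms] clin_sum[OF chom_clin[OF assms]] chom_mult[OF assms])

lemma mapA_mapA: "clin g \<Longrightarrow> clin h \<Longrightarrow> mapA g (mapA h f) = mapA (\<lambda>x. g (h x)) f"
  by (rule aps_eqI) (simp add: coef_mapA clin_compose)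

lemma mapA_id: "mapA (\<lambda>x. x) f = f"
  by (rule aps_eqI) (simp add: coef_mapA chom_clin[OF chom_id])

section \<open>Evaluation on the closed unit ball, for single and double series\<close>

definition ev :: "'a::comm_banach_algebra \<Rightarrow> 'a aps \<Rightarrow> 'a" where
  "ev t f = (\<Sum>n. coef f n * t ^ n)"

lemma norm_power_le_one: "norm t \<le> 1 \<Longrightarrow> norm (t ^ n :: 'a::real_normed_algebra_1) \<le> 1"
  by (rule order_trans[OF norm_power_ineq]) (rule power_le_one, auto)

lemma norm_ev_term: "norm t \<le> 1 \<Longrightarrow> norm (coef f n * t ^ n) \<le> norm (coef f n)"
  by (rule order_trans[OF norm_mult_ineq]) (simp add: mult_left_le norm_power_le_one)

lemma summable_norm_ev: "norm t \<le> 1 \<Longrightarrow> summable (\<lambda>n. norm (coef f n * t ^ n))"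
  by (rule summable_comparison_test[OF _ summable_norm_coef[of f]]) (use norm_ev_term in auto)

lemma summable_ev: "norm t \<le> 1 \<Longrightarrow> summable (\<lambda>n. coef f n * t ^ n)"
  by (rule summable_norm_cancel) (rule summable_norm_ev)

lemma ev_sums: "norm t \<le> 1 \<Longrightarrow> (\<lambda>n. coef f n * t ^ n) sums ev t f"
  unfolding ev_def by (rule summable_sums) (rule summable_ev)

lemma chom_ev: assumes t: "norm t \<le> 1" shows "chom (ev t)"
proof (rule chomI, rule clinI)
  show "ev t (f + g) = ev t f + ev t g" for f g
    unfolding ev_def by (simp add: distrib_right suminf_add summable_ev t)
  show "ev t (r *\<^sub>R f) = r *\<^sub>R ev t f" for r f
    unfolding ev_def by (simp add: suminf_scaleR_right summable_ev t)
  show "norm (ev t f) \<le> norm f" for f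
  proof -
    have "norm (ev t f) \<le> (\<Sum>n. norm (coef f n * t ^ n))"
      unfolding ev_def by (rule summable_norm) (rule summable_norm_ev[OF t])
    also have "\<dots> \<le> norm f"
      unfolding norm_aps_def by (intro suminf_le summable_norm_ev t summable_norm_coef norm_ev_term)
    finally show ?thesis .
  qed
  have "(\<Sum>n. coef 1 n * t ^ n) = (\<Sum>n\<in>{0}. coef 1 n * t ^ n)"
    by (rule suminf_finite) (auto simp: coef_one)
  then show "ev t 1 = 1" by (simp add: ev_def coef_one)
  show "ev t (f * g) = ev t f * ev t g" for f g
  proof -
    have "ev t f * ev t g = (\<Sum>n. \<Sum>i\<le>n. (coef f i * t ^ i) * (coef g (n - i) * t ^ (n - i)))"
      unfolding ev_def by (rule Cauchy_product) (auto intro: summable_norm_ev t)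
    also have "\<dots> = ev t (f * g)"
      unfolding ev_def coef_mult sum_distrib_right
    proof (intro suminf_cong sum.cong refl)
      fix n i :: nat assume "i \<in> {..n}"
      then have "t ^ i * t ^ (n - i) = t ^ n" by (simp flip: power_add)
      moreover have "coef f i * t ^ i * (coef g (n - i) * t ^ (n - i)) = coef f i * coef g (n - i) * (t ^ i * t ^ (n - i))"
        by (simp only: mult_ac)
      ultimately show "coef f i * t ^ i * (coef g (n - i) * t ^ (n - i)) = coef f i * coef g (n - i) * t ^ n" by simp
    qed
    finally show ?thesis ..
  qed
qed

lemmas clin_ev = chom_clin[OF chom_ev]

text \<open>On the unit ball the n-th power is Lipschitz with constant n, whence the weighted sum.
  The point \<open>p\<close> may be a double series, as in the contraction estimate, or a real
  number, as in the uniqueness estimate.\<close>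

lemma ev_lipschitz:
  assumes D: "summable (\<lambda>n. real n * norm (coef f n))" and p: "norm p \<le> 1" "norm p' \<le> 1"
  shows "norm (ev p f - ev p' f) \<le> (\<Sum>n. real n * norm (coef f n)) * norm (p - p')"
proof -
  have "ev p f - ev p' f = (\<Sum>n. coef f n * p ^ n - coef f n * p' ^ n)"
    unfolding ev_def using suminf_diff[OF summable_ev[OF p(1)] summable_ev[OF p(2)]] by simp
  also have "norm \<dots> \<le> (\<Sum>n. real n * norm (coef f n) * norm (p - p'))"
  proof (rule norm_suminf_le)
    fix n
    have "norm (coef f n * p ^ n - coef f n * p' ^ n) \<le> norm (coef f n) * norm (p ^ n - p' ^ n)"
      by (metis norm_mult_ineq right_diff_distrib)
    also have "\<dots> \<le> norm (coef f n) * (real n * norm (p - p'))"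
      using norm_power_diff[OF p, of n] by (intro mult_left_mono) auto
    finally show "norm (coef f n * p ^ n - coef f n * p' ^ n) \<le> real n * norm (coef f n) * norm (p - p')"
      by (simp add: algebra_simps)
  qed (intro summable_mult2 D)
  also have "\<dots> = (\<Sum>n. real n * norm (coef f n)) * norm (p - p')"
    by (rule suminf_mult2[OF D, symmetric])
  finally show ?thesis .
qed

text \<open>A continuous homomorphism passes through a convergent power series. With
  \<open>h\<close> an evaluation in further variables this is the substitution rule; with
  \<open>h = cnj\<close> it is Schwarz reflection.\<close>

lemma chom_ev_commute:
  assumes "chom h" "norm t \<le> 1"
  shows "h (ev t f) = ev (h t) (mapA h f)"
proof -
  have "h (ev t f) = (\<Sum>n. h (coef f n * t ^ n))"
    unfolding ev_def using bounded_linear.suminf[OF chom_bounded_linear[OF assms(1)] summable_ev[OF assms(2)]] .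
  then show ?thesis
    by (simp add: ev_def coef_mapA[OF chom_clin[OF assms(1)]] chom_mult[OF assms(1)] chom_power[OF assms(1)])
qed

definition const :: "'a::comm_banach_algebra \<Rightarrow> 'a aps" where
  "const a = Aps (\<lambda>n. if n = 0 then a else 0)"

definition var :: "'a::comm_banach_algebra aps" where
  "var = Aps (\<lambda>n. if n = 1 then 1 else 0)"

lemma coef_const: "coef (const a) n = (if n = 0 then a else 0)"
  unfolding const_def by (rule coef_Aps, rule summable_finite[of "{0}"]) auto

lemma coef_var: "coef var n = (if n = 1 then 1 else 0)"
  unfolding var_def by (rule coef_Aps, rule summable_finite[of "{1}"]) auto

lemma norm_const: "norm (const a) = norm a"
proof -
  have "norm (const a) = (\<Sum>n\<in>{0}. norm (coef (const a) n))"
    unfolding norm_aps_def by (rule suminf_finite) (auto simp: coef_const)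
  then show ?thesis by (simp add: coef_const)
qed

lemma norm_var: "norm (var :: 'a::comm_banach_algebra aps) = 1"
proof -
  have "norm (var :: 'a aps) = (\<Sum>n\<in>{1}. norm (coef (var :: 'a aps) n))"
    unfolding norm_aps_def by (rule suminf_finite) (auto simp: coef_var)
  then show ?thesis by (simp add: coef_var)
qed

lemma chom_const: "chom const"
proof (rule chomI, rule clinI)
  show "const (x * y) = const x * const y" for x y :: 'a
  proof (rule aps_eqI)
    fix n
    have "coef (const x * const y) n = (\<Sum>i\<in>{..n}. if i = 0 then x * coef (const y) n else 0)"
      unfolding coef_mult by (intro sum.cong) (auto simp: coef_const)
    also have "\<dots> = coef (const (x * y)) n"
      by (simp add: coef_const)
    finally show "coef (const (x * y)) n = coef (const x * const y) n" ..
  qed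
qed (auto intro!: aps_eqI simp: coef_const coef_one norm_const)

lemmas clin_const = chom_clin[OF chom_const]

lemma ev_const: "ev t (const a) = a"
proof -
  have "ev t (const a) = (\<Sum>n\<in>{0}. coef (const a) n * t ^ n)"
    unfolding ev_def by (rule suminf_finite) (auto simp: coef_const)
  then show ?thesis by (simp add: coef_const)
qed

lemma ev_var: "ev t var = t"
proof -
  have "ev t var = (\<Sum>n\<in>{1}. coef var n * t ^ n)"
    unfolding ev_def by (rule suminf_finite) (auto simp: coef_var)
  then show ?thesis by (simp add: coef_var)
qed

lemma ev_0: "ev 0 f = coef f 0"
proof -
  have "ev 0 f = (\<Sum>n\<in>{0}. coef f n * 0 ^ n)"
    unfolding ev_def by (rule suminf_finite) (auto simp: power_0_left)
  then show ?thesis by simp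
qed

lemma continuous_on_ev: "continuous_on (cball 0 1) (\<lambda>t. ev t f)"
proof -
  have "uniform_limit (cball 0 1) (\<lambda>N t. \<Sum>n<N. coef f n * t ^ n) (\<lambda>t. ev t f) sequentially"
    unfolding ev_def by (rule Weierstrass_m_test[OF _ summable_norm_coef[of f]]) (auto intro: norm_ev_term)
  then show ?thesis
    by (rule uniform_limit_theorem[rotated]) (auto intro!: always_eventually continuous_intros)
qed

text \<open>A double series is a series over the algebra of single series: \<open>s\<close> is the variable of the
  coefficients, \<open>t\<close> the variable of the outer series.\<close>
definition Ev :: "'a::comm_banach_algebra aps aps \<Rightarrow> 'a \<Rightarrow> 'a \<Rightarrow> 'a" where
  "Ev f s t = ev t (mapA (ev s) f)"

lemma chom_Ev: "norm s \<le> 1 \<Longrightarrow> norm t \<le> 1 \<Longrightarrow> chom (\<lambda>f. Ev f s t)"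
  unfolding Ev_def by (intro chom_compose[OF chom_ev chom_mapA] chom_ev)

text \<open>Interchange of the two summations without a double sum: \<open>ev s\<close> is a
  homomorphism that sends \<open>const t\<close> to \<open>t\<close>, so it can be pulled out of the
  outer series.\<close>

lemma Ev_swap: "norm s \<le> 1 \<Longrightarrow> norm t \<le> 1 \<Longrightarrow> Ev f s t = ev s (ev (const t) f)"
  by (simp add: chom_ev_commute chom_ev norm_const ev_const Ev_def)

lemma Ev_sums: "norm s \<le> 1 \<Longrightarrow> norm t \<le> 1 \<Longrightarrow> (\<lambda>n. ev s (coef f n) * t ^ n) sums Ev f s t"
  using ev_sums[of t "mapA (ev s) f"] by (simp add: Ev_def coef_mapA clin_ev)

lemma Ev_const: "norm s \<le> 1 \<Longrightarrow> Ev (const g) s t = ev s g"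
proof -
  assume s: "norm s \<le> 1"
  have "mapA (ev s) (const g) = const (ev s g)"
    by (rule aps_eqI) (simp add: coef_mapA clin_ev[OF s] coef_const clin_zero[OF clin_ev[OF s]])
  then show ?thesis by (simp add: Ev_def ev_const)
qed

lemma Ev_mapA_const: "norm s \<le> 1 \<Longrightarrow> Ev (mapA const g) s t = ev t g"
  by (simp add: Ev_def mapA_mapA clin_ev clin_const ev_const mapA_id)

lemma continuous_on_Ev: "continuous_on (cball 0 1 \<times> cball 0 1) (\<lambda>(s, t). Ev f s t)"
proof -
  let ?S = "cball 0 1 \<times> cball 0 1 :: ('a \<times> 'a) set"
  have "uniform_limit ?S (\<lambda>N (s, t). \<Sum>n<N. ev s (coef f n) * t ^ n)
     (\<lambda>(s, t). \<Sum>n. ev s (coef f n) * t ^ n) sequentially"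
    unfolding case_prod_unfold
  proof (rule Weierstrass_m_test[OF _ summable_norm_coef[of f]])
    fix n and x :: "'a \<times> 'a" assume "x \<in> ?S"
    then have x: "norm (fst x) \<le> 1" "norm (snd x) \<le> 1" by (auto simp: mem_Times_iff)
    show "norm (ev (fst x) (coef f n) * snd x ^ n) \<le> norm (coef f n)"
      using norm_mult_ineq[of "ev (fst x) (coef f n)" "snd x ^ n"] clin_norm[OF clin_ev[OF x(1)], of "coef f n"]
        norm_power_le_one[OF x(2), of n]
      by (smt (verit) mult_left_le norm_ge_zero)
  qed
  then have "continuous_on ?S (\<lambda>(s, t). \<Sum>n. ev s (coef f n) * t ^ n)"
  proof (rule uniform_limit_theorem[rotated])
    have "continuous_on ?S (\<lambda>x. ev (fst x) (coef f n))" for n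
      by (rule continuous_on_compose2[OF continuous_on_ev]) (auto intro!: continuous_intros)
    then show "\<forall>\<^sub>F N in sequentially. continuous_on ?S (\<lambda>(s, t). \<Sum>n<N. ev s (coef f n) * t ^ n)"
      unfolding case_prod_unfold
      by (intro always_eventually allI continuous_on_sum continuous_on_mult) (auto intro!: continuous_intros)
  qed simp
  also have "?this \<longleftrightarrow> ?thesis"
    by (intro continuous_on_cong refl) (auto simp: sums_unique[OF Ev_sums])
  finally show ?thesis .
qed

section \<open>Termwise integration and differentiation\<close>

definition integ :: "'a::comm_banach_algebra aps \<Rightarrow> 'a aps" where
  "integ f = Aps (\<lambda>n. case n of 0 \<Rightarrow> 0 | Suc m \<Rightarrow> (1 / (1 + real m)) *\<^sub>R coef f m)"

lemma summable_integ:
  "summable (\<lambda>n. norm (case n of 0 \<Rightarrow> 0 | Suc m \<Rightarrow> (1 / (1 + real m)) *\<^sub>R coef f m))"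
proof (subst summable_Suc_iff[symmetric], rule summable_comparison_test[OF _ summable_norm_coef[of f]])
qed (auto intro!: exI[of _ 0] simp: divide_simps mult_le_cancel_left1 algebra_simps)

lemma coef_integ: "coef (integ f) n = (case n of 0 \<Rightarrow> 0 | Suc m \<Rightarrow> (1 / (1 + real m)) *\<^sub>R coef f m)"
  unfolding integ_def by (rule coef_Aps) (rule summable_integ)

lemma clin_integ: "clin integ"
proof (rule clinI)
  fix f :: "'a aps"
  have "norm (integ f) = (\<Sum>n. norm (coef (integ f) (Suc n)))"
    unfolding norm_aps_def using suminf_split_head[OF summable_norm_coef[of "integ f"]]
    by (simp add: coef_integ)
  also have "\<dots> \<le> norm f"
    unfolding norm_aps_def
  proof (rule suminf_le)
    show "summable (\<lambda>n. norm (coef (integ f) (Suc n)))"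
      using summable_norm_coef[of "integ f"] by (subst summable_Suc_iff)
  qed (auto simp: coef_integ divide_simps mult_le_cancel_left1 algebra_simps)
  finally show "norm (integ f) \<le> norm f" .
qed (auto intro!: aps_eqI simp: coef_integ scaleR_add_right split: nat.split)

lemma mapA_integ: "clin h \<Longrightarrow> mapA h (integ f) = integ (mapA h f)"
  by (rule aps_eqI) (auto simp: coef_mapA coef_integ clin_zero clin_scaleR split: nat.split)

text \<open>The derivative, dilated to half the radius so that it is contractive: \<open>ev (2 * t) (der f)\<close> is the
  derivative of \<open>ev t f\<close>.\<close>
definition der :: "'a::comm_banach_algebra aps \<Rightarrow> 'a aps" where
  "der f = Aps (\<lambda>n. (real (Suc n) / 2 ^ n) *\<^sub>R coef f (Suc n))"

lemma norm_der_term: "norm ((real (Suc n) / 2 ^ n) *\<^sub>R x) \<le> norm x"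
proof -
  have "real (Suc n) \<le> 2 ^ n"
    by (induction n) auto
  then have "real (Suc n) / 2 ^ n \<le> 1" by (simp add: divide_simps)
  then show ?thesis
    unfolding norm_scaleR using mult_left_le_one_le[of "norm x" "real (Suc n) / 2 ^ n"] by simp
qed

lemma coef_der: "coef (der f) n = (real (Suc n) / 2 ^ n) *\<^sub>R coef f (Suc n)"
  unfolding der_def
proof (rule coef_Aps, rule summable_comparison_test)
  show "summable (\<lambda>n. norm (coef f (Suc n)))"
    using summable_norm_coef[of f] by (subst summable_Suc_iff)
qed (auto simp only: real_norm_def abs_norm_cancel intro!: exI[of _ 0] norm_der_term)

lemma clin_der: "clin der"
proof (rule clinI)
  fix f :: "'a aps"
  have s: "summable (\<lambda>n. norm (coef f (Suc n)))"
    using summable_norm_coef[of f] by (subst summable_Suc_iff)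
  have "norm (der f) \<le> (\<Sum>n. norm (coef f (Suc n)))"
    unfolding norm_aps_def by (rule suminf_le[OF _ summable_norm_coef s]) (simp only: coef_der norm_der_term)
  also have "\<dots> \<le> norm f"
    unfolding norm_aps_def using suminf_split_head[OF summable_norm_coef[of f]] by simp
  finally show "norm (der f) \<le> norm f" .
qed (auto intro!: aps_eqI simp: coef_der scaleR_add_right)

lemma mapA_der: "clin h \<Longrightarrow> mapA h (der f) = der (mapA h f)"
  by (rule aps_eqI) (auto simp: coef_mapA coef_der clin_scaleR)

lemma ev_has_derivative_diffs:
  fixes f :: "'a::{comm_banach_algebra, real_normed_field} aps"
  assumes "norm t < 1"
  shows "((\<lambda>t. ev t f) has_field_derivative (\<Sum>n. diffs (coef f) n * t ^ n)) (at t)"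
  unfolding ev_def by (rule termdiffs_strong[of _ 1]) (use assms in auto)

lemma ev_integ_derivative:
  fixes f :: "'a::{comm_banach_algebra, real_normed_field} aps"
  assumes "norm t < 1"
  shows "((\<lambda>t. ev t (integ f)) has_field_derivative ev t f) (at t)"
proof -
  have "diffs (coef (integ f)) n = coef f n" for n
  proof -
    have "diffs (coef (integ f)) n = of_real (real (Suc n)) * of_real (1 / (1 + real n)) * coef f n"
      by (simp add: diffs_def coef_integ scaleR_conv_of_real)
    also have "of_real (real (Suc n)) * of_real (1 / (1 + real n)) = (1 :: 'a)"
      by (subst of_real_mult[symmetric]) simp
    finally show ?thesis by simp
  qed
  then show ?thesis
    using ev_has_derivative_diffs[OF assms, of "integ f"] by (simp add: ev_def)
qed

lemma ev_der_derivative: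
  fixes f :: "'a::{comm_banach_algebra, real_normed_field} aps"
  assumes "norm t < 1 / 2"
  shows "((\<lambda>t. ev t f) has_field_derivative ev (2 * t) (der f)) (at t)"
proof -
  have "coef (der f) n * (2 * t) ^ n = diffs (coef f) n * t ^ n" for n
    by (simp add: coef_der diffs_def power_mult_distrib scaleR_conv_of_real)
  then have "(\<Sum>n. diffs (coef f) n * t ^ n) = ev (2 * t) (der f)"
    by (simp only: ev_def)
  then show ?thesis
    using ev_has_derivative_diffs[of t f] assms by simp
qed

section \<open>Two variables and real analyticity\<close>

text \<open>Meant for \<open>integ\<close> and \<open>der\<close> acting on the inner variable: they
  are not multiplicative, but they commute with multiplication by constants, in particular by the
  powers of the outer variable.\<close>

lemma ev_commute_module:
  assumes h: "clin h" and m: "\<And>x n. h (x * t ^ n) = h x * t ^ n" and t: "norm t \<le> 1"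
  shows "h (ev t f) = ev t (mapA h f)"
proof -
  have "h (ev t f) = (\<Sum>n. h (coef f n * t ^ n))"
    unfolding ev_def using bounded_linear.suminf[OF clin_bounded_linear[OF h] summable_ev[OF t]] .
  then show ?thesis by (simp add: ev_def coef_mapA h m)
qed

lemma coef_mult_const: "coef (f * const c) n = coef f n * c"
proof -
  have "coef (f * const c) n = (\<Sum>i\<in>{..n}. if i = n then coef f n * c else 0)"
    unfolding coef_mult by (intro sum.cong) (auto simp: coef_const)
  then show ?thesis by simp
qed

lemma integ_mult_const: "integ (f * const c) = integ f * const c"
  by (rule aps_eqI) (simp add: coef_mult_const coef_integ split: nat.split)

lemma der_mult_const: "der (f * const c) = der f * const c"
  by (rule aps_eqI) (simp add: coef_mult_const coef_der)

lemma Ev_integ_outer: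
  fixes f :: "'a::{comm_banach_algebra, real_normed_field} aps aps"
  assumes "norm s \<le> 1" "norm t < 1"
  shows "((\<lambda>t. Ev (integ f) s t) has_field_derivative Ev f s t) (at t)"
  unfolding Ev_def mapA_integ[OF clin_ev[OF assms(1)]] by (rule ev_integ_derivative[OF assms(2)])

lemma Ev_mapA_swap:
  assumes "norm s \<le> 1" "norm t \<le> 1" "clin h" "\<And>f c. h (f * const c) = h f * const c"
  shows "Ev (mapA h f) s t = ev s (h (ev (const t) f))"
  unfolding Ev_swap[OF assms(1,2)]
  using ev_commute_module[of h "const t" f] assms
  by (simp add: norm_const flip: chom_power[OF chom_const])

lemma has_field_derivative_transform_ball:
  fixes t :: "'a::real_normed_field"
  assumes "(f has_field_derivative d) (at t)" "norm t < e" "\<And>x. norm x < e \<Longrightarrow> f x = g x"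
  shows "(g has_field_derivative d) (at t)"
  by (rule has_field_derivative_transform_within_open[OF assms(1), of "ball 0 e"]) (use assms in auto)

lemma Ev_integ_inner:
  fixes f :: "'a::{comm_banach_algebra, real_normed_field} aps aps"
  assumes "norm s < 1" "norm t \<le> 1"
  shows "((\<lambda>s. Ev (mapA integ f) s t) has_field_derivative Ev f s t) (at s)"
proof (rule has_field_derivative_transform_ball[where e = 1])
  show "((\<lambda>s. ev s (integ (ev (const t) f))) has_field_derivative Ev f s t) (at s)"
    using ev_integ_derivative[OF assms(1), of "ev (const t) f"] assms by (simp add: Ev_swap)
qed (use assms in \<open>auto simp: Ev_mapA_swap clin_integ integ_mult_const\<close>)

lemma Ev_der_outer:
  fixes f :: "'a::{comm_banach_algebra, real_normed_field} aps aps"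
  assumes "norm s \<le> 1" "norm t < 1 / 2"
  shows "((\<lambda>t. Ev f s t) has_field_derivative Ev (der f) s (2 * t)) (at t)"
  unfolding Ev_def mapA_der[OF clin_ev[OF assms(1)]] by (rule ev_der_derivative[OF assms(2)])

lemma Ev_der_inner:
  fixes f :: "'a::{comm_banach_algebra, real_normed_field} aps aps"
  assumes "norm s < 1 / 2" "norm t \<le> 1"
  shows "((\<lambda>s. Ev f s t) has_field_derivative Ev (mapA der f) (2 * s) t) (at s)"
proof (rule has_field_derivative_transform_ball[where e = 1])
  have "ev (2 * s) (der (ev (const t) f)) = Ev (mapA der f) (2 * s) t"
    using assms by (subst Ev_mapA_swap) (auto simp: clin_der der_mult_const norm_mult)
  then show "((\<lambda>s. ev s (ev (const t) f)) has_field_derivative Ev (mapA der f) (2 * s) t) (at s)"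
    using ev_der_derivative[OF assms(1), of "ev (const t) f"] by simp
qed (use assms in \<open>auto simp: Ev_swap\<close>)

text \<open>Both partials exist and the one in \<open>t\<close> is jointly continuous, which gives a
  total derivative. The radius 1 / 2 comes from the doubled argument of \<open>der\<close>;
  \<open>Ev_joint_ex\<close> reaches the whole open bidisc by recentring.\<close>

lemma Ev_joint_near_0:
  fixes f :: "'a::{comm_banach_algebra, real_normed_field} aps aps"
  assumes st: "norm s < 1 / 2" "norm t < 1 / 2"
  shows "((\<lambda>(s, t). Ev f s t) has_derivative
          (\<lambda>(h, k). Ev (mapA der f) (2 * s) t * h + Ev (der f) s (2 * t) * k)) (at (s, t))"
proof -
  let ?B = "ball 0 (1/2) :: 'a set"
  have "((\<lambda>(s, t). Ev f s t) has_derivative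
     (\<lambda>(h, k). Ev (mapA der f) (2 * s) t * h + blinfun_mult_right (Ev (der f) s (2 * t)) k))
     (at (s, t) within ?B \<times> ?B)"
  proof (rule has_derivative_partialsI[where f = "Ev f" and fx = "(*) (Ev (mapA der f) (2 * s) t)"
        and fy = "\<lambda>x y. blinfun_mult_right (Ev (der f) x (2 * y))"])
    show "((\<lambda>x. Ev f x t) has_derivative (*) (Ev (mapA der f) (2 * s) t)) (at s within ?B)"
      using Ev_der_inner[of s t f] st by (auto simp: has_field_derivative_def intro: has_derivative_at_withinI)
    show "(Ev f x has_derivative blinfun_apply (blinfun_mult_right (Ev (der f) x (2 * y)))) (at y within ?B)"
      if "x \<in> ?B" "y \<in> ?B" for x y
      using Ev_der_outer[of x y f] that
      by (auto simp: has_field_derivative_def intro: has_derivative_at_withinI)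
    have "continuous_on (?B \<times> ?B) (\<lambda>z. (\<lambda>(s, t). Ev (der f) s t) (fst z, 2 * snd z))"
      by (rule continuous_on_compose2[OF continuous_on_Ev], (intro continuous_intros)[1])
         (auto simp: norm_mult)
    then have "continuous_on (?B \<times> ?B) (\<lambda>(x, y). blinfun_mult_right (Ev (der f) x (2 * y)))"
      by (simp add: case_prod_unfold bounded_linear.continuous_on[OF bounded_linear_blinfun_mult_right])
    then show "continuous (at (s, t) within ?B \<times> ?B) (\<lambda>(x, y). blinfun_mult_right (Ev (der f) x (2 * y)))"
      using st by (simp add: continuous_on_eq_continuous_within)
  qed (use st in auto)
  moreover have "at (s, t) within ?B \<times> ?B = at (s, t)"
    using st by (intro at_within_open) (auto simp: open_Times)
  ultimately show ?thesis by simp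
qed

section \<open>Substitution and recentring\<close>

definition subst2 :: "'a::comm_banach_algebra aps aps \<Rightarrow> 'a aps aps \<Rightarrow> 'a aps aps \<Rightarrow> 'a aps aps" where
  "subst2 P Q f = ev Q (mapA (\<lambda>g. ev P (mapA (\<lambda>a. const (const a)) g)) f)"

text \<open>Evaluation at \<open>(s, t)\<close> is a homomorphism from double series to scalars, so
  it passes through the evaluations at \<open>P\<close> and at \<open>Q\<close>; on scalars lifted
  by \<open>const (const a)\<close> it is the identity.\<close>

lemma Ev_subst2:
  assumes P: "norm P \<le> 1" and Q: "norm Q \<le> 1" and st: "norm s \<le> 1" "norm t \<le> 1"
  shows "Ev (subst2 P Q f) s t = Ev f (Ev P s t) (Ev Q s t)"
proof -
  note cc = chom_compose[OF chom_const chom_const]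
  note E = chom_Ev[OF st]
  note cm = chom_compose[OF chom_ev[OF P] chom_mapA[OF cc]]
  have "Ev (ev P (mapA (\<lambda>a. const (const a)) g)) s t = ev (Ev P s t) g" for g
    by (simp add: chom_ev_commute[OF E P] mapA_mapA chom_clin[OF E] chom_clin[OF cc] Ev_const ev_const mapA_id st)
  then show ?thesis
    unfolding subst2_def
    by (simp add: chom_ev_commute[OF E Q] mapA_mapA chom_clin[OF E] chom_clin[OF cm]) (simp add: Ev_def)
qed

lemma Ev_var_inner: "norm s \<le> 1 \<Longrightarrow> Ev (const var) s t = s"
  by (simp add: Ev_const ev_var)

lemma Ev_var_outer: "norm s \<le> 1 \<Longrightarrow> Ev var s t = t"
proof -
  assume s: "norm s \<le> 1"
  have "mapA (ev s) var = var"
    by (rule aps_eqI) (simp add: coef_mapA clin_ev[OF s] coef_var clin_zero[OF clin_ev[OF s]] chom_one[OF chom_ev[OF s]])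
  then show ?thesis by (simp add: Ev_def ev_var)
qed

text \<open>Expansion about another point is substitution of shifted series. The norm condition
  keeps them in the unit ball of the algebra, so no binomial rearrangement is involved.
  \<open>P\<close> and \<open>Q\<close> stay general because the passage to real coordinates also
  needs a complex linear change of variables.\<close>

lemma Ev_recenter:
  fixes f :: "'a::comm_banach_algebra aps aps"
  assumes "norm (const (const s0) + P) \<le> 1" "norm (const (const t0) + Q) \<le> 1"
  shows "\<exists>g. \<forall>s t. norm s \<le> 1 \<longrightarrow> norm t \<le> 1 \<longrightarrow> Ev g s t = Ev f (s0 + Ev P s t) (t0 + Ev Q s t)"
  by (rule exI[of _ "subst2 (const (const s0) + P) (const (const t0) + Q) f"])
     (use assms in \<open>simp add: Ev_subst2 chom_add[OF chom_Ev] Ev_const ev_const\<close>)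

text \<open>Recentre at the given point, on the largest bidisc that fits, and transport
  differentiability at the origin back by an affine map.\<close>

lemma Ev_joint_ex:
  fixes f :: "'a::{comm_banach_algebra, real_normed_field} aps aps"
  assumes st: "norm s0 < 1" "norm t0 < 1"
  shows "\<exists>d1 d2. ((\<lambda>(s, t). Ev f s t) has_derivative (\<lambda>(h, k). d1 * h + d2 * k)) (at (s0, t0))"
proof -
  define r where "r = min (1 - norm s0) (1 - norm t0)"
  have r: "r > 0" "norm s0 + r \<le> 1" "norm t0 + r \<le> 1" using st by (auto simp: r_def)
  have "norm (const (const s0) + r *\<^sub>R const var :: 'a aps aps) \<le> norm s0 + r"
       "norm (const (const t0) + r *\<^sub>R var :: 'a aps aps) \<le> norm t0 + r"
    using r by (auto intro!: order_trans[OF norm_triangle_ineq] simp: norm_const norm_var)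
  then obtain g :: "'a aps aps" where g: "\<And>s t. norm s \<le> 1 \<Longrightarrow> norm t \<le> 1 \<Longrightarrow>
      Ev g s t = Ev f (s0 + Ev (r *\<^sub>R const var) s t) (t0 + Ev (r *\<^sub>R var) s t)"
    using Ev_recenter[of s0 "r *\<^sub>R const var" t0 "r *\<^sub>R var" f] r by (meson order_trans)
  then have g: "Ev g s t = Ev f (s0 + r *\<^sub>R s) (t0 + r *\<^sub>R t)" if "norm s \<le> 1" "norm t \<le> 1" for s t
    using that by (simp add: chom_scaleR[OF chom_Ev] Ev_var_inner Ev_var_outer)
  define T where "T = (\<lambda>z::'a \<times> 'a. (inverse r *\<^sub>R (fst z - s0), inverse r *\<^sub>R (snd z - t0)))"
  have T0: "T (s0, t0) = (0, 0)" by (simp add: T_def)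
  have dT: "(T has_derivative (\<lambda>z. (inverse r *\<^sub>R fst z, inverse r *\<^sub>R snd z))) (at (s0, t0))"
    unfolding T_def by (auto intro!: derivative_eq_intros)
  define e1 e2 where "e1 = Ev (mapA der g) 0 0" and "e2 = Ev (der g) 0 0"
  have "((\<lambda>(s, t). Ev g s t) has_derivative (\<lambda>(h, k). e1 * h + e2 * k)) (at (T (s0, t0)))"
    using Ev_joint_near_0[of 0 0 g] by (simp add: T0 e1_def e2_def)
  from has_derivative_compose[OF dT this]
  have "((\<lambda>z. case T z of (s, t) \<Rightarrow> Ev g s t) has_derivative
     (\<lambda>(h, k). (inverse r *\<^sub>R e1) * h + (inverse r *\<^sub>R e2) * k)) (at (s0, t0))"
    by (simp add: case_prod_unfold)
  then have "((\<lambda>(s, t). Ev f s t) has_derivative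
     (\<lambda>(h, k). (inverse r *\<^sub>R e1) * h + (inverse r *\<^sub>R e2) * k)) (at (s0, t0))"
  proof (rule has_derivative_transform_within_open)
    show "open (ball s0 r \<times> ball t0 r)" by (simp add: open_Times)
    fix z assume "z \<in> ball s0 r \<times> ball t0 r"
    then have "norm (fst z - s0) < r" "norm (snd z - t0) < r"
      by (auto simp: dist_norm norm_minus_commute mem_Times_iff)
    then have "norm (inverse r *\<^sub>R (fst z - s0)) \<le> 1" "norm (inverse r *\<^sub>R (snd z - t0)) \<le> 1"
      unfolding norm_scaleR using r by (auto simp: field_simps)
    then show "(case T z of (s, t) \<Rightarrow> Ev g s t) = (case z of (s, t) \<Rightarrow> Ev f s t)"
      using r by (simp add: T_def g case_prod_unfold)
  qed (use r in auto)
  then show ?thesis by blast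
qed

lemma Ev_joint:
  fixes f :: "'a::{comm_banach_algebra, real_normed_field} aps aps"
  assumes st: "norm s < 1" "norm t < 1"
    and d1: "((\<lambda>s. Ev f s t) has_field_derivative d1) (at s)"
    and d2: "((\<lambda>t. Ev f s t) has_field_derivative d2) (at t)"
  shows "((\<lambda>(s, t). Ev f s t) has_derivative (\<lambda>(h, k). d1 * h + d2 * k)) (at (s, t))"
proof -
  obtain e1 e2 where e: "((\<lambda>(s, t). Ev f s t) has_derivative (\<lambda>(h, k). e1 * h + e2 * k)) (at (s, t))"
    using Ev_joint_ex[OF st] by blast
  have "((\<lambda>x. (x, t)) has_derivative (\<lambda>x. (x, 0))) (at s)" by (auto intro!: derivative_eq_intros)
  from has_derivative_compose[OF this e] have "((\<lambda>s. Ev f s t) has_field_derivative e1) (at s)"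
    by (simp add: has_field_derivative_def)
  then have "e1 = d1" using d1 by (rule DERIV_unique)
  have "((\<lambda>x. (s, x)) has_derivative (\<lambda>x. (0, x))) (at t)" by (auto intro!: derivative_eq_intros)
  from has_derivative_compose[OF this e] have "((\<lambda>t. Ev f s t) has_field_derivative e2) (at t)"
    by (simp add: has_field_derivative_def)
  then have "e2 = d2" using d2 by (rule DERIV_unique)
  with \<open>e1 = d1\<close> e show ?thesis by simp
qed

text \<open>The local normal form of analyticity: a Taylor series, absolutely summable on a closed square
  of half-side \<open>r\<close> around the point, rescaled to the unit square.\<close>
definition loc_an :: "(real \<times> real \<Rightarrow> real) \<Rightarrow> real \<times> real \<Rightarrow> bool" where
  "loc_an f p \<longleftrightarrow> (\<exists>r>0. \<exists>F. \<forall>s t. \<bar>s\<bar> \<le> 1 \<longrightarrow> \<bar>t\<bar> \<le> 1 \<longrightarrow> f (fst p + r * s, snd p + r * t) = Ev F s t)"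

text \<open>The nested norms give absolute summability over pairs, so the iterated sum may be read
  as an unordered one. The outer index of \<open>F\<close> is the exponent of \<open>t\<close>,
  hence the swap of indices at the end.\<close>

lemma Ev_has_sum:
  fixes F :: "'a::{comm_banach_algebra, real_normed_field} aps aps"
  assumes "norm s \<le> 1" "norm t \<le> 1"
  shows "((\<lambda>(i, j). coef (coef F j) i * s ^ i * t ^ j) has_sum Ev F s t) UNIV"
proof -
  let ?a = "\<lambda>(j, i). coef (coef F j) i * s ^ i * t ^ j"
  have inner: "((\<lambda>i. norm (coef (coef F j) i)) has_sum norm (coef F j)) UNIV" for j
    unfolding norm_aps_def by (rule norm_summable_imp_has_sum) (auto intro: summable_sums)
  have "(\<lambda>z. norm ((\<lambda>(j, i). coef (coef F j) i) z)) summable_on UNIV \<times> UNIV"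
  proof (rule iffD2[OF Infinite_Sum.abs_summable_on_Sigma_iff], intro conjI ballI)
    show "(\<lambda>y. norm (case (x, y) of (j, i) \<Rightarrow> coef (coef F j) i)) summable_on UNIV" for x
      using inner[of x] by (auto simp: summable_on_def)
    have "(\<lambda>x. norm (coef F x)) summable_on UNIV"
      by (rule norm_summable_imp_summable_on) simp
    then show "(\<lambda>x. norm (infsum (\<lambda>y. norm (case (x, y) of (j, i) \<Rightarrow> coef (coef F j) i)) UNIV)) summable_on UNIV"
      using infsumI[OF inner] by simp
  qed
  then have "(\<lambda>z. norm (?a z)) summable_on UNIV \<times> UNIV"
  proof (rule Infinite_Sum.abs_summable_on_comparison_test)
    show "norm (?a x) \<le> norm ((\<lambda>(j, i). coef (coef F j) i) x)" for x
      using norm_power_le_one[OF assms(1), of "snd x"] norm_power_le_one[OF assms(2), of "fst x"]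
      by (simp add: case_prod_unfold norm_mult mult.assoc mult_left_le mult_le_one)
  qed
  then have sm: "?a summable_on UNIV \<times> UNIV" by (rule abs_summable_summable)
  have "((\<lambda>j. ev s (coef F j) * t ^ j) has_sum Ev F s t) UNIV"
    using summable_norm_ev[OF assms(2), of "mapA (ev s) F"] Ev_sums[OF assms, of F]
    by (intro norm_summable_imp_has_sum) (auto simp: coef_mapA clin_ev assms)
  moreover have "((\<lambda>i. ?a (j, i)) has_sum ev s (coef F j) * t ^ j) UNIV" for j
    using norm_summable_imp_has_sum[OF summable_norm_ev ev_sums, OF assms(1) assms(1), of "coef F j"]
    by (auto intro: has_sum_cmult_left)
  ultimately have "(?a has_sum Ev F s t) (UNIV \<times> UNIV)"
    by (intro has_sum_SigmaI[OF _ _ sm]) auto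
  then have "(?a has_sum Ev F s t) (prod.swap ` (UNIV \<times> UNIV))" by simp
  then show ?thesis
    by (subst (asm) has_sum_reindex) (auto simp: o_def case_prod_unfold)
qed

lemma loc_an_imp_has_sum:
  assumes "loc_an f p"
  shows "\<exists>c. \<exists>r>0. \<forall>q. dist q p < r \<longrightarrow>
          ((\<lambda>(i, j). c i j * (fst q - fst p) ^ i * (snd q - snd p) ^ j) has_sum f q) UNIV"
proof -
  obtain r F where r: "r > 0" and F: "\<And>s t. \<bar>s\<bar> \<le> 1 \<Longrightarrow> \<bar>t\<bar> \<le> 1 \<Longrightarrow> f (fst p + r * s, snd p + r * t) = Ev F s t"
    using assms by (auto simp: loc_an_def)
  show ?thesis
  proof (intro exI[of _ "\<lambda>i j. coef (coef F j) i / r ^ (i + j)"] exI[of _ r] conjI allI impI r)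
    fix q :: "real \<times> real" assume "dist q p < r"
    then have q: "\<bar>fst q - fst p\<bar> \<le> r" "\<bar>snd q - snd p\<bar> \<le> r"
      using dist_fst_le[of q p] dist_snd_le[of q p] by (auto simp: dist_real_def)
    define s t where "s = (fst q - fst p) / r" and "t = (snd q - snd p) / r"
    have st: "\<bar>s\<bar> \<le> 1" "\<bar>t\<bar> \<le> 1" "fst q - fst p = r * s" "snd q - snd p = r * t"
      using q r by (auto simp: s_def t_def)
    have "f q = Ev F s t"
      using F[OF st(1,2)] st(3,4) by (metis add_diff_cancel_left' add_diff_eq prod.collapse)
    then show "((\<lambda>(i, j). coef (coef F j) i / r ^ (i + j) * (fst q - fst p) ^ i * (snd q - snd p) ^ j) has_sum f q) UNIV"
      using Ev_has_sum[of s t F] st r by (simp add: power_mult_distrib power_add mult.assoc)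
  qed
qed

text \<open>A square of half-side \<open>r / 2\<close> has its corners at distance
  \<open>r / sqrt 2\<close>, so it lies in the disk where the expansion holds.\<close>

lemma has_sum_imp_loc_an:
  assumes r: "r > 0" and c: "\<And>q. dist q p < r \<Longrightarrow>
          ((\<lambda>(i, j). c i j * (fst q - fst p) ^ i * (snd q - snd p) ^ j) has_sum f q) UNIV"
  shows "loc_an f p"
proof -
  define r' where "r' = r / 2"
  have r': "r' > 0" using r by (simp add: r'_def)
  have near: "dist (fst p + r' * s, snd p + r' * t) p < r" if "\<bar>s\<bar> \<le> 1" "\<bar>t\<bar> \<le> 1" for s t
  proof -
    have "s\<^sup>2 \<le> 1" "t\<^sup>2 \<le> 1" using that by (simp_all add: abs_square_le_1)
    then have "(s\<^sup>2 + t\<^sup>2) * (r'\<^sup>2) \<le> 2 * r'\<^sup>2" by (intro mult_right_mono) auto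
    also have "\<dots> < r\<^sup>2" using r by (simp add: r'_def power2_eq_square)
    finally have "sqrt ((s\<^sup>2 + t\<^sup>2) * (r'\<^sup>2)) < r" by (simp add: r less_imp_le real_less_lsqrt)
    moreover have "dist (fst p + r' * s, snd p + r' * t) p = sqrt ((s\<^sup>2 + t\<^sup>2) * (r'\<^sup>2))"
      by (cases p) (simp add: dist_Pair_Pair dist_real_def power_mult_distrib algebra_simps)
    ultimately show ?thesis by simp
  qed
  define a where "a = (\<lambda>i j. c i j * r' ^ i * r' ^ j)"
  \<comment> \<open>At the corner \<open>(1, 1)\<close> the expansion is the sum of the rescaled
    coefficients themselves; real unordered sums converge absolutely, which gives the nested
    norms.\<close>
  have "(\<lambda>(i, j). a i j) summable_on UNIV"
    using c[OF near[of 1 1]] by (auto simp: a_def summable_on_def)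
  then have "((\<lambda>(i, j). a i j) \<circ> prod.swap) summable_on UNIV"
    by (subst summable_on_reindex[symmetric]) auto
  then have "(\<lambda>(j, i). a i j) summable_on UNIV \<times> UNIV"
    by (simp add: o_def case_prod_unfold)
  then have "(\<lambda>z. norm ((\<lambda>(j, i). a i j) z)) summable_on UNIV \<times> UNIV"
    by (rule iffD1[OF summable_on_iff_abs_summable_on_real])
  from iffD1[OF Infinite_Sum.abs_summable_on_Sigma_iff this]
  have s1: "(\<lambda>i. norm (a i j)) summable_on UNIV"
    and s2: "(\<lambda>j. infsum (\<lambda>i. norm (a i j)) UNIV) summable_on UNIV" for j
    by (simp_all add: iffD2[OF summable_on_iff_abs_summable_on_real])
  define G where "G = (\<lambda>j. Aps (\<lambda>i. a i j))"
  have s1': "summable (\<lambda>i. norm (a i j))" for j using s1 by (rule summable_on_imp_summable)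
  have G: "coef (G j) i = a i j" for i j
    unfolding G_def by (rule coef_Aps) (rule s1')
  have "norm (G j) = infsum (\<lambda>i. norm (a i j)) UNIV" for j
    unfolding norm_aps_def G
    using has_sum_imp_sums[OF has_sum_infsum[OF s1, of j]] by (simp add: sums_iff)
  then have sG: "summable (\<lambda>j. norm (G j))"
    using summable_on_imp_summable[OF s2] by simp
  define F where "F = Aps G"
  have F: "coef (coef F j) i = a i j" for i j
    unfolding F_def coef_Aps[OF sG] G ..
  have "f (fst p + r' * s, snd p + r' * t) = Ev F s t" if "\<bar>s\<bar> \<le> 1" "\<bar>t\<bar> \<le> 1" for s t
  proof (rule has_sum_unique)
    show "((\<lambda>(i, j). a i j * s ^ i * t ^ j) has_sum Ev F s t) UNIV"
      using Ev_has_sum[of s t F] that by (simp add: F)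
    show "((\<lambda>(i, j). a i j * s ^ i * t ^ j) has_sum f (fst p + r' * s, snd p + r' * t)) UNIV"
      using c[OF near[OF that]] by (simp add: a_def power_mult_distrib algebra_simps)
  qed
  then show ?thesis using r' unfolding loc_an_def by (intro exI[of _ r'] exI[of _ F] conjI) auto
qed

lemma real_analytic2_on_iff: "real_analytic2_on f S \<longleftrightarrow> (\<forall>p\<in>S. loc_an f p)"
  unfolding real_analytic2_on_def
proof (intro ball_cong refl iffI)
  fix p
  assume "\<exists>c. \<exists>r>0. \<forall>q. dist q p < r \<longrightarrow>
          ((\<lambda>(i, j). c i j * (fst q - fst p) ^ i * (snd q - snd p) ^ j) has_sum f q) UNIV"
  then obtain c r where "r > 0" and c: "\<forall>q. dist q p < r \<longrightarrow>
          ((\<lambda>(i, j). c i j * (fst q - fst p) ^ i * (snd q - snd p) ^ j) has_sum f q) UNIV"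
    by (elim exE conjE)
  then show "loc_an f p" by (intro has_sum_imp_loc_an[of r p c]) auto
qed (rule loc_an_imp_has_sum)

section \<open>The characteristic problem\<close>

text \<open>\<open>var\<close> is the inner variable regarded as a point of the coefficient algebra,
  so this is the single series of \<open>f (t, t)\<close>.\<close>

definition diag :: "'a::comm_banach_algebra aps aps \<Rightarrow> 'a aps" where
  "diag f = ev var f"

lemma clin_diag: "clin diag"
  unfolding diag_def[abs_def] by (rule clin_ev) (simp add: norm_var)

lemma ev_diag: "norm t \<le> 1 \<Longrightarrow> ev t (diag f) = Ev f t t"
  by (simp add: diag_def chom_ev_commute[OF chom_ev] norm_var ev_var Ev_def)

text \<open>\<open>dif_s\<close>, \<open>dif_t\<close> and \<open>sol\<close> are the first derivatives and the primitive of the function with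
  mixed derivative \<open>w\<close> and first derivatives \<open>\<alpha>\<close>, \<open>\<beta>\<close> on the diagonal.\<close>
definition dif_s :: "'a::comm_banach_algebra aps \<Rightarrow> 'a aps aps \<Rightarrow> 'a aps aps" where
  "dif_s \<alpha> w = const (\<alpha> - diag (integ w)) + integ w"

definition dif_t :: "'a::comm_banach_algebra aps \<Rightarrow> 'a aps aps \<Rightarrow> 'a aps aps" where
  "dif_t \<beta> w = mapA const (\<beta> - diag (mapA integ w)) + mapA integ w"

definition sol :: "'a::comm_banach_algebra aps \<Rightarrow> 'a aps \<Rightarrow> 'a aps aps \<Rightarrow> 'a aps aps" where
  "sol \<alpha> \<beta> w = const (integ (\<alpha> - diag (integ w))) + mapA const (integ (\<beta> - diag (mapA integ w)))
     + mapA integ (integ w)"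

lemmas clin_mapA_integ = clin_mapA[OF clin_integ]
lemmas clin_mapA_const = clin_mapA[OF clin_const]

lemma norm_triangle_le3: "norm x \<le> a \<Longrightarrow> norm y \<le> b \<Longrightarrow> norm z \<le> c \<Longrightarrow> norm (x + y + z) \<le> a + b + c"
  by (meson add_mono norm_triangle_le norm_triangle_mono)

lemma norm_diag_integ: "norm (diag (integ w)) \<le> norm w"
  by (meson clin_norm clin_diag clin_integ order_trans)

lemma norm_diag_mapA_integ: "norm (diag (mapA integ w)) \<le> norm w"
  by (meson clin_norm clin_diag clin_mapA_integ order_trans)

lemma norm_dif_s: "norm (dif_s \<alpha> w) \<le> norm \<alpha> + 2 * norm w"
proof -
  have "norm (dif_s \<alpha> w) \<le> norm (\<alpha> - diag (integ w)) + norm (integ w)"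
    unfolding dif_s_def by (rule order_trans[OF norm_triangle_ineq]) (simp add: norm_const)
  then show ?thesis
    using norm_triangle_ineq4[of \<alpha> "diag (integ w)"] norm_diag_integ[of w] clin_norm[OF clin_integ, of w] by linarith
qed

lemma norm_dif_t: "norm (dif_t \<beta> w) \<le> norm \<beta> + 2 * norm w"
proof -
  have "norm (dif_t \<beta> w) \<le> norm (\<beta> - diag (mapA integ w)) + norm (mapA integ w)"
    unfolding dif_t_def by (rule order_trans[OF norm_triangle_ineq]) (simp add: clin_norm clin_mapA_const)
  then show ?thesis
    using norm_triangle_ineq4[of \<beta> "diag (mapA integ w)"] norm_diag_mapA_integ[of w]
      clin_norm[OF clin_mapA_integ, of w] by linarith
qed

lemma norm_sol: "norm (sol \<alpha> \<beta> w) \<le> norm \<alpha> + norm \<beta> + 3 * norm w"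
proof -
  have "norm (const (integ (\<alpha> - diag (integ w)))) \<le> norm (\<alpha> - diag (integ w))"
    by (simp add: norm_const clin_norm clin_integ)
  moreover have "norm (mapA const (integ (\<beta> - diag (mapA integ w)))) \<le> norm (\<beta> - diag (mapA integ w))"
    by (meson clin_norm clin_mapA_const clin_integ order_trans)
  moreover have "norm (mapA integ (integ w)) \<le> norm w"
    by (meson clin_norm clin_mapA_integ clin_integ order_trans)
  ultimately have "norm (sol \<alpha> \<beta> w) \<le> norm (\<alpha> - diag (integ w)) + norm (\<beta> - diag (mapA integ w)) + norm w"
    unfolding sol_def by (rule norm_triangle_le3)
  then show ?thesis
    using norm_triangle_ineq4[of \<alpha> "diag (integ w)"] norm_diag_integ[of w]
      norm_triangle_ineq4[of \<beta> "diag (mapA integ w)"] norm_diag_mapA_integ[of w] by linarith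
qed

lemma dif_s_diff: "dif_s \<alpha> w - dif_s \<alpha> w' = dif_s 0 (w - w')"
  by (simp add: dif_s_def clin_diff clin_diag clin_integ clin_const algebra_simps clin_minus clin_add)

lemma dif_t_diff: "dif_t \<beta> w - dif_t \<beta> w' = dif_t 0 (w - w')"
  by (simp add: dif_t_def clin_diff clin_diag clin_mapA_integ clin_mapA_const algebra_simps clin_minus clin_add)

lemma sol_diff: "sol \<alpha> \<beta> w - sol \<alpha> \<beta> w' = sol 0 0 (w - w')"
  by (simp add: sol_def clin_diff clin_diag clin_mapA_integ clin_mapA_const clin_const clin_integ
      algebra_simps clin_minus clin_add)

text \<open>The terms that correct the values on the diagonal depend on one variable only and so
  disappear from the mixed derivative. For the \<open>t\<close>-derivative of \<open>sol\<close> the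
  two integrations have to be interchanged, which is \<open>mapA_integ\<close>.\<close>

lemma
  fixes w :: "'a::{comm_banach_algebra, real_normed_field} aps aps"
  assumes st: "norm s < 1" "norm t < 1"
  shows sol_derivative_s: "((\<lambda>s. Ev (sol \<alpha> \<beta> w) s t) has_field_derivative Ev (dif_s \<alpha> w) s t) (at s)"
    and sol_derivative_t: "((\<lambda>t. Ev (sol \<alpha> \<beta> w) s t) has_field_derivative Ev (dif_t \<beta> w) s t) (at t)"
    and dif_s_derivative_t: "((\<lambda>t. Ev (dif_s \<alpha> w) s t) has_field_derivative Ev w s t) (at t)"
    and dif_t_derivative_s: "((\<lambda>s. Ev (dif_t \<beta> w) s t) has_field_derivative Ev w s t) (at s)"
proof -
  define a where "a = \<alpha> - diag (integ w)"
  define b where "b = \<beta> - diag (mapA integ w)"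
  have sl: "Ev (sol \<alpha> \<beta> w) s t = ev s (integ a) + ev t (integ b) + Ev (mapA integ (integ w)) s t"
    and ds: "Ev (dif_s \<alpha> w) s t = ev s a + Ev (integ w) s t"
    and dt: "Ev (dif_t \<beta> w) s t = ev t b + Ev (mapA integ w) s t" if "norm s < 1" "norm t < 1" for s t
    using that by (simp_all add: sol_def dif_s_def dif_t_def chom_add[OF chom_Ev] Ev_const Ev_mapA_const a_def b_def)
  note tr = has_field_derivative_transform_ball[where e = 1]
  have comm: "mapA integ (integ w) = integ (mapA integ w)" by (rule mapA_integ[OF clin_integ])
  have "((\<lambda>s. ev s (integ a) + ev t (integ b) + Ev (mapA integ (integ w)) s t) has_field_derivative
      (ev s a + 0 + Ev (integ w) s t)) (at s)"
    using st by (intro DERIV_add DERIV_const ev_integ_derivative Ev_integ_inner) auto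
  from tr[OF this] show "((\<lambda>s. Ev (sol \<alpha> \<beta> w) s t) has_field_derivative Ev (dif_s \<alpha> w) s t) (at s)"
    using st by (simp add: sl ds)
  have "((\<lambda>t. ev s (integ a) + ev t (integ b) + Ev (integ (mapA integ w)) s t) has_field_derivative
      (0 + ev t b + Ev (mapA integ w) s t)) (at t)"
    using st by (intro DERIV_add DERIV_const ev_integ_derivative Ev_integ_outer) auto
  from tr[OF this] show "((\<lambda>t. Ev (sol \<alpha> \<beta> w) s t) has_field_derivative Ev (dif_t \<beta> w) s t) (at t)"
    using st by (simp add: sl dt comm)
  have "((\<lambda>t. ev s a + Ev (integ w) s t) has_field_derivative (0 + Ev w s t)) (at t)"
    using st by (intro DERIV_add DERIV_const Ev_integ_outer) auto
  from tr[OF this] show "((\<lambda>t. Ev (dif_s \<alpha> w) s t) has_field_derivative Ev w s t) (at t)"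
    using st by (simp add: ds)
  have "((\<lambda>s. ev t b + Ev (mapA integ w) s t) has_field_derivative (0 + Ev w s t)) (at s)"
    using st by (intro DERIV_add DERIV_const Ev_integ_inner) auto
  from tr[OF this] show "((\<lambda>s. Ev (dif_t \<beta> w) s t) has_field_derivative Ev w s t) (at s)"
    using st by (simp add: dt)
qed

lemma ev_0_integ: "ev 0 (integ f) = 0"
  by (simp add: ev_0 coef_integ)

lemma
  assumes "norm t \<le> 1"
  shows dif_s_diag: "Ev (dif_s \<alpha> w) t t = ev t \<alpha>" and dif_t_diag: "Ev (dif_t \<beta> w) t t = ev t \<beta>"
  using assms
  by (simp_all add: dif_s_def dif_t_def chom_add[OF chom_Ev] Ev_const Ev_mapA_const clin_diff clin_ev ev_diag)

lemma sol_0: "Ev (sol \<alpha> \<beta> w) 0 0 = 0"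
proof -
  have "Ev (mapA integ (integ w)) 0 0 = 0"
    using mapA_integ[OF clin_integ, of w] by (simp add: Ev_def mapA_integ[OF clin_ev] ev_0_integ)
  then show ?thesis
    by (simp add: sol_def chom_add[OF chom_Ev] Ev_const Ev_mapA_const ev_0_integ)
qed

section \<open>Reflection symmetry and reality\<close>

definition symc :: "complex aps \<Rightarrow> complex aps \<Rightarrow> bool" where
  "symc a b \<longleftrightarrow> (\<forall>t. norm t < 1 \<longrightarrow> ev t b = cnj (ev (cnj t) a))"

text \<open>On the real plane \<open>t = cnj s\<close>, so there the condition reads
  \<open>f = cnj g\<close>, and \<open>symr f f\<close> makes \<open>f\<close> real. With both
  variables free the condition survives integration in one of them.\<close>

definition symr :: "complex aps aps \<Rightarrow> complex aps aps \<Rightarrow> bool" where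
  "symr f g \<longleftrightarrow> (\<forall>s t. norm s < 1 \<longrightarrow> norm t < 1 \<longrightarrow> Ev f s t = cnj (Ev g (cnj t) (cnj s)))"

lemma symc_diff: "symc a b \<Longrightarrow> symc a' b' \<Longrightarrow> symc (a - a') (b - b')"
  by (simp add: symc_def clin_diff clin_ev)

text \<open>Conjugating argument and value preserves holomorphy, so the two sides differ by a
  holomorphic function with derivative 0, and both vanish at 0.\<close>

lemma symc_integ:
  assumes "symc a b" shows "symc (integ a) (integ b)"
  unfolding symc_def
proof (intro allI impI)
  define h where "h = (\<lambda>t. ev t (integ b) - cnj (ev (cnj t) (integ a)))"
  have "\<exists>c. \<forall>t\<in>ball 0 1. h t = c"
  proof (rule has_field_derivative_zero_constant)
    fix t :: complex assume "t \<in> ball 0 1"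
    then have t: "norm t < 1" by simp
    have "((cnj \<circ> (\<lambda>t. ev t (integ a)) \<circ> cnj) has_field_derivative cnj (ev (cnj t) a)) (at t)"
      using t by (intro has_field_derivative_cnj_cnj ev_integ_derivative) simp
    then have "(h has_field_derivative (ev t b - cnj (ev (cnj t) a))) (at t)"
      unfolding h_def using t by (intro DERIV_diff ev_integ_derivative) (auto simp: o_def)
    then show "(h has_field_derivative 0) (at t within ball 0 1)"
      using assms t by (auto simp: symc_def intro: has_field_derivative_at_within)
  qed simp
  then obtain c where c: "\<And>t. norm t < 1 \<Longrightarrow> h t = c" by auto
  have "h 0 = 0" by (simp add: h_def ev_0_integ)
  with c have "c = 0" by (metis norm_zero zero_less_one)
  then show "ev t (integ b) = cnj (ev (cnj t) (integ a))" if "norm t < 1" for t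
    using c[OF that] by (simp add: h_def)
qed

lemma symr_commute: assumes "symr f g" shows "symr g f"
  unfolding symr_def
proof (intro allI impI)
  fix s t :: complex assume "norm s < 1" "norm t < 1"
  with assms have "Ev f (cnj t) (cnj s) = cnj (Ev g (cnj (cnj s)) (cnj (cnj t)))"
    unfolding symr_def by (metis complex_mod_cnj)
  then show "Ev g s t = cnj (Ev f (cnj t) (cnj s))" by simp
qed

lemma symr_add: "symr f g \<Longrightarrow> symr f' g' \<Longrightarrow> symr (f + f') (g + g')"
  by (simp add: symr_def chom_add[OF chom_Ev])

lemma symr_diff: "symr f g \<Longrightarrow> symr f' g' \<Longrightarrow> symr (f - f') (g - g')"
  by (simp add: symr_def chom_diff[OF chom_Ev])

lemma symr_mult: "symr f g \<Longrightarrow> symr f' g' \<Longrightarrow> symr (f * f') (g * g')"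
  by (simp add: symr_def chom_mult[OF chom_Ev])

lemma symr_scaleR: "symr f g \<Longrightarrow> symr (r *\<^sub>R f) (r *\<^sub>R g)"
  by (simp add: symr_def chom_scaleR[OF chom_Ev])

lemma symr_const: "symc a b \<Longrightarrow> symr (const a) (mapA const b)"
  by (simp add: symr_def symc_def Ev_const Ev_mapA_const)

text \<open>Reflection exchanges the variables, so integration in the inner variable on one side
  matches integration in the outer variable on the other. Freezing the remaining variable reduces
  this to \<open>symc_integ\<close>.\<close>

lemma symr_integ:
  assumes "symr f g" shows "symr (mapA integ f) (integ g)"
  unfolding symr_def
proof (intro allI impI)
  fix s t :: complex assume st: "norm s < 1" "norm t < 1"
  have "symc (mapA (ev (cnj t)) g) (ev (const t) f)"
    using assms st by (simp add: symc_def symr_def flip: Ev_swap Ev_def)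
  from symc_integ[OF this] st
  show "Ev (mapA integ f) s t = cnj (Ev (integ g) (cnj t) (cnj s))"
    by (simp add: symc_def Ev_mapA_swap clin_integ integ_mult_const) (simp add: Ev_def mapA_integ clin_ev)
qed

lemma symc_diag: assumes "symr f g" shows "symc (diag f) (diag g)"
  unfolding symc_def
proof (intro allI impI)
  fix t :: complex assume t: "norm t < 1"
  with symr_commute[OF assms] have "Ev g t t = cnj (Ev f (cnj t) (cnj t))"
    unfolding symr_def by blast
  then show "ev t (diag g) = cnj (ev (cnj t) (diag f))"
    using t by (simp add: ev_diag)
qed

lemma
  assumes "symc \<alpha> \<beta>" "symr w w"
  shows symr_dif: "symr (dif_s \<alpha> w) (dif_t \<beta> w)" and symr_sol: "symr (sol \<alpha> \<beta> w) (sol \<alpha> \<beta> w)"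
proof -
  have 1: "symr (mapA integ w) (integ w)" using assms(2) by (rule symr_integ)
  then have 2: "symr (integ w) (mapA integ w)" by (rule symr_commute)
  have 3: "symc (\<alpha> - diag (integ w)) (\<beta> - diag (mapA integ w))"
    by (intro symc_diff assms symc_diag 2)
  show "symr (dif_s \<alpha> w) (dif_t \<beta> w)"
    unfolding dif_s_def dif_t_def by (intro symr_add symr_const 2 3)
  have 4: "symr (mapA integ (integ w)) (mapA integ (integ w))"
    using symr_integ[OF 2] by (simp add: mapA_integ clin_integ)
  have 5: "symr (const (integ (\<alpha> - diag (integ w)))) (mapA const (integ (\<beta> - diag (mapA integ w))))"
    by (intro symr_const symc_integ 3)
  show "symr (sol \<alpha> \<beta> w) (sol \<alpha> \<beta> w)"
    unfolding sol_def by (rule symr_add[OF _ 4]) (use symr_add[OF 5 symr_commute[OF 5]] in \<open>simp add: add.commute\<close>)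
qed

text \<open>In the application \<open>D\<close> is the series of \<open>deriv \<phi>\<close> about
  the base height, rescaled from radius \<open>r\<close> to 1, and \<open>q\<close> is the
  displacement in height. A bound of \<open>q\<close> by \<open>r\<close> in the algebra norm then
  gives convergence on the whole bidisc at once.\<close>

definition pcomp :: "real aps \<Rightarrow> real \<Rightarrow> complex aps aps \<Rightarrow> complex aps aps" where
  "pcomp D r q = ev ((1 / r) *\<^sub>R q) (mapA of_real D)"

lemma chom_of_real: "chom (of_real :: real \<Rightarrow> 'a::comm_banach_algebra)"
  by (rule chomI, rule clinI) (auto simp: scaleR_conv_of_real)

lemmas clin_of_real = chom_clin[OF chom_of_real]

lemma Ev_pcomp:
  assumes "norm s \<le> 1" "norm t \<le> 1" "norm q \<le> r" "r > 0"
  shows "Ev (pcomp D r q) s t = ev (Ev q s t / of_real r) (mapA of_real D)"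
proof -
  have "Ev (of_real x) s t = of_real x" for x
    using chom_scaleR[OF chom_Ev, OF assms(1,2), of x 1] chom_one[OF chom_Ev, OF assms(1,2)]
    by (simp add: of_real_def)
  moreover have "norm ((1 / r) *\<^sub>R q) \<le> 1" using assms by (simp add: field_simps)
  ultimately show ?thesis
    using assms unfolding pcomp_def
    by (simp add: chom_ev_commute[OF chom_Ev] mapA_mapA chom_clin[OF chom_Ev] clin_of_real chom_scaleR[OF chom_Ev])
       (simp add: scaleR_conv_of_real field_simps)
qed

lemma norm_pcomp: "norm q \<le> r \<Longrightarrow> r > 0 \<Longrightarrow> norm (pcomp D r q) \<le> norm D"
  unfolding pcomp_def
  by (rule order_trans[OF clin_norm[OF clin_ev] clin_norm[OF clin_mapA[OF clin_of_real]]]) (simp add: field_simps)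

lemma pcomp_lipschitz:
  assumes D: "summable (\<lambda>n. real n * \<bar>coef D n\<bar>)" and r: "r > 0" and q: "norm q \<le> r" "norm q' \<le> r"
  shows "norm (pcomp D r q - pcomp D r q') \<le> (\<Sum>n. real n * \<bar>coef D n\<bar>) / r * norm (q - q')"
proof -
  define p p' where "p = (1 / r) *\<^sub>R q" and "p' = (1 / r) *\<^sub>R q'"
  have p: "norm p \<le> 1" "norm p' \<le> 1" using q r by (auto simp: p_def p'_def field_simps)
  have pp: "norm (p - p') = norm (q - q') / r"
    unfolding p_def p'_def using r by (simp flip: scaleR_diff_right)
  have c: "norm (coef (mapA of_real D :: complex aps aps aps) n) = \<bar>coef D n\<bar>" for n
    by (simp add: coef_mapA clin_of_real)
  have "norm (ev p (mapA of_real D) - ev p' (mapA of_real D)) \<le> (\<Sum>n. real n * \<bar>coef D n\<bar>) * norm (p - p')"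
    using ev_lipschitz[OF _ p, of "mapA of_real D"] D unfolding c .
  then show ?thesis by (simp add: pcomp_def p_def[symmetric] p'_def[symmetric] pp)
qed

lemma chom_cnj: "chom cnj"
  by (rule chomI, rule clinI) (auto simp: scaleR_conv_of_real)

lemma symr_pcomp:
  assumes q: "symr q q" and r: "norm q \<le> r" "r > 0"
  shows "symr (pcomp D r q) (pcomp D r q)"
  unfolding symr_def
proof (intro allI impI)
  fix s t :: complex assume st: "norm s < 1" "norm t < 1"
  define z where "z = Ev q (cnj t) (cnj s) / of_real r"
  have "norm (Ev q (cnj t) (cnj s)) \<le> r"
    using chom_norm[OF chom_Ev[of "cnj t" "cnj s"], of q] st r by simp
  then have z: "norm z \<le> 1" using r by (simp add: z_def norm_divide)
  have "cnj (ev z (mapA of_real D)) = ev (cnj z) (mapA of_real D)"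
    by (simp add: chom_ev_commute[OF chom_cnj z] mapA_mapA chom_clin[OF chom_cnj] clin_of_real)
  moreover have 1: "Ev q s t = cnj (Ev q (cnj t) (cnj s))"
    using q st unfolding symr_def by blast
  have "Ev q s t / of_real r = cnj z"
    by (subst 1) (simp add: z_def)
  ultimately show "Ev (pcomp D r q) s t = cnj (Ev (pcomp D r q) (cnj t) (cnj s))"
    using st r by (simp add: Ev_pcomp z_def)
qed

section \<open>Contraction estimates and the fixed point\<close>

lemma mult_diff_bound:
  fixes x y :: "'a::real_normed_algebra"
  assumes "norm y \<le> Y" "norm x' \<le> X" "norm (x - x') \<le> dx" "norm (y - y') \<le> dy"
  shows "norm (x * y - x' * y') \<le> dx * Y + X * dy"
proof -
  have "x * y - x' * y' = (x - x') * y + x' * (y - y')" by (simp add: algebra_simps)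
  then have "norm (x * y - x' * y') \<le> norm ((x - x') * y) + norm (x' * (y - y'))"
    by (simp add: norm_triangle_ineq)
  also have "\<dots> \<le> dx * Y + X * dy"
    using assms by (intro add_mono order_trans[OF norm_mult_ineq] mult_mono)
      (auto intro: order_trans[OF norm_ge_zero])
  finally show ?thesis .
qed

text \<open>For \<open>s = u + \<i> v\<close> and \<open>t = u - \<i> v\<close> the Laplacian is 4
  times the mixed derivative, and \<open>gdot f g\<close> is
  \<open>2 * (f_s * g_t + f_t * g_s)\<close>. Inserting both into the Cauchy system leaves the
  factors - 1 / 2 and 1 / 2.\<close>

definition rhs :: "real aps \<Rightarrow> real \<Rightarrow> (nat \<Rightarrow> complex aps) \<Rightarrow> (nat \<Rightarrow> complex aps) \<Rightarrow> nat \<Rightarrow> (nat \<Rightarrow> complex aps aps) \<Rightarrow> complex aps aps" where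
  "rhs D r \<alpha> \<beta> i w = (let G = pcomp D r (sol (\<alpha> 3) (\<beta> 3) (w 3));
       a = (\<lambda>i. dif_s (\<alpha> i) (w i)); b = (\<lambda>i. dif_t (\<beta> i) (w i)) in
     if i = 3 then (1 / 2) *\<^sub>R (G * (a 1 * b 1 + a 2 * b 2 - a 3 * b 3))
     else (- 1 / 2) *\<^sub>R (G * (a i * b 3 + b i * a 3)))"

text \<open>Origin of the numbers: data and \<open>w\<close> of norm at most \<open>m\<close> give a
  primitive of norm at most \<open>5 * m\<close> and first derivatives of norm at most
  \<open>3 * m\<close>; three products of these are at most \<open>27 * m * m\<close>, and half of
  27 is rounded up to 14. Under a change of \<open>w\<close> by \<open>\<delta>\<close> the
  primitive moves by \<open>3 * \<delta>\<close>, first derivatives by \<open>2 * \<delta>\<close>,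
  a product by \<open>12 * m * \<delta>\<close>, three of them by \<open>36 * m * \<delta>\<close>.
  With \<open>m * m \<le> m\<close>, the halves of 3 * 27 = 81 and of 36 give 41 and 18.\<close>

lemma rhs_bounds:
  assumes D: "summable (\<lambda>n. real n * \<bar>coef D n\<bar>)" and r: "r > 0" and i: "i \<in> {1, 2, 3}"
    and m: "m > 0" "5 * m \<le> r" "m \<le> 1"
    and \<alpha>: "\<And>i. norm (\<alpha> i) \<le> m" and \<beta>: "\<And>i. norm (\<beta> i) \<le> m"
    and w: "\<And>i. norm (w i) \<le> m" "\<And>i. norm (w' i) \<le> m" and \<delta>: "\<And>i. norm (w i - w' i) \<le> \<delta>"
  shows "norm (rhs D r \<alpha> \<beta> i w) \<le> 14 * norm D * m * m"
    and "norm (rhs D r \<alpha> \<beta> i w - rhs D r \<alpha> \<beta> i w')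
           \<le> (41 * ((\<Sum>n. real n * \<bar>coef D n\<bar>) / r) + 18 * norm D) * m * \<delta>"
proof -
  define L where "L = (\<Sum>n. real n * \<bar>coef D n\<bar>) / r"
  define M where "M = norm D"
  have L: "L \<ge> 0" unfolding L_def using r D by (intro divide_nonneg_pos suminf_nonneg) auto
  have M: "M \<ge> 0" by (simp add: M_def)
  have \<delta>0: "\<delta> \<ge> 0" using \<delta>[of 0] norm_ge_zero order_trans by blast
  define G where "G = (\<lambda>w::nat \<Rightarrow> _. pcomp D r (sol (\<alpha> 3) (\<beta> 3) (w 3)))"
  define a where "a = (\<lambda>(w::nat\<Rightarrow>_) i. dif_s (\<alpha> i) (w i))"
  define b where "b = (\<lambda>(w::nat\<Rightarrow>_) i. dif_t (\<beta> i) (w i))"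
  have solr: "norm (sol (\<alpha> 3) (\<beta> 3) (w 3)) \<le> r" if "\<And>i. norm (w i) \<le> m" for w :: "nat \<Rightarrow> _"
    using norm_sol[of "\<alpha> 3" "\<beta> 3" "w 3"] \<alpha>[of 3] \<beta>[of 3] that[of 3] m by linarith
  have ab: "norm (a w i) \<le> 3 * m" "norm (b w i) \<le> 3 * m" if "\<And>i. norm (w i) \<le> m" for w i
    unfolding a_def b_def
    using norm_dif_s[of "\<alpha> i" "w i"] norm_dif_t[of "\<beta> i" "w i"] \<alpha>[of i] \<beta>[of i] that[of i] by linarith+
  have dab: "norm (a w i - a w' i) \<le> 2 * \<delta>" "norm (b w i - b w' i) \<le> 2 * \<delta>" for i
    unfolding a_def b_def dif_s_diff dif_t_diff
    using norm_dif_s[of 0 "w i - w' i"] norm_dif_t[of 0 "w i - w' i"] \<delta>[of i] by simp_all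
  have G: "norm (G w) \<le> M" if "\<And>i. norm (w i) \<le> m" for w
    unfolding G_def M_def by (intro norm_pcomp solr that r)
  have "norm (sol (\<alpha> 3) (\<beta> 3) (w 3) - sol (\<alpha> 3) (\<beta> 3) (w' 3)) \<le> 3 * \<delta>"
    unfolding sol_diff using norm_sol[of 0 0 "w 3 - w' 3"] \<delta>[of 3] by simp
  then have dG: "norm (G w - G w') \<le> L * (3 * \<delta>)"
    unfolding G_def using L by (intro order_trans[OF pcomp_lipschitz[OF D r]] solr w) (auto simp: L_def[symmetric] mult_left_mono)
  have pr: "norm (a w i * b w j) \<le> 9 * m * m" "norm (b w j * a w i) \<le> 9 * m * m" if "\<And>i. norm (w i) \<le> m" for w :: "nat \<Rightarrow> complex aps aps" and i j :: nat
  proof -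
    have "norm (a w i) * norm (b w j) \<le> (3 * m) * (3 * m)"
      using ab[OF that] m by (intro mult_mono) auto
    then show "norm (a w i * b w j) \<le> 9 * m * m"
      using norm_mult_ineq[of "a w i" "b w j"] by linarith
    then show "norm (b w j * a w i) \<le> 9 * m * m" by (simp add: mult.commute)
  qed
  have dpr: "norm (a w i * b w j - a w' i * b w' j) \<le> 12 * m * \<delta>"
     "norm (b w j * a w i - b w' j * a w' i) \<le> 12 * m * \<delta>" for i j
  proof -
    show "norm (a w i * b w j - a w' i * b w' j) \<le> 12 * m * \<delta>"
      by (rule order_trans[OF mult_diff_bound[OF ab(2)[OF w(1)] ab(1)[OF w(2)] dab(1) dab(2)]])
         (simp add: algebra_simps)
    then show "norm (b w j * a w i - b w' j * a w' i) \<le> 12 * m * \<delta>" by (simp add: mult.commute)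
  qed
  define Q where "Q = (\<lambda>w::nat \<Rightarrow> _. if i = 3 then a w 1 * b w 1 + a w 2 * b w 2 - a w 3 * b w 3
     else a w i * b w 3 + b w i * a w 3)"
  have mm: "0 \<le> m * m" "0 \<le> m * \<delta>" using m \<delta>0 by auto
  have Q: "norm (Q w) \<le> 27 * m * m" if "\<And>i. norm (w i) \<le> m" for w
  proof (cases "i = 3")
    case True
    have "norm (a w 1 * b w 1 + a w 2 * b w 2 + - (a w 3 * b w 3)) \<le> 9 * m * m + 9 * m * m + 9 * m * m"
      by (rule norm_triangle_le3) (use pr[OF that] in \<open>simp_all only: norm_minus_cancel\<close>)
    then show ?thesis using True by (simp add: Q_def)
  next
    case False
    have "norm (a w i * b w 3 + b w i * a w 3) \<le> 9 * m * m + 9 * m * m"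
      by (intro norm_triangle_mono pr that)
    also have "\<dots> \<le> 27 * m * m" using mm(1) by linarith
    finally show ?thesis using False by (simp add: Q_def)
  qed
  have dQ: "norm (Q w - Q w') \<le> 36 * m * \<delta>"
  proof (cases "i = 3")
    case True
    have "norm ((a w 1 * b w 1 - a w' 1 * b w' 1) + (a w 2 * b w 2 - a w' 2 * b w' 2)
        + - (a w 3 * b w 3 - a w' 3 * b w' 3)) \<le> 12 * m * \<delta> + 12 * m * \<delta> + 12 * m * \<delta>"
      by (rule norm_triangle_le3) (use dpr in \<open>simp_all only: norm_minus_cancel\<close>)
    then show ?thesis using True by (simp add: Q_def algebra_simps)
  next
    case False
    have "norm ((a w i * b w 3 - a w' i * b w' 3) + (b w i * a w 3 - b w' i * a w' 3)) \<le> 12 * m * \<delta> + 12 * m * \<delta>"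
      by (intro norm_triangle_mono dpr)
    then show ?thesis using False mm by (simp add: Q_def algebra_simps)
  qed
  have rhs: "norm (rhs D r \<alpha> \<beta> i w) = norm (G w * Q w) / 2" for w
    by (simp add: rhs_def Let_def Q_def G_def a_def b_def)
  have "norm (G w * Q w) \<le> M * (27 * m * m)"
    by (intro order_trans[OF norm_mult_ineq] mult_mono G Q w M norm_ge_zero)
  moreover have "0 \<le> M * (m * m)" using M mm by simp
  ultimately show "norm (rhs D r \<alpha> \<beta> i w) \<le> 14 * norm D * m * m"
    unfolding rhs by (simp add: M_def[symmetric] algebra_simps)
  have "norm (rhs D r \<alpha> \<beta> i w - rhs D r \<alpha> \<beta> i w') = norm (G w * Q w - G w' * Q w') / 2"
  proof (cases "i = 3")
    case True
    then have "rhs D r \<alpha> \<beta> i w - rhs D r \<alpha> \<beta> i w' = (1/2) *\<^sub>R (G w * Q w - G w' * Q w')"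
      by (simp add: rhs_def Let_def Q_def G_def a_def b_def flip: scaleR_diff_right)
    then show ?thesis by simp
  next
    case False
    then have "rhs D r \<alpha> \<beta> i w - rhs D r \<alpha> \<beta> i w' = (-1/2) *\<^sub>R (G w * Q w - G w' * Q w')"
      by (simp add: rhs_def Let_def Q_def G_def a_def b_def scaleR_diff_right)
    then show ?thesis by simp
  qed
  also have "norm (G w * Q w - G w' * Q w') \<le> (L * (3 * \<delta>)) * (27 * m * m) + M * (36 * m * \<delta>)"
    by (intro mult_diff_bound Q w G dG dQ)
  also have "(L * (3 * \<delta>)) * (27 * m * m) \<le> (L * (3 * \<delta>)) * (27 * m * 1)"
    using L \<delta>0 m by (intro mult_left_mono) auto
  finally have "norm (rhs D r \<alpha> \<beta> i w - rhs D r \<alpha> \<beta> i w') \<le> (81 * L * m * \<delta> + 36 * M * m * \<delta>) / 2"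
    by (simp add: algebra_simps)
  moreover have "0 \<le> L * (m * \<delta>)" using L mm by simp
  ultimately show "norm (rhs D r \<alpha> \<beta> i w - rhs D r \<alpha> \<beta> i w')
      \<le> (41 * ((\<Sum>n. real n * \<bar>coef D n\<bar>) / r) + 18 * norm D) * m * \<delta>"
    unfolding L_def[symmetric] M_def[symmetric] by (simp add: algebra_simps)
qed

text \<open>Reflection exchanges the two first derivatives, and the quadratic terms are symmetric
  under this exchange; the coefficients of \<open>D\<close> are real, so the composed factor is
  symmetric too.\<close>

lemma symr_rhs:
  assumes r: "r > 0" and s: "norm (sol (\<alpha> 3) (\<beta> 3) (w 3)) \<le> r"
    and w: "\<And>i. symr (w i) (w i)" and sc: "\<And>i. symc (\<alpha> i) (\<beta> i)"
  shows "symr (rhs D r \<alpha> \<beta> i w) (rhs D r \<alpha> \<beta> i w)"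
proof -
  define a b where "a = (\<lambda>i. dif_s (\<alpha> i) (w i))" and "b = (\<lambda>i. dif_t (\<beta> i) (w i))"
  have ab: "symr (a i) (b i)" for i unfolding a_def b_def by (rule symr_dif[OF sc w])
  have ba: "symr (b i) (a i)" for i by (rule symr_commute[OF ab])
  have G: "symr (pcomp D r (sol (\<alpha> 3) (\<beta> 3) (w 3))) (pcomp D r (sol (\<alpha> 3) (\<beta> 3) (w 3)))"
    by (intro symr_pcomp symr_sol sc w s r)
  have sq: "symr (a i * b i) (a i * b i)" for i
    using symr_mult[OF ab ba, of i i] by (simp add: mult.commute)
  have "symr (a i * b 3 + b i * a 3) (a i * b 3 + b i * a 3)"
    using symr_add[OF symr_mult[OF ab ba] symr_mult[OF ba ab], of i 3 i 3] by (simp add: algebra_simps)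
  from symr_scaleR[OF symr_mult[OF G this], of "-1/2"]
  show ?thesis
    using symr_scaleR[OF symr_mult[OF G symr_diff[OF symr_add[OF sq[of 1] sq[of 2]] sq[of 3]]], of "1/2"]
    unfolding rhs_def Let_def a_def b_def by (auto simp del: scaleR_minus_left)
qed

lemma symr_0: "symr 0 0"
  by (simp add: symr_def chom_zero[OF chom_Ev])

text \<open>Each instance of the symmetry is an equation between continuous functions of
  \<open>w\<close>. Closedness supplies the complete set on which the contraction acts.\<close>

lemma closed_symr: "closed {w. symr w w}"
proof -
  have "closed {w. Ev w s t = cnj (Ev w (cnj t) (cnj s))}" if "norm s < 1" "norm t < 1" for s t
  proof (rule closed_Collect_eq)
    show "continuous_on UNIV (\<lambda>w. Ev w s t)"
      using that by (intro linear_continuous_on chom_bounded_linear chom_Ev) auto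
    show "continuous_on UNIV (\<lambda>w. cnj (Ev w (cnj t) (cnj s)))"
      using that by (intro continuous_on_cnj linear_continuous_on chom_bounded_linear chom_Ev) auto
  qed
  then have "closed (\<Inter>s\<in>ball 0 1. \<Inter>t\<in>ball 0 1. {w. Ev w s t = cnj (Ev w (cnj t) (cnj s))})"
    by (intro closed_INT) auto
  also have "(\<Inter>s\<in>ball 0 1. \<Inter>t\<in>ball 0 1. {w. Ev w s t = cnj (Ev w (cnj t) (cnj s))}) = {w. symr w w}"
    unfolding symr_def set_eq_iff by (simp only: INT_iff mem_Collect_eq mem_ball_0 Ball_def, blast)
  finally show ?thesis .
qed

text \<open>The three components are estimated together by the sum of their norms: 42 is 3 times the
  14 of \<open>rhs_bounds\<close> and keeps the ball invariant; 6 is 3 times 2 and gives the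
  contraction factor 1 / 2.\<close>

lemma rhs_fixed_point:
  assumes D: "summable (\<lambda>n. real n * \<bar>coef D n\<bar>)" and r: "r > 0"
    and m: "m > 0" "5 * m \<le> r" "m \<le> 1" "42 * norm D * m \<le> 1"
      "6 * (41 * ((\<Sum>n. real n * \<bar>coef D n\<bar>) / r) + 18 * norm D) * m \<le> 1"
    and \<alpha>: "\<And>i. norm (\<alpha> i) \<le> m" and \<beta>: "\<And>i. norm (\<beta> i) \<le> m"
    and sc: "\<And>i. symc (\<alpha> i) (\<beta> i)"
  shows "\<exists>w. \<forall>i\<in>{1,2,3}. symr (w i) (w i) \<and> norm (w i) \<le> m \<and> w i = rhs D r \<alpha> \<beta> i w"
proof -
  define C where "C = (41 * ((\<Sum>n. real n * \<bar>coef D n\<bar>) / r) + 18 * norm D) * m"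
  \<comment> \<open>A triple is extended by 0 to all indices, because \<open>rhs_bounds\<close> and
    \<open>symr_rhs\<close> ask for their conditions at every index.\<close>
  define W :: "complex aps aps \<times> complex aps aps \<times> complex aps aps \<Rightarrow> nat \<Rightarrow> complex aps aps"
    where "W = (\<lambda>w i. if i = 1 then fst w else if i = 2 then fst (snd w) else if i = 3 then snd (snd w) else 0)"
  define S where "S = cball 0 m \<inter> {w. symr w w} \<times> {w. symr w w} \<times> {w. symr w w}"
  define f where "f = (\<lambda>w. (rhs D r \<alpha> \<beta> 1 (W w), rhs D r \<alpha> \<beta> 2 (W w), rhs D r \<alpha> \<beta> 3 (W w)))"
  have Wd: "norm (W w i - W w' i) \<le> dist w w'" for w w' i
  proof -
    have "norm (fst (w - w')) \<le> norm (w - w')" "norm (fst (snd (w - w'))) \<le> norm (w - w')"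
      "norm (snd (snd (w - w'))) \<le> norm (w - w')"
      using norm_fst_le[of "fst (w - w')" "snd (w - w')"] norm_snd_le[of "snd (w - w')" "fst (w - w')"]
        norm_fst_le[of "fst (snd (w - w'))" "snd (snd (w - w'))"]
        norm_snd_le[of "snd (snd (w - w'))" "fst (snd (w - w'))"]
      unfolding prod.collapse by linarith+
    then show ?thesis by (simp add: W_def dist_norm)
  qed
  have W0: "W 0 i = 0" for i by (simp add: W_def)
  have Wn: "norm (W w i) \<le> m" if "w \<in> S" for w i
    using Wd[of w i 0] that by (simp add: W0 S_def)
  have Ws: "symr (W w i) (W w i)" if "w \<in> S" for w i
    using that symr_0 by (auto simp: W_def S_def)
  have n3: "norm (x, y, z) \<le> norm x + norm y + norm z" for x y z :: "complex aps aps"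
    using norm_Pair_le[of x "(y, z)"] norm_Pair_le[of y z] by linarith
  have "\<exists>!w\<in>S. f w = w"
  proof (rule Banach_fix[where c = "1/2"])
    have "closed S" unfolding S_def
      by (intro closed_Int closed_Times closed_symr closed_cball)
    then show "complete S" by (simp add: complete_eq_closed)
    have "0 \<in> S" using m symr_0 by (auto simp: S_def zero_prod_def)
    then show "S \<noteq> {}" by blast
    show "f ` S \<subseteq> S"
    proof (rule image_subsetI)
      fix w assume w: "w \<in> S"
      have "norm (sol (\<alpha> 3) (\<beta> 3) (W w 3)) \<le> r"
        using norm_sol[of "\<alpha> 3" "\<beta> 3" "W w 3"] \<alpha>[of 3] \<beta>[of 3] Wn[OF w, of 3] m by linarith
      then have "symr (rhs D r \<alpha> \<beta> i (W w)) (rhs D r \<alpha> \<beta> i (W w))" for i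
        by (intro symr_rhs r Ws[OF w] sc)
      moreover have b: "norm (rhs D r \<alpha> \<beta> i (W w)) \<le> 14 * norm D * m * m" if "i \<in> {1,2,3}" for i
        by (rule rhs_bounds(1)[where w' = "W w" and \<delta> = 0, OF D r that m(1-3) \<alpha> \<beta> Wn[OF w] Wn[OF w]]) simp
      have "norm (f w) \<le> (42 * norm D * m) * m"
        unfolding f_def by (rule order_trans[OF n3]) (use b[of 1] b[of 2] b[of 3] in simp)
      moreover have "(42 * norm D * m) * m \<le> 1 * m" using m by (intro mult_right_mono) auto
      ultimately show "f w \<in> S" by (simp add: S_def f_def)
    qed
    fix w w' assume w: "w \<in> S" "w' \<in> S"
    have b: "norm (rhs D r \<alpha> \<beta> i (W w) - rhs D r \<alpha> \<beta> i (W w')) \<le> C * dist w w'" if "i \<in> {1,2,3}" for i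
      unfolding C_def by (rule rhs_bounds(2)[OF D r that m(1-3) \<alpha> \<beta> Wn[OF w(1)] Wn[OF w(2)] Wd])
    define \<delta> where "\<delta> = dist w w'"
    have "norm (f w - f w') \<le> 3 * C * \<delta>"
      unfolding f_def minus_prod_def fst_conv snd_conv
      by (intro order_trans[OF n3]) (use b[folded \<delta>_def, of 1] b[folded \<delta>_def, of 2] b[folded \<delta>_def, of 3] in simp)
    then have "dist (f w) (f w') \<le> 3 * C * dist w w'"
      by (simp only: \<delta>_def dist_norm)
    also have "\<dots> \<le> 1/2 * dist w w'"
    proof (rule mult_right_mono)
      have "6 * C \<le> 1" using m(5) unfolding C_def by (simp only: mult.assoc)
      then show "3 * C \<le> 1/2" by simp
    qed simp
    finally show "dist (f w) (f w') \<le> 1/2 * dist w w'" .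
  qed auto
  then obtain w where w: "w \<in> S" "f w = w" by blast
  have "W w 1 = rhs D r \<alpha> \<beta> 1 (W w)" "W w 2 = rhs D r \<alpha> \<beta> 2 (W w)" "W w 3 = rhs D r \<alpha> \<beta> 3 (W w)"
    using w(2) unfolding f_def by (auto simp: prod_eq_iff W_def)
  then show ?thesis
    using Wn[OF w(1)] Ws[OF w(1)] by (intro exI[of _ "W w"]) auto
qed

section \<open>Real traces of characteristic solutions\<close>

lemma ev_mapA_cnj: "norm t \<le> 1 \<Longrightarrow> ev t (mapA cnj a) = cnj (ev (cnj t) a)"
  by (simp add: chom_ev_commute[OF chom_cnj])

lemma symc_mapA_cnj: "symc a (mapA cnj a)"
  by (simp add: symc_def ev_mapA_cnj)

lemma clin_Re: "clin Re"
  by (rule clinI) (auto simp: abs_Re_le_cmod)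

lemma ev_mapA_Re:
  assumes "\<bar>s\<bar> \<le> 1" shows "ev s (mapA Re c) = Re (ev (of_real s) c)"
proof (rule sums_unique2)
  show "(\<lambda>n. Re (coef c n) * s ^ n) sums ev s (mapA Re c)"
    using ev_sums[of s "mapA Re c"] assms by (simp add: coef_mapA clin_Re)
  have "(\<lambda>n. coef c n * of_real s ^ n) sums ev (of_real s) c"
    using assms by (intro ev_sums) simp
  from sums_Re[OF this] show "(\<lambda>n. Re (coef c n) * s ^ n) sums Re (ev (of_real s) c)"
    by (simp flip: of_real_power)
qed

text \<open>For real arguments taking real parts commutes with both sums; this turns a complex
  expansion into the real one demanded by \<open>loc_an\<close>.\<close>

lemma Ev_mapA_Re:
  assumes "\<bar>s\<bar> \<le> 1" "\<bar>t\<bar> \<le> 1"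
  shows "Ev (mapA (mapA Re) g) s t = Re (Ev g (of_real s) (of_real t))"
proof -
  have "norm (of_real s :: complex) \<le> 1" using assms by simp
  note ce = clin_ev[OF this]
  have "mapA (ev s) (mapA (mapA Re) g) = mapA Re (mapA (ev (of_real s)) g)"
    using assms by (intro aps_eqI) (simp add: coef_mapA clin_mapA clin_Re ce clin_ev ev_mapA_Re)
  then show ?thesis using assms by (simp add: Ev_def ev_mapA_Re)
qed

section \<open>Restriction to the real plane \<open>t = cnj s\<close>\<close>

definition Zc :: "real \<Rightarrow> real \<times> real \<Rightarrow> complex" where
  "Zc \<rho> q = Complex (fst q) (snd q) / of_real \<rho>"

abbreviation "Ez \<rho> F q \<equiv> Ev F (Zc \<rho> q) (cnj (Zc \<rho> q))"

definition Rf :: "real \<Rightarrow> complex aps aps \<Rightarrow> real \<times> real \<Rightarrow> real" where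
  "Rf \<rho> F q = Re (Ez \<rho> F q)"

lemma norm_Zc: "\<rho> > 0 \<Longrightarrow> norm (Zc \<rho> q) = norm q / \<rho>"
  by (simp add: Zc_def norm_divide complex_norm norm_prod_def)

lemma norm_Zc_less: "\<rho> > 0 \<Longrightarrow> norm q < \<rho> \<Longrightarrow> norm (Zc \<rho> q) < 1"
  by (simp add: norm_Zc)

text \<open>Both characteristic variables move with \<open>u\<close> and with \<open>v\<close>, so
  the total derivative \<open>Ev_joint\<close> is used; along \<open>u\<close> their velocities are
  equal, along \<open>v\<close> they are opposite and imaginary.\<close>

lemma Rf_derivatives:
  assumes \<rho>: "\<rho> > 0" and q: "norm q < \<rho>"
    and d1: "((\<lambda>s. Ev F s (cnj (Zc \<rho> q))) has_field_derivative d1) (at (Zc \<rho> q))"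
    and d2: "((\<lambda>t. Ev F (Zc \<rho> q) t) has_field_derivative d2) (at (cnj (Zc \<rho> q)))"
  shows "((\<lambda>s. Rf \<rho> F (s, snd q)) has_real_derivative Re (d1 + d2) / \<rho>) (at (fst q))"
    and "((\<lambda>s. Rf \<rho> F (fst q, s)) has_real_derivative Re (\<i> * (d1 - d2)) / \<rho>) (at (snd q))"
proof -
  let ?E = "\<lambda>(s, t). Ev F s t"
  have J: "(?E has_derivative (\<lambda>(h, k). d1 * h + d2 * k)) (at (Zc \<rho> q, cnj (Zc \<rho> q)))"
    using norm_Zc_less[OF \<rho> q] by (intro Ev_joint d1 d2) auto
  have z: "Zc \<rho> (u, v) = of_real (u / \<rho>) + of_real (v / \<rho>) * \<i>" for u v
    by (simp add: Zc_def complex_eq_iff)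
  have 1: "((\<lambda>s. (Zc \<rho> (s, snd q), cnj (Zc \<rho> (s, snd q)))) has_derivative
      (\<lambda>h. (of_real (h / \<rho>), of_real (h / \<rho>)))) (at (fst q))"
    unfolding z using \<rho> by (auto intro!: derivative_eq_intros)
  have "(?E has_derivative (\<lambda>(h, k). d1 * h + d2 * k)) (at (Zc \<rho> (fst q, snd q), cnj (Zc \<rho> (fst q, snd q))))"
    using J by simp
  note c1 = has_derivative_Re[OF has_derivative_compose[OF 1 this]]
  have e1: "(*) (Re (d1 + d2) / \<rho>) =
      (\<lambda>h. Re (case (of_real (h / \<rho>), of_real (h / \<rho>)) of (h, k) \<Rightarrow> d1 * h + d2 * k))"
    by (simp add: fun_eq_iff algebra_simps add_divide_distrib diff_divide_distrib)
  show "((\<lambda>s. Rf \<rho> F (s, snd q)) has_real_derivative Re (d1 + d2) / \<rho>) (at (fst q))"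
    unfolding has_field_derivative_def Rf_def e1 using c1 by (simp only: prod.case)
  have 2: "((\<lambda>s. (Zc \<rho> (fst q, s), cnj (Zc \<rho> (fst q, s)))) has_derivative
      (\<lambda>h. (of_real (h / \<rho>) * \<i>, - of_real (h / \<rho>) * \<i>))) (at (snd q))"
    unfolding z using \<rho> by (auto intro!: derivative_eq_intros)
  have "(?E has_derivative (\<lambda>(h, k). d1 * h + d2 * k)) (at (Zc \<rho> (fst q, snd q), cnj (Zc \<rho> (fst q, snd q))))"
    using J by simp
  note c2 = has_derivative_Re[OF has_derivative_compose[OF 2 this]]
  have e2: "(*) (Re (\<i> * (d1 - d2)) / \<rho>) =
      (\<lambda>h. Re (case (of_real (h / \<rho>) * \<i>, - of_real (h / \<rho>) * \<i>) of (h, k) \<Rightarrow> d1 * h + d2 * k))"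
    by (simp add: fun_eq_iff algebra_simps add_divide_distrib diff_divide_distrib)
  show "((\<lambda>s. Rf \<rho> F (fst q, s)) has_real_derivative Re (\<i> * (d1 - d2)) / \<rho>) (at (snd q))"
    unfolding has_field_derivative_def Rf_def e2 using c2 by (simp only: prod.case)
qed

lemma continuous_on_Rf:
  assumes "\<rho> > 0" shows "continuous_on (ball 0 \<rho>) (Rf \<rho> F)"
proof -
  have "continuous_on (ball 0 \<rho>) (Zc \<rho>)"
    unfolding Zc_def[abs_def] Complex_eq using assms by (intro continuous_intros) auto
  then have c: "continuous_on (ball 0 \<rho>) (\<lambda>q. (Zc \<rho> q, cnj (Zc \<rho> q)))"
    by (intro continuous_on_Pair continuous_on_cnj)
  have "continuous_on (ball 0 \<rho>) (\<lambda>q. (\<lambda>(s, t). Ev F s t) (Zc \<rho> q, cnj (Zc \<rho> q)))"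
    by (rule continuous_on_compose2[OF continuous_on_Ev c])
       (use norm_Zc_less[OF assms] in \<open>force simp: less_imp_le\<close>)
  then show ?thesis unfolding Rf_def[abs_def] by (simp add: continuous_on_Re)
qed

lemma loc_an_Rf:
  assumes \<rho>: "\<rho> > 0" and q: "norm q < \<rho>"
  shows "loc_an (Rf \<rho> F) q"
proof -
  define z where "z = Zc \<rho> q"
  \<comment> \<open>\<open>P\<close> and \<open>Q\<close> below stand for
    \<open>r * (\<sigma> + \<i> * \<tau>)\<close> and \<open>r * (\<sigma> - \<i> * \<tau>)\<close>
    with real coordinates \<open>\<sigma>\<close>, \<open>\<tau>\<close> as inner and outer
    variable. Their norms are bounded by \<open>2 * r\<close>, hence the division by 2.\<close>
  define r where "r = (1 - norm z) / 2"
  have r: "r > 0" using norm_Zc_less[OF \<rho> q] by (simp add: r_def z_def)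
  define P Q :: "complex aps aps" where "P = r *\<^sub>R (const var + const (const \<i>) * var)"
    and "Q = r *\<^sub>R (const var - const (const \<i>) * var)"
  have nv: "norm (const (const \<i>) * var :: complex aps aps) \<le> 1"
    by (rule order_trans[OF norm_mult_ineq]) (simp add: norm_const norm_var)
  have "norm P \<le> 2 * r" "norm Q \<le> 2 * r"
    unfolding P_def Q_def
    using nv r norm_triangle_ineq[of "const var" "const (const \<i>) * var :: complex aps aps"]
      norm_triangle_ineq4[of "const var" "const (const \<i>) * var :: complex aps aps"]
    by (auto simp: norm_const norm_var)
  then have "norm (const (const z) + P) \<le> 1" "norm (const (const (cnj z)) + Q) \<le> 1"
    by (auto intro!: order_trans[OF norm_triangle_ineq] simp: norm_const r_def)
  from Ev_recenter[OF this, of F] obtain g where g: "\<And>s t. norm s \<le> 1 \<Longrightarrow> norm t \<le> 1 \<Longrightarrow>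
      Ev g s t = Ev F (z + Ev P s t) (cnj z + Ev Q s t)" by blast
  have "Rf \<rho> F (fst q + (\<rho> * r) * s, snd q + (\<rho> * r) * t) = Ev (mapA (mapA Re) g) s t"
    if st: "\<bar>s\<bar> \<le> 1" "\<bar>t\<bar> \<le> 1" for s t
  proof -
    have n: "norm (of_real s :: complex) \<le> 1" "norm (of_real t :: complex) \<le> 1" using st by auto
    have "Zc \<rho> (fst q + (\<rho> * r) * s, snd q + (\<rho> * r) * t) = z + Ev P (of_real s) (of_real t)"
      "cnj (Zc \<rho> (fst q + (\<rho> * r) * s, snd q + (\<rho> * r) * t)) = cnj z + Ev Q (of_real s) (of_real t)"
      using \<rho> n unfolding P_def Q_def z_def Zc_def
      by (simp_all add: chom_scaleR[OF chom_Ev] chom_add[OF chom_Ev] chom_diff[OF chom_Ev] chom_mult[OF chom_Ev]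
          Ev_const Ev_var_outer ev_const ev_var complex_eq_iff field_simps)
    then show ?thesis
      by (simp add: Rf_def Ev_mapA_Re st g n)
  qed
  then show ?thesis
    unfolding loc_an_def using \<rho> r by (intro exI[of _ "\<rho> * r"]) auto
qed

text \<open>The data of the second variable are the conjugated ones, as reality requires.
  \<open>small\<close> keeps the height inside the disc of convergence of \<open>D\<close>, and
  \<open>iso0\<close> is conformality along the diagonal in complex form.\<close>

locale char_solution =
  fixes \<rho> r :: real and D :: "real aps" and \<alpha> :: "nat \<Rightarrow> complex aps" and w :: "nat \<Rightarrow> complex aps aps"
  assumes \<rho>: "\<rho> > 0" and r: "r > 0"
    and w_eq: "\<And>i. i \<in> {1, 2, 3} \<Longrightarrow> w i = rhs D r \<alpha> (\<lambda>i. mapA cnj (\<alpha> i)) i w"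
    and w_sym: "\<And>i. i \<in> {1, 2, 3} \<Longrightarrow> symr (w i) (w i)"
    and small: "norm (sol (\<alpha> 3) (mapA cnj (\<alpha> 3)) (w 3)) \<le> r"
    and iso0: "\<And>t. norm t < 1 \<Longrightarrow> (ev t (\<alpha> 1))\<^sup>2 + (ev t (\<alpha> 2))\<^sup>2 + (ev t (\<alpha> 3))\<^sup>2 = 0"
begin

definition "S i = sol (\<alpha> i) (mapA cnj (\<alpha> i)) (w i)"
definition "da i = dif_s (\<alpha> i) (w i)"
definition "db i = dif_t (mapA cnj (\<alpha> i)) (w i)"
definition "G = pcomp D r (S 3)"

lemma Ev_w:
  assumes "norm s < 1" "norm t < 1"
  shows "Ev (w 1) s t = - (1/2) * Ev G s t * (Ev (da 1) s t * Ev (db 3) s t + Ev (db 1) s t * Ev (da 3) s t)"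
    and "Ev (w 2) s t = - (1/2) * Ev G s t * (Ev (da 2) s t * Ev (db 3) s t + Ev (db 2) s t * Ev (da 3) s t)"
    and "Ev (w 3) s t = (1/2) * Ev G s t *
      (Ev (da 1) s t * Ev (db 1) s t + Ev (da 2) s t * Ev (db 2) s t - Ev (da 3) s t * Ev (db 3) s t)"
proof -
  have E: "chom (\<lambda>f. Ev f s t)" using assms by (intro chom_Ev) auto
  note E = chom_scaleR[OF E] chom_add[OF E] chom_diff[OF E] chom_mult[OF E] chom_minus[OF E]
  have "w 1 = (- 1 / 2) *\<^sub>R (G * (da 1 * db 3 + db 1 * da 3))"
    "w 2 = (- 1 / 2) *\<^sub>R (G * (da 2 * db 3 + db 2 * da 3))"
    "w 3 = (1 / 2) *\<^sub>R (G * (da 1 * db 1 + da 2 * db 2 - da 3 * db 3))"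
    by (subst w_eq; simp add: rhs_def Let_def G_def da_def db_def S_def)+
  then show "Ev (w 1) s t = - (1/2) * Ev G s t * (Ev (da 1) s t * Ev (db 3) s t + Ev (db 1) s t * Ev (da 3) s t)"
    and "Ev (w 2) s t = - (1/2) * Ev G s t * (Ev (da 2) s t * Ev (db 3) s t + Ev (db 2) s t * Ev (da 3) s t)"
    and "Ev (w 3) s t = (1/2) * Ev G s t *
      (Ev (da 1) s t * Ev (db 1) s t + Ev (da 2) s t * Ev (db 2) s t - Ev (da 3) s t * Ev (db 3) s t)"
    by (simp_all add: E scaleR_conv_of_real[where 'a = complex])
qed

text \<open>The Hopf differential \<open>a \<bullet> a\<close> solves a linear homogeneous equation in the second characteristic
  variable and vanishes on the diagonal.\<close>
lemma isotropic:
  assumes s: "norm s < 1" and t: "norm t < 1"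
  shows "(Ev (da 1) s t)\<^sup>2 + (Ev (da 2) s t)\<^sup>2 + (Ev (da 3) s t)\<^sup>2 = 0"
proof -
  define H where "H = (\<lambda>t. (Ev (da 1) s t)\<^sup>2 + (Ev (da 2) s t)\<^sup>2 + (Ev (da 3) s t)\<^sup>2)"
  define K where "K = (\<lambda>t. exp (Ev (integ (G * db 3)) s t))"
  have "\<exists>c. \<forall>t\<in>ball 0 1. H t * K t = c"
  proof (rule has_field_derivative_zero_constant)
    fix t :: complex assume "t \<in> ball 0 1"
    then have t: "norm t < 1" by simp
    have da: "((\<lambda>t. Ev (da i) s t) has_field_derivative Ev (w i) s t) (at t)" for i
      unfolding da_def by (rule dif_s_derivative_t[OF s t])
    have K: "((\<lambda>t. Ev (integ (G * db 3)) s t) has_field_derivative Ev G s t * Ev (db 3) s t) (at t)"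
      using Ev_integ_outer[of s t "G * db 3"] s t by (simp add: chom_mult[OF chom_Ev])
    have "((\<lambda>t. H t * K t) has_field_derivative
       (2 * Ev (da 1) s t * Ev (w 1) s t + 2 * Ev (da 2) s t * Ev (w 2) s t + 2 * Ev (da 3) s t * Ev (w 3) s t) * K t
       + H t * (K t * (Ev G s t * Ev (db 3) s t))) (at t)"
      unfolding H_def K_def by (rule derivative_eq_intros da K refl | simp)+
    \<comment> \<open>In the sum of the products \<open>da i * w i\<close> the terms with
      \<open>db 1\<close> and \<open>db 2\<close> cancel between the third equation and the first
      two, precisely because all three carry the same factor 1 / 2. What remains is
      \<open>- 1 / 2 * G * db 3 * H\<close>, and \<open>K\<close> is the matching integrating
      factor.\<close>
    also have "(2 * Ev (da 1) s t * Ev (w 1) s t + 2 * Ev (da 2) s t * Ev (w 2) s t + 2 * Ev (da 3) s t * Ev (w 3) s t) * K t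
       + H t * (K t * (Ev G s t * Ev (db 3) s t)) = 0"
      unfolding Ev_w[OF s t] H_def by (simp add: field_simps power2_eq_square)
    finally show "((\<lambda>t. H t * K t) has_field_derivative 0) (at t within ball 0 1)"
      by (rule has_field_derivative_at_within)
  qed simp
  then obtain c where c: "\<And>t. norm t < 1 \<Longrightarrow> H t * K t = c" by auto
  have "H s = 0"
    using iso0[OF s] s by (simp add: H_def da_def dif_s_diag)
  then have "c = 0" using c[OF s] by simp
  then show ?thesis using c[OF t] by (simp add: H_def K_def)
qed

end

lemma pu_eqI: "((\<lambda>s. f (s, snd q)) has_real_derivative d) (at (fst q)) \<Longrightarrow> pu f q = d"
  unfolding pu_def by (rule DERIV_imp_deriv)

lemma pv_eqI: "((\<lambda>s. f (fst q, s)) has_real_derivative d) (at (snd q)) \<Longrightarrow> pv f q = d"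
  unfolding pv_def by (rule DERIV_imp_deriv)

lemma ev_of_real:
  assumes "\<bar>x\<bar> \<le> 1"
  shows "ev (of_real x :: 'a::comm_banach_algebra) (mapA of_real D) = of_real (ev x D)"
  using chom_ev_commute[OF chom_of_real[where 'a = 'a], of x D] assms by simp

text \<open>Multiplication by this constant turns minus an imaginary part into a real part, so that
  \<open>Rf_derivatives\<close> applies a second time to the \<open>v\<close>-derivative, which is
  given by \<open>- Im\<close>.\<close>

definition imag :: "complex aps aps" where "imag = const (const \<i>)"

lemma Ev_imag:
  assumes "norm s \<le> 1" "norm t \<le> 1"
  shows "Ev imag s t = \<i>" and "Ev (imag * f) s t = \<i> * Ev f s t"
  using assms by (simp_all add: imag_def chom_mult[OF chom_Ev] Ev_const ev_const)

lemma Rf_imag: "\<rho> > 0 \<Longrightarrow> norm q < \<rho> \<Longrightarrow> Rf \<rho> (imag * f) q = - Im (Ez \<rho> f q)"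
  using norm_Zc_less[of \<rho> q] by (simp add: Rf_def Ev_imag)

lemma Zc_real: "Zc \<rho> (u, 0) = of_real (u / \<rho>)"
  by (simp add: Zc_def complex_eq_iff)

section \<open>The real map: gradient, Laplacian, equations, conformality\<close>

context char_solution
begin

definition "a i q = Ez \<rho> (da i) q"
definition "X p i q = p i + Rf \<rho> (S i) q" for p :: "nat \<Rightarrow> real"

lemma Zn: "norm q < \<rho> \<Longrightarrow> norm (Zc \<rho> q) < 1" using \<rho> by (rule norm_Zc_less)

text \<open>The reflection symmetry between \<open>da i\<close> and \<open>db i\<close>, taken at
  \<open>t = cnj s\<close>. Consequently \<open>a i\<close> alone carries the whole gradient of the
  i-th coordinate.\<close>

lemma db_conv: assumes q: "norm q < \<rho>" and i: "i \<in> {1,2,3}"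
  shows "Ez \<rho> (db i) q = cnj (a i q)"
proof -
  have "symr (da i) (db i)" unfolding da_def db_def by (intro symr_dif symc_mapA_cnj w_sym i)
  then have "Ez \<rho> (da i) q = cnj (Ev (db i) (cnj (cnj (Zc \<rho> q))) (cnj (Zc \<rho> q)))"
    using Zn[OF q] unfolding symr_def by (metis complex_mod_cnj)
  then show ?thesis by (simp add: a_def)
qed

lemma X_derivatives:
  assumes q: "norm q < \<rho>" and i: "i \<in> {1,2,3}"
  shows "((\<lambda>s. X p i (s, snd q)) has_real_derivative 2 * Re (a i q) / \<rho>) (at (fst q))"
    and "((\<lambda>s. X p i (fst q, s)) has_real_derivative - 2 * Im (a i q) / \<rho>) (at (snd q))"
proof -
  have z: "norm (Zc \<rho> q) < 1" "norm (cnj (Zc \<rho> q)) < 1" using Zn[OF q] by auto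
  note d = Rf_derivatives[OF \<rho> q sol_derivative_s[OF z] sol_derivative_t[OF z], of "\<alpha> i" "mapA cnj (\<alpha> i)" "w i"]
  note d = d[folded S_def da_def db_def, unfolded db_conv[OF q i], folded a_def]
  show "((\<lambda>s. X p i (s, snd q)) has_real_derivative 2 * Re (a i q) / \<rho>) (at (fst q))"
    using DERIV_add[OF DERIV_const[of "p i"] d(1)] by (simp add: X_def)
  show "((\<lambda>s. X p i (fst q, s)) has_real_derivative - 2 * Im (a i q) / \<rho>) (at (snd q))"
    using DERIV_add[OF DERIV_const[of "p i"] d(2)] by (simp add: X_def)
qed

lemma pu_X: "norm q < \<rho> \<Longrightarrow> i \<in> {1,2,3} \<Longrightarrow> pu (X p i) q = 2 * Re (a i q) / \<rho>"
  by (intro pu_eqI X_derivatives)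

lemma pv_X: "norm q < \<rho> \<Longrightarrow> i \<in> {1,2,3} \<Longrightarrow> pv (X p i) q = - 2 * Im (a i q) / \<rho>"
  by (intro pv_eqI X_derivatives)

lemma da_partials:
  assumes z: "norm s < 1" "norm t < 1"
  obtains e where "((\<lambda>s. Ev (da i) s t) has_field_derivative e) (at s)"
    "((\<lambda>t. Ev (da i) s t) has_field_derivative Ev (w i) s t) (at t)"
    "((\<lambda>(s, t). Ev (da i) s t) has_derivative (\<lambda>(h, k). e * h + Ev (w i) s t * k)) (at (s, t))"
proof -
  obtain e e' where e: "((\<lambda>(s, t). Ev (da i) s t) has_derivative (\<lambda>(h, k). e * h + e' * k)) (at (s, t))"
    using Ev_joint_ex[OF z] by blast
  have "((\<lambda>x. (x, t)) has_derivative (\<lambda>x. (x, 0))) (at s)" by (auto intro!: derivative_eq_intros)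
  from has_derivative_compose[OF this e] have 1: "((\<lambda>s. Ev (da i) s t) has_field_derivative e) (at s)"
    by (simp add: has_field_derivative_def)
  have 2: "((\<lambda>t. Ev (da i) s t) has_field_derivative Ev (w i) s t) (at t)"
    unfolding da_def by (rule dif_s_derivative_t[OF z])
  show thesis by (rule that[OF 1 2 Ev_joint[OF z 1 2]])
qed

text \<open>The pure second derivative \<open>e\<close> in \<open>s\<close> enters the
  \<open>u\<close>-part and the \<open>v\<close>-part with opposite signs and cancels; the mixed
  derivative enters both with the same sign.\<close>

lemma lap_X:
  assumes q: "norm q < \<rho>" and i: "i \<in> {1,2,3}"
  shows "lap (X p i) q = 4 * Re (Ez \<rho> (w i) q) / \<rho>\<^sup>2"
proof -
  define z where "z = Zc \<rho> q"
  have z: "norm z < 1" "norm (cnj z) < 1" using Zn[OF q] by (auto simp: z_def)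
  obtain e where e: "((\<lambda>s. Ev (da i) s (cnj z)) has_field_derivative e) (at z)"
    "((\<lambda>t. Ev (da i) z t) has_field_derivative Ev (w i) z (cnj z)) (at (cnj z))"
    using da_partials[OF z] by metis
  note d = Rf_derivatives[OF \<rho> q e[unfolded z_def], folded z_def]
  have "((\<lambda>s. Ev (imag * da i) s (cnj z)) has_field_derivative \<i> * e) (at z)"
    by (rule has_field_derivative_transform_ball[OF DERIV_cmult[OF e(1)] z(1)]) (use z in \<open>simp add: Ev_imag\<close>)
  moreover have "((\<lambda>t. Ev (imag * da i) z t) has_field_derivative \<i> * Ev (w i) z (cnj z)) (at (cnj z))"
    by (rule has_field_derivative_transform_ball[OF DERIV_cmult[OF e(2)] z(2)]) (use z in \<open>simp add: Ev_imag\<close>)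
  ultimately have di: "((\<lambda>s. Rf \<rho> (imag * da i) (fst q, s)) has_real_derivative
      Re (\<i> * (\<i> * e - \<i> * Ev (w i) z (cnj z))) / \<rho>) (at (snd q))"
    unfolding z_def by (rule Rf_derivatives(2)[OF \<rho> q])
  have "pu (pu (X p i)) q = 2 / \<rho> * (Re (e + Ev (w i) z (cnj z)) / \<rho>)"
  proof (rule pu_eqI, rule has_field_derivative_transform_within_open)
    show "((\<lambda>s. 2 / \<rho> * Rf \<rho> (da i) (s, snd q)) has_real_derivative
      2 / \<rho> * (Re (e + Ev (w i) z (cnj z)) / \<rho>)) (at (fst q))"
      by (rule DERIV_cmult[OF d(1)])
    show "open {s. norm (s, snd q) < \<rho>}" by (intro open_Collect_less continuous_intros)
    show "2 / \<rho> * Rf \<rho> (da i) (s, snd q) = pu (X p i) (s, snd q)" if "s \<in> {s. norm (s, snd q) < \<rho>}" for s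
      using that i by (simp add: pu_X Rf_def a_def)
  qed (use q in simp)
  moreover have "pv (pv (X p i)) q = 2 / \<rho> * (Re (\<i> * (\<i> * e - \<i> * Ev (w i) z (cnj z))) / \<rho>)"
  proof (rule pv_eqI, rule has_field_derivative_transform_within_open)
    show "((\<lambda>s. 2 / \<rho> * Rf \<rho> (imag * da i) (fst q, s)) has_real_derivative
      2 / \<rho> * (Re (\<i> * (\<i> * e - \<i> * Ev (w i) z (cnj z))) / \<rho>)) (at (snd q))"
      by (rule DERIV_cmult[OF di])
    show "open {s. norm (fst q, s) < \<rho>}" by (intro open_Collect_less continuous_intros)
    show "2 / \<rho> * Rf \<rho> (imag * da i) (fst q, s) = pv (X p i) (fst q, s)" if "s \<in> {s. norm (fst q, s) < \<rho>}" for s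
      using that i \<rho> by (simp add: pv_X Rf_imag a_def)
  qed (use q in simp)
  ultimately show ?thesis
    using \<rho> by (simp add: lap_def z_def field_simps power2_eq_square)
qed

text \<open>Stands for \<open>deriv \<phi>\<close> at the height of the surface; the series
  \<open>D\<close> is tied to \<open>\<phi>\<close> only in
  \<open>cauchy_solution_X\<close>.\<close>

definition "g q = ev (Rf \<rho> (S 3) q / r) D"

lemma Rf_S_bound: "norm q < \<rho> \<Longrightarrow> \<bar>Rf \<rho> (S 3) q\<bar> \<le> r"
proof -
  assume q: "norm q < \<rho>"
  have "\<bar>Rf \<rho> (S 3) q\<bar> \<le> norm (Ez \<rho> (S 3) q)"
    unfolding Rf_def by (rule abs_Re_le_cmod)
  also have "\<dots> \<le> norm (S 3)" using Zn[OF q] by (intro chom_norm[OF chom_Ev]) auto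
  also have "\<dots> \<le> r" using small by (simp add: S_def)
  finally show ?thesis .
qed

text \<open>By its reflection symmetry the height is real on the real plane, so the complex
  composition takes the value of the real series.\<close>

lemma Ev_G: assumes q: "norm q < \<rho>"
  shows "Ez \<rho> G q = of_real (g q)"
proof -
  let ?z = "Ez \<rho> (S 3) q"
  have "symr (S 3) (S 3)" unfolding S_def by (intro symr_sol symc_mapA_cnj w_sym) auto
  then have "?z = cnj (Ev (S 3) (cnj (cnj (Zc \<rho> q))) (cnj (Zc \<rho> q)))"
    using Zn[OF q] unfolding symr_def by (metis complex_mod_cnj)
  then have "?z = cnj ?z" unfolding complex_cnj_cnj .
  then have z: "?z = of_real (Rf \<rho> (S 3) q)" by (simp add: Rf_def complex_eq_iff)
  have "\<bar>Rf \<rho> (S 3) q / r\<bar> \<le> 1" using Rf_S_bound[OF q] r by simp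
  from ev_of_real[OF this, of D, where 'a = complex]
  show ?thesis
    unfolding G_def g_def using Zn[OF q] small r by (simp add: Ev_pcomp z S_def[symmetric])
qed

lemma Re_w:
  assumes q: "norm q < \<rho>"
  shows "Re (Ez \<rho> (w 1) q) = - g q * Re (a 1 q * cnj (a 3 q))"
    and "Re (Ez \<rho> (w 2) q) = - g q * Re (a 2 q * cnj (a 3 q))"
    and "Re (Ez \<rho> (w 3) q) = g q / 2 * (norm (a 1 q) ^ 2 + norm (a 2 q) ^ 2 - norm (a 3 q) ^ 2)"
proof -
  have z: "norm (Zc \<rho> q) < 1" "norm (cnj (Zc \<rho> q)) < 1" using Zn[OF q] by auto
  note W = Ev_w[OF z, unfolded Ev_G[OF q], folded a_def]
  have db: "Ez \<rho> (db 1) q = cnj (a 1 q)" "Ez \<rho> (db 2) q = cnj (a 2 q)"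
    "Ez \<rho> (db 3) q = cnj (a 3 q)"
    using db_conv[OF q] by auto
  show "Re (Ez \<rho> (w 1) q) = - g q * Re (a 1 q * cnj (a 3 q))"
    and "Re (Ez \<rho> (w 2) q) = - g q * Re (a 2 q * cnj (a 3 q))"
    unfolding W db by (simp_all add: algebra_simps)
  show "Re (Ez \<rho> (w 3) q) = g q / 2 * (norm (a 1 q) ^ 2 + norm (a 2 q) ^ 2 - norm (a 3 q) ^ 2)"
    unfolding W db cmod_power2 by (simp add: algebra_simps power2_eq_square add_divide_distrib diff_divide_distrib)
qed

lemma gdot_X: "norm q < \<rho> \<Longrightarrow> i \<in> {1,2,3} \<Longrightarrow> j \<in> {1,2,3} \<Longrightarrow>
    gdot (X p i) (X p j) q = 4 * Re (a i q * cnj (a j q)) / \<rho>\<^sup>2"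
  by (simp add: gdot_def pu_X pv_X power2_eq_square add_divide_distrib)

lemma pde:
  assumes q: "norm q < \<rho>"
  shows "lap (X p 1) q = - g q * gdot (X p 1) (X p 3) q"
    and "lap (X p 2) q = - g q * gdot (X p 2) (X p 3) q"
    and "lap (X p 3) q = - g q * ((- gdot (X p 1) (X p 1) q - gdot (X p 2) (X p 2) q + gdot (X p 3) (X p 3) q) / 2)"
proof -
  show "lap (X p 1) q = - g q * gdot (X p 1) (X p 3) q" "lap (X p 2) q = - g q * gdot (X p 2) (X p 3) q"
    using q by (simp_all only: lap_X gdot_X Re_w insert_iff simp_thms) simp_all
  show "lap (X p 3) q = - g q * ((- gdot (X p 1) (X p 1) q - gdot (X p 2) (X p 2) q + gdot (X p 3) (X p 3) q) / 2)"
  proof -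
    have n: "Re (a i q * cnj (a i q)) = (norm (a i q))\<^sup>2" for i
      unfolding cmod_power2 by (simp add: power2_eq_square)
    have "4 * (c / 2 * (x + y - z)) / d = - c * ((- (4 * x / d) - 4 * y / d + 4 * z / d) / 2)" for c d x y z :: real
      by (cases "d = 0") (simp_all add: field_simps)
    then show ?thesis using q by (simp only: lap_X gdot_X Re_w n insert_iff simp_thms)
  qed
qed

lemma a_isotropic:
  assumes q: "norm q < \<rho>"
  shows "(Re (a 1 q))\<^sup>2 + (Re (a 2 q))\<^sup>2 + (Re (a 3 q))\<^sup>2 = (Im (a 1 q))\<^sup>2 + (Im (a 2 q))\<^sup>2 + (Im (a 3 q))\<^sup>2"
    and "Re (a 1 q) * Im (a 1 q) + Re (a 2 q) * Im (a 2 q) + Re (a 3 q) * Im (a 3 q) = 0"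
proof -
  have "(a 1 q)\<^sup>2 + (a 2 q)\<^sup>2 + (a 3 q)\<^sup>2 = 0"
    unfolding a_def using Zn[OF q] by (intro isotropic) auto
  from arg_cong[OF this, of Re] arg_cong[OF this, of Im]
  show "(Re (a 1 q))\<^sup>2 + (Re (a 2 q))\<^sup>2 + (Re (a 3 q))\<^sup>2 = (Im (a 1 q))\<^sup>2 + (Im (a 2 q))\<^sup>2 + (Im (a 3 q))\<^sup>2"
    and "Re (a 1 q) * Im (a 1 q) + Re (a 2 q) * Im (a 2 q) + Re (a 3 q) * Im (a 3 q) = 0"
    by (simp_all add: power2_eq_square algebra_simps)
qed

lemma conformal:
  assumes q: "norm q < \<rho>"
  shows "(pu (X p 1) q)\<^sup>2 + (pu (X p 2) q)\<^sup>2 + (pu (X p 3) q)\<^sup>2 = (pv (X p 1) q)\<^sup>2 + (pv (X p 2) q)\<^sup>2 + (pv (X p 3) q)\<^sup>2"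
    and "pu (X p 1) q * pv (X p 1) q + pu (X p 2) q * pv (X p 2) q + pu (X p 3) q * pv (X p 3) q = 0"
proof -
  define c where "c = 2 / \<rho>"
  have d: "pu (X p i) q = c * Re (a i q)" "pv (X p i) q = - (c * Im (a i q))" if "i \<in> {1,2,3}" for i
    using that q by (simp_all add: pu_X pv_X c_def)
  have "(pu (X p 1) q)\<^sup>2 + (pu (X p 2) q)\<^sup>2 + (pu (X p 3) q)\<^sup>2 = c\<^sup>2 * ((Re (a 1 q))\<^sup>2 + (Re (a 2 q))\<^sup>2 + (Re (a 3 q))\<^sup>2)"
    "(pv (X p 1) q)\<^sup>2 + (pv (X p 2) q)\<^sup>2 + (pv (X p 3) q)\<^sup>2 = c\<^sup>2 * ((Im (a 1 q))\<^sup>2 + (Im (a 2 q))\<^sup>2 + (Im (a 3 q))\<^sup>2)"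
    "pu (X p 1) q * pv (X p 1) q + pu (X p 2) q * pv (X p 2) q + pu (X p 3) q * pv (X p 3) q =
      - c\<^sup>2 * (Re (a 1 q) * Im (a 1 q) + Re (a 2 q) * Im (a 2 q) + Re (a 3 q) * Im (a 3 q))"
    by (simp_all add: d power2_eq_square algebra_simps)
  then show "(pu (X p 1) q)\<^sup>2 + (pu (X p 2) q)\<^sup>2 + (pu (X p 3) q)\<^sup>2 = (pv (X p 1) q)\<^sup>2 + (pv (X p 2) q)\<^sup>2 + (pv (X p 3) q)\<^sup>2"
    and "pu (X p 1) q * pv (X p 1) q + pu (X p 2) q * pv (X p 2) q + pu (X p 3) q * pv (X p 3) q = 0"
    by (simp_all only: a_isotropic[OF q] mult_zero_right)
qed

lemma a_real: "\<bar>u\<bar> < \<rho> \<Longrightarrow> a i (u, 0) = ev (of_real (u / \<rho>)) (\<alpha> i)"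
  using \<rho> unfolding a_def Zc_real da_def complex_cnj_complex_of_real by (intro dif_s_diag) (simp add: norm_divide)

lemma X_0: "X p i (0, 0) = p i"
  unfolding X_def Rf_def Zc_real by (simp add: S_def sol_0)

text \<open>Up to the factor \<open>4 / \<rho>\<^sup>2\<close> its trace is the third component of \<open>\<psi>\<^sub>u \<times> \<psi>\<^sub>v\<close>.\<close>
definition "nrm = - (imag * (da 1 * db 2))"

lemma Rf_nrm:
  assumes q: "norm q < \<rho>"
  shows "pu (X p 1) q * pv (X p 2) q - pu (X p 2) q * pv (X p 1) q = 4 / \<rho>\<^sup>2 * Rf \<rho> nrm q"
proof -
  have db2: "Ez \<rho> (db 2) q = cnj (a 2 q)" using db_conv[OF q] by auto
  have "Ez \<rho> nrm q = - \<i> * (a 1 q * cnj (a 2 q))"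
    using Zn[OF q] unfolding nrm_def
    by (simp add: chom_minus[OF chom_Ev] Ev_imag chom_mult[OF chom_Ev] db2 a_def[symmetric])
  then show ?thesis
    using q \<rho> by (simp add: Rf_def pu_X pv_X field_simps power2_eq_square)
qed

lemma nrm_derivative:
  assumes "norm q < \<rho> / 2"
  shows "((\<lambda>s. Rf \<rho> nrm (fst q, s)) has_real_derivative
    Re (\<i> * (Ev (mapA der nrm) (2 * Zc \<rho> q) (cnj (Zc \<rho> q)) - Ev (der nrm) (Zc \<rho> q) (2 * cnj (Zc \<rho> q)))) / \<rho>) (at (snd q))"
proof (rule Rf_derivatives(2)[OF \<rho>])
  have "norm (Zc \<rho> q) < 1/2" using assms \<rho> by (simp add: norm_Zc field_simps)
  then show "((\<lambda>s. Ev nrm s (cnj (Zc \<rho> q))) has_field_derivative Ev (mapA der nrm) (2 * Zc \<rho> q) (cnj (Zc \<rho> q))) (at (Zc \<rho> q))"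
    "(Ev nrm (Zc \<rho> q) has_field_derivative Ev (der nrm) (Zc \<rho> q) (2 * cnj (Zc \<rho> q))) (at (cnj (Zc \<rho> q)))"
    by (intro Ev_der_inner Ev_der_outer; simp)+
qed (use assms \<rho> in \<open>auto intro: less_le_trans\<close>)

text \<open>The condition \<open>g\<close> says that along the axis the gradients of the first two
  coordinates are orthogonal to that of the third. The mixed derivatives \<open>w 1\<close> and
  \<open>w 2\<close> then vanish there, so the remaining partial of \<open>da 1\<close> or of
  \<open>db 2\<close> equals its derivative along the diagonal, where both functions are given by
  the data.\<close>

lemma nrm_derivative_axis:
  assumes u: "\<bar>u\<bar> < \<rho>" and g: "\<And>i. i \<in> {1,2} \<Longrightarrow> Re (a i (u, 0) * cnj (a 3 (u, 0))) = 0"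
    and d: "((\<lambda>t. ev t (\<alpha> 1)) has_field_derivative d1) (at (of_real (u / \<rho>)))"
      "((\<lambda>t. ev t (\<alpha> 2)) has_field_derivative d2) (at (of_real (u / \<rho>)))"
  shows "((\<lambda>s. Rf \<rho> nrm (u, s)) has_real_derivative Re (d1 * cnj (a 2 (u, 0)) - a 1 (u, 0) * cnj d2) / \<rho>) (at 0)"
proof -
  define t :: complex where "t = of_real (u / \<rho>)"
  have q: "norm (u, 0::real) < \<rho>" using u by (simp add: norm_prod_def)
  have Z: "Zc \<rho> (u, 0) = t" "cnj t = t" unfolding t_def by (simp_all add: Zc_real)
  have t: "norm t < 1" using Zn[OF q] by (simp add: Z)
  have b: "Ev (db i) t t = cnj (a i (u, 0))" if "i \<in> {1,2,3}" for i
    using db_conv[OF q that] by (simp add: Z)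
  have aa: "Ev (da i) t t = a i (u, 0)" for i
    by (simp add: a_def Z)
  have w0: "Ev (w i) t t = 0" if "i \<in> {1,2}" for i
  proof -
    have "a i (u, 0) * cnj (a 3 (u, 0)) + cnj (a i (u, 0) * cnj (a 3 (u, 0))) = 0"
      unfolding complex_add_cnj g[OF that] by simp
    moreover have "Ev (w i) t t = - (1/2) * Ev G t t * (a i (u, 0) * cnj (a 3 (u, 0)) + cnj (a i (u, 0) * cnj (a 3 (u, 0))))"
      using that Ev_w(1,2)[OF t t] by (auto simp: b aa)
    ultimately show ?thesis by (simp only: mult_zero_right)
  qed
  have e1: "((\<lambda>s. Ev (da 1) s t) has_field_derivative d1) (at t)"
   and f1: "((\<lambda>s. Ev (da 1) t s) has_field_derivative 0) (at t)"
  proof -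
    obtain e where e: "((\<lambda>s. Ev (da 1) s t) has_field_derivative e) (at t)"
      "((\<lambda>s. Ev (da 1) t s) has_field_derivative Ev (w 1) t t) (at t)"
      "((\<lambda>(s, t). Ev (da 1) s t) has_derivative (\<lambda>(h, k). e * h + Ev (w 1) t t * k)) (at (t, t))"
      using da_partials[OF t t] by metis
    have "((\<lambda>x. (x, x)) has_derivative (\<lambda>x. (x, x))) (at t)" by (auto intro!: derivative_eq_intros)
    from has_derivative_compose[OF this e(3)] have "((\<lambda>s. Ev (da 1) s s) has_field_derivative e) (at t)"
      by (simp add: has_field_derivative_def w0)
    moreover have "((\<lambda>s. Ev (da 1) s s) has_field_derivative d1) (at t)"
      by (rule has_field_derivative_transform_ball[OF d(1)[folded t_def] t]) (simp add: da_def dif_s_diag)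
    ultimately have "e = d1" by (rule DERIV_unique)
    then show "((\<lambda>s. Ev (da 1) s t) has_field_derivative d1) (at t)"
       "((\<lambda>s. Ev (da 1) t s) has_field_derivative 0) (at t)" using e by (simp_all add: w0)
  qed
  have e2: "((\<lambda>s. Ev (db 2) t s) has_field_derivative cnj d2) (at t)"
   and f2: "((\<lambda>s. Ev (db 2) s t) has_field_derivative 0) (at t)"
  proof -
    obtain e e' where e: "((\<lambda>(s, t). Ev (db 2) s t) has_derivative (\<lambda>(h, k). e' * h + e * k)) (at (t, t))"
      using Ev_joint_ex[OF t t] by blast
    have "((\<lambda>x. (t, x)) has_derivative (\<lambda>x. (0, x))) (at t)" by (auto intro!: derivative_eq_intros)
    from has_derivative_compose[OF this e] have 1: "((\<lambda>s. Ev (db 2) t s) has_field_derivative e) (at t)"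
      by (simp add: has_field_derivative_def)
    have "((\<lambda>x. (x, t)) has_derivative (\<lambda>x. (x, 0))) (at t)" by (auto intro!: derivative_eq_intros)
    from has_derivative_compose[OF this e] have 2: "((\<lambda>s. Ev (db 2) s t) has_field_derivative e') (at t)"
      by (simp add: has_field_derivative_def)
    moreover have 3: "((\<lambda>s. Ev (db 2) s t) has_field_derivative 0) (at t)"
      using dif_t_derivative_s[OF t t, of "mapA cnj (\<alpha> 2)" "w 2"] by (simp add: db_def w0)
    ultimately have e'0: "e' = 0" by (rule DERIV_unique)
    have "((\<lambda>x. (x, x)) has_derivative (\<lambda>x. (x, x))) (at t)" by (auto intro!: derivative_eq_intros)
    from has_derivative_compose[OF this e] have "((\<lambda>s. Ev (db 2) s s) has_field_derivative e) (at t)"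
      by (simp add: has_field_derivative_def e'0)
    moreover have "((\<lambda>s. Ev (db 2) s s) has_field_derivative cnj d2) (at t)"
    proof (rule has_field_derivative_transform_ball[OF _ t])
      show "((cnj \<circ> (\<lambda>t. ev t (\<alpha> 2)) \<circ> cnj) has_field_derivative cnj d2) (at t)"
        by (rule has_field_derivative_cnj_cnj) (use d(2) Z t_def in simp)
    qed (simp add: db_def dif_t_diag ev_mapA_cnj)
    ultimately have "e = cnj d2" by (rule DERIV_unique)
    then show "((\<lambda>s. Ev (db 2) t s) has_field_derivative cnj d2) (at t)"
      "((\<lambda>s. Ev (db 2) s t) has_field_derivative 0) (at t)" using 1 3 by simp_all
  qed
  have n: "Ev nrm s t = - \<i> * (Ev (da 1) s t * Ev (db 2) s t)" if "norm s < 1" "norm t < 1" for s t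
    using that by (simp add: nrm_def chom_minus[OF chom_Ev] Ev_imag chom_mult[OF chom_Ev])
  have n1: "((\<lambda>s. Ev nrm s t) has_field_derivative - \<i> * (d1 * Ev (db 2) t t + 0 * Ev (da 1) t t)) (at t)"
    by (rule has_field_derivative_transform_ball[OF DERIV_cmult[OF DERIV_mult[OF e1 f2]] t]) (simp add: n t)
  have n2: "((\<lambda>s. Ev nrm t s) has_field_derivative - \<i> * (0 * Ev (db 2) t t + cnj d2 * Ev (da 1) t t)) (at t)"
    by (rule has_field_derivative_transform_ball[OF DERIV_cmult[OF DERIV_mult[OF f1 e2]] t]) (simp add: n t)
  have "((\<lambda>s. Rf \<rho> nrm (u, s)) has_real_derivative
     Re (\<i> * (- \<i> * (d1 * Ev (db 2) t t + 0 * Ev (da 1) t t) - - \<i> * (0 * Ev (db 2) t t + cnj d2 * Ev (da 1) t t))) / \<rho>)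
     (at 0)"
    by (rule Rf_derivatives(2)[OF \<rho> q, unfolded fst_conv snd_conv]) (simp_all only: Z n1 n2)
  then show ?thesis by (simp add: b aa algebra_simps)
qed

end

section \<open>Uniqueness\<close>

abbreviation "E_s F s t \<equiv> Ev (mapA der F) (2 * s) t"
abbreviation "E_t F s t \<equiv> Ev (der F) s (2 * t)"
text \<open>Half the Laplacian of the evaluated series: each \<open>der\<close> doubles its
  argument, and differentiating an already doubled argument yields a factor 2, which is left out
  here.\<close>

abbreviation "E_lap F s t \<equiv> Ev (mapA der (mapA der F)) (4 * s) t + Ev (der (der F)) s (4 * t)"
abbreviation "rep f r F \<equiv> \<forall>s t. \<bar>s\<bar> \<le> 1 \<longrightarrow> \<bar>t\<bar> \<le> 1 \<longrightarrow> f (r * s, r * t) = Ev F s t"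

section \<open>Order of vanishing\<close>

lemma norm_ev_vanishing:
  fixes f :: "'a::comm_banach_algebra aps"
  assumes z: "\<And>n. n < k \<Longrightarrow> coef f n = 0" and t: "norm t \<le> 1"
  shows "norm (ev t f) \<le> norm f * norm t ^ k"
proof -
  have le: "norm (coef f n * t ^ n) \<le> norm (coef f n) * norm t ^ k" for n
  proof (cases "n < k")
    case False
    have "norm (coef f n * t ^ n) \<le> norm (coef f n) * norm t ^ n"
      by (intro order_trans[OF norm_mult_ineq] mult_left_mono norm_power_ineq norm_ge_zero)
    also have "\<dots> \<le> norm (coef f n) * norm t ^ k"
      using False t by (intro mult_left_mono power_decreasing) auto
    finally show ?thesis .
  qed (simp add: z)
  have "norm (ev t f) \<le> (\<Sum>n. norm (coef f n) * norm t ^ k)"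
    unfolding ev_def by (rule norm_suminf_le[OF le]) (intro summable_mult2 summable_norm_coef)
  also have "\<dots> = norm f * norm t ^ k"
    unfolding norm_aps_def by (rule suminf_mult2[symmetric]) simp
  finally show ?thesis .
qed

text \<open>Up to order \<open>Suc m\<close> the function is \<open>coef h m * \<tau> ^ m\<close>;
  divide by \<open>\<tau> ^ m\<close> and let \<open>\<tau>\<close> tend to 0. Only positive
  \<open>\<tau>\<close> are used, which is what the continuation along rays provides.\<close>

lemma coef_eq_0I:
  fixes h :: "real aps"
  assumes z: "\<And>n. n < m \<Longrightarrow> coef h n = 0" and \<delta>: "\<delta> > 0"
    and b: "\<And>\<tau>. 0 < \<tau> \<Longrightarrow> \<tau> < \<delta> \<Longrightarrow> \<bar>ev \<tau> h\<bar> \<le> K * \<tau> ^ Suc m"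
  shows "coef h m = 0"
proof -
  define c where "c = coef h m"
  define e where "e = Aps (\<lambda>n. if n = m then c else 0)"
  have e: "coef e n = (if n = m then c else 0)" for n
    unfolding e_def by (rule coef_Aps, rule summable_finite[of "{m}"]) auto
  have eve: "ev \<tau> e = c * \<tau> ^ m" for \<tau> :: real
  proof -
    have "ev \<tau> e = (\<Sum>n\<in>{m}. coef e n * \<tau> ^ n)"
      unfolding ev_def by (rule suminf_finite) (auto simp: e)
    then show ?thesis by (simp add: e)
  qed
  have v: "coef (h - e) n = 0" if "n < Suc m" for n
    using that z[of n] by (cases "n = m") (auto simp: e c_def)
  have "\<bar>c\<bar> \<le> (K + norm (h - e)) * \<tau>" if \<tau>: "0 < \<tau>" "\<tau> < min \<delta> 1" for \<tau>
  proof -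
    have v2: "\<bar>ev \<tau> (h - e)\<bar> \<le> norm (h - e) * \<tau> ^ Suc m"
      using norm_ev_vanishing[of "Suc m" "h - e" \<tau>] v \<tau> by simp
    have "c * \<tau> ^ m = ev \<tau> h - ev \<tau> (h - e)"
      using \<tau> by (simp add: clin_diff clin_ev eve)
    also have "\<bar>\<dots>\<bar> \<le> K * \<tau> ^ Suc m + norm (h - e) * \<tau> ^ Suc m"
      using b[of \<tau>] v2 \<tau> by linarith
    also have "\<dots> = ((K + norm (h - e)) * \<tau>) * \<tau> ^ m" by (simp add: algebra_simps)
    finally have "\<bar>c\<bar> * \<tau> ^ m \<le> ((K + norm (h - e)) * \<tau>) * \<tau> ^ m" using \<tau> by (simp add: abs_mult)
    then show ?thesis using \<tau> by simp
  qed
  then have low: "\<forall>\<^sub>F \<tau> in at_right 0. \<bar>c\<bar> \<le> (K + norm (h - e)) * \<tau>"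
    using \<delta> by (intro eventually_at_rightI[of 0 "min \<delta> 1"]) auto
  have lim: "((\<lambda>\<tau>. (K + norm (h - e)) * \<tau>) \<longlongrightarrow> (K + norm (h - e)) * 0) (at_right 0)"
    by (intro tendsto_intros)
  have "\<bar>c\<bar> \<le> (K + norm (h - e)) * 0"
    by (rule tendsto_lowerbound[OF lim low]) simp
  then show ?thesis by (simp add: c_def)
qed

lemma aps_eq_0I:
  fixes h :: "real aps"
  assumes "\<delta> > 0" and "\<And>\<tau>. 0 < \<tau> \<Longrightarrow> \<tau> < \<delta> \<Longrightarrow> ev \<tau> h = 0"
  shows "h = 0"
proof (rule aps_eqI)
  fix n show "coef h n = coef 0 n"
  proof (induction n rule: less_induct)
    case (less n)
    then show ?case using coef_eq_0I[of n h \<delta> 0] assms by simp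
  qed
qed

text \<open>The lowest power of \<open>t\<close> that occurs in \<open>D\<close> would have to be cancelled by terms of higher order.\<close>
lemma unique_continuation:
  fixes D :: "nat \<Rightarrow> real aps aps"
  assumes J: "finite J" and \<theta>: "\<theta> > 0" "\<theta> \<le> 1 / 4"
    and ineq: "\<And>i \<sigma> t. i \<in> J \<Longrightarrow> \<bar>\<sigma>\<bar> < \<theta> \<Longrightarrow> \<bar>t\<bar> < \<theta> \<Longrightarrow>
      \<bar>E_lap (D i) \<sigma> t\<bar>
      \<le> C * (\<Sum>j\<in>J. \<bar>Ev (D j) \<sigma> t\<bar> + \<bar>E_s (D j) \<sigma> t\<bar> + \<bar>E_t (D j) \<sigma> t\<bar>)"
    and C: "C \<ge> 0"
    and init: "\<And>i. i \<in> J \<Longrightarrow> coef (D i) 0 = 0" "\<And>i. i \<in> J \<Longrightarrow> coef (D i) 1 = 0"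
  shows "i \<in> J \<Longrightarrow> D i = 0"
proof -
  have "\<forall>i\<in>J. coef (D i) n = 0" for n
  proof (induction n rule: less_induct)
    case (less k)
    show ?case
    proof (cases "k < 2")
      case True
      then show ?thesis using init by (auto simp: less_2_cases_iff)
    next
      case False
      then obtain m where k: "k = Suc (Suc m)" by (metis add_2_eq_Suc le_Suc_ex not_less)
      have mono: "\<bar>t\<bar> ^ k \<le> \<bar>t\<bar> ^ Suc m" if "\<bar>t\<bar> < \<theta>" for t
        using that \<theta> by (intro power_decreasing) (auto simp: k)
      \<comment> \<open>With \<open>k = m + 2\<close> the known zeros make \<open>D j\<close> and
        its \<open>s\<close>-derivatives of order \<open>k\<close> in \<open>t\<close>, and its
        \<open>t\<close>-derivative of order \<open>m + 1\<close>, the worst of all. The second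
        \<open>t\<close>-derivative starts at order \<open>m\<close>, so the inequality makes it one
        order too small.\<close>
      have low: "\<bar>Ev (D j) \<sigma> t\<bar> \<le> norm (D j) * \<bar>t\<bar> ^ Suc m"
        "\<bar>E_s (D j) \<sigma> t\<bar> \<le> norm (D j) * \<bar>t\<bar> ^ Suc m"
        "\<bar>Ev (mapA der (mapA der (D j))) (4 * \<sigma>) t\<bar> \<le> norm (D j) * \<bar>t\<bar> ^ Suc m"
        "\<bar>E_t (D j) \<sigma> t\<bar> \<le> norm (D j) * (2 ^ Suc m * \<bar>t\<bar> ^ Suc m)"
        if j: "j \<in> J" and st: "\<bar>\<sigma>\<bar> < \<theta>" "\<bar>t\<bar> < \<theta>" for j \<sigma> t
      proof -
        have gen: "\<bar>Ev H s t\<bar> \<le> norm H * \<bar>t\<bar> ^ l"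
          if "\<And>n. n < l \<Longrightarrow> coef H n = 0" "\<bar>s\<bar> \<le> 1" "\<bar>t\<bar> \<le> 1" for H :: "real aps aps" and s t l
        proof -
          have s: "norm s \<le> 1" using that by simp
          have "norm (ev t (mapA (ev s) H)) \<le> norm (mapA (ev s) H) * norm t ^ l"
            using that by (intro norm_ev_vanishing) (auto simp: coef_mapA clin_ev clin_zero[OF clin_ev])
          also have "\<dots> \<le> norm H * norm t ^ l"
            using clin_norm[OF clin_mapA[OF clin_ev[OF s]], of H] by (intro mult_right_mono) auto
          finally show ?thesis by (simp add: Ev_def)
        qed
        have nd: "norm (mapA der (D j)) \<le> norm (D j)" "norm (mapA der (mapA der (D j))) \<le> norm (D j)"
          "norm (der (D j)) \<le> norm (D j)"
          by (meson clin_norm clin_mapA clin_der order_trans)+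
        have z: "coef (D j) n = 0" if "n < k" for n using less that j by blast
        have z1: "coef (mapA der (D j)) n = 0" "coef (mapA der (mapA der (D j))) n = 0" if "n < k" for n
          using z[OF that] by (simp_all add: coef_mapA clin_mapA clin_der clin_zero[OF clin_der])
        have z2: "coef (der (D j)) n = 0" if "n < Suc m" for n
          using z[of "Suc n"] that by (simp add: coef_der k)
        have bd: "\<bar>\<sigma>\<bar> \<le> 1" "\<bar>t\<bar> \<le> 1" "\<bar>2 * \<sigma>\<bar> \<le> 1" "\<bar>4 * \<sigma>\<bar> \<le> 1" "\<bar>2 * t\<bar> \<le> 1" using st \<theta> by auto
        have mono': "norm H * \<bar>t\<bar> ^ k \<le> norm (D j) * \<bar>t\<bar> ^ Suc m" if "norm H \<le> norm (D j)" for H :: "real aps aps"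
          using that by (intro mult_mono mono st) auto
        have "\<bar>Ev (D j) \<sigma> t\<bar> \<le> norm (D j) * \<bar>t\<bar> ^ k"
          by (rule gen[OF _ bd(1,2)]) (rule z)
        with mono'[OF order_refl] show "\<bar>Ev (D j) \<sigma> t\<bar> \<le> norm (D j) * \<bar>t\<bar> ^ Suc m"
          by (rule order_trans[rotated])
        have "\<bar>E_s (D j) \<sigma> t\<bar> \<le> norm (mapA der (D j)) * \<bar>t\<bar> ^ k"
          by (rule gen[OF _ bd(3,2)]) (rule z1)
        with mono'[OF nd(1)] show "\<bar>E_s (D j) \<sigma> t\<bar> \<le> norm (D j) * \<bar>t\<bar> ^ Suc m"
          by (rule order_trans[rotated])
        have "\<bar>Ev (mapA der (mapA der (D j))) (4 * \<sigma>) t\<bar> \<le> norm (mapA der (mapA der (D j))) * \<bar>t\<bar> ^ k"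
          by (rule gen[OF _ bd(4,2)]) (rule z1)
        with mono'[OF nd(2)] show "\<bar>Ev (mapA der (mapA der (D j))) (4 * \<sigma>) t\<bar> \<le> norm (D j) * \<bar>t\<bar> ^ Suc m"
          by (rule order_trans[rotated])
        have "\<bar>E_t (D j) \<sigma> t\<bar> \<le> norm (der (D j)) * \<bar>2 * t\<bar> ^ Suc m"
          by (rule gen[OF _ bd(1,5)]) (rule z2)
        also have "\<dots> \<le> norm (D j) * \<bar>2 * t\<bar> ^ Suc m"
          by (intro mult_right_mono nd) simp
        finally have "\<bar>E_t (D j) \<sigma> t\<bar> \<le> norm (D j) * \<bar>2 * t\<bar> ^ Suc m" .
        then show "\<bar>E_t (D j) \<sigma> t\<bar> \<le> norm (D j) * (2 ^ Suc m * \<bar>t\<bar> ^ Suc m)"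
          by (simp only: abs_mult power_mult_distrib abs_numeral)
      qed
      define N where "N = (\<Sum>j\<in>J. norm (D j) + norm (D j) + norm (D j) * 2 ^ Suc m)"
      have "coef (D i) k = 0" if i: "i \<in> J" for i
      proof -
        \<comment> \<open>A nonzero multiple of \<open>coef (D i) k\<close>. It is itself a series
          in \<open>s\<close>, shown to vanish at all small positive
          \<open>\<sigma>\<close>.\<close>
        have "coef (der (der (D i))) m = 0"
        proof (rule aps_eq_0I[OF \<theta>(1)])
          fix \<sigma> :: real assume \<sigma>: "0 < \<sigma>" "\<sigma> < \<theta>"
          then have \<sigma>': "\<bar>\<sigma>\<bar> < \<theta>" "norm \<sigma> \<le> 1" using \<theta> by auto
          have "coef (mapA (ev \<sigma>) (der (der (D i)))) m = 0"
          proof (rule coef_eq_0I)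
            \<comment> \<open>\<open>E_lap\<close> evaluates the second \<open>t\<close>-derivative
              at \<open>4 * t\<close>, so \<open>\<tau> = 4 * t\<close> ranges over four times the
              interval of \<open>t\<close>.\<close>
            show "4 * \<theta> > 0" using \<theta> by simp
            show "coef (mapA (ev \<sigma>) (der (der (D i)))) n = 0" if "n < m" for n
              using less that i \<sigma>' by (simp add: coef_mapA clin_ev coef_der k clin_zero[OF clin_ev])
            fix \<tau> assume \<tau>: "0 < \<tau>" "\<tau> < 4 * \<theta>"
            define t where "t = \<tau> / 4"
            have t: "\<bar>t\<bar> < \<theta>" "\<bar>t\<bar> \<le> \<tau>" "4 * t = \<tau>" using \<tau> by (auto simp: t_def)
            have "(\<Sum>j\<in>J. \<bar>Ev (D j) \<sigma> t\<bar> + \<bar>E_s (D j) \<sigma> t\<bar> + \<bar>E_t (D j) \<sigma> t\<bar>)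
                \<le> N * \<bar>t\<bar> ^ Suc m"
              unfolding N_def sum_distrib_right using low[OF _ \<sigma>'(1) t(1)]
              by (intro sum_mono) (simp only: distrib_right mult.assoc add_mono)
            then have "C * (\<Sum>j\<in>J. \<bar>Ev (D j) \<sigma> t\<bar> + \<bar>E_s (D j) \<sigma> t\<bar> + \<bar>E_t (D j) \<sigma> t\<bar>)
                \<le> C * (N * \<bar>t\<bar> ^ Suc m)"
              by (rule mult_left_mono[OF _ C])
            then have "\<bar>Ev (der (der (D i))) \<sigma> (4 * t)\<bar> \<le> C * (N * \<bar>t\<bar> ^ Suc m) + norm (D i) * \<bar>t\<bar> ^ Suc m"
              using ineq[OF i \<sigma>'(1) t(1)] low(3)[OF i \<sigma>'(1) t(1)] by linarith
            also have "\<dots> = (C * N + norm (D i)) * \<bar>t\<bar> ^ Suc m" by (simp add: algebra_simps)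
            also have "\<dots> \<le> (C * N + norm (D i)) * \<tau> ^ Suc m"
              using C t by (intro mult_left_mono power_mono add_nonneg_nonneg mult_nonneg_nonneg)
                (auto simp: N_def intro!: sum_nonneg)
            finally show "\<bar>ev \<tau> (mapA (ev \<sigma>) (der (der (D i))))\<bar> \<le> (C * N + norm (D i)) * \<tau> ^ Suc m"
              by (simp add: Ev_def t)
          qed
          then show "ev \<sigma> (coef (der (der (D i))) m) = 0"
            using \<sigma>' by (simp add: coef_mapA clin_ev)
        qed
        then show ?thesis by (simp add: coef_der k)
      qed
      then show ?thesis by blast
    qed
  qed
  then show "i \<in> J \<Longrightarrow> D i = 0" by (intro aps_eqI) simp
qed

section \<open>Analytic continuation along rays\<close>

lemma Ev_line:
  fixes F :: "real aps aps"
  assumes "\<bar>a\<bar> \<le> 1" "\<bar>b\<bar> \<le> 1"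
  shows "\<exists>W. \<forall>\<tau>. \<bar>\<tau>\<bar> \<le> 1 \<longrightarrow> Ev F (a * \<tau>) (b * \<tau>) = ev \<tau> W"
proof (intro exI allI impI)
  define P Q :: "real aps" where "P = a *\<^sub>R var" and "Q = b *\<^sub>R var"
  have P: "norm P \<le> 1" and Q: "norm Q \<le> 1" using assms by (simp_all add: P_def Q_def norm_var)
  fix \<tau> :: real assume "\<bar>\<tau>\<bar> \<le> 1"
  then have E: "chom (ev \<tau>)" by (simp add: chom_ev)
  have PQ: "ev \<tau> P = a * \<tau>" "ev \<tau> Q = b * \<tau>"
    by (simp_all add: P_def Q_def chom_scaleR[OF E] ev_var)
  have 1: "ev \<tau> (ev P (mapA const g)) = ev (a * \<tau>) g" for g
    by (simp add: chom_ev_commute[OF E P] mapA_mapA chom_clin[OF E] clin_const ev_const mapA_id PQ)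
  have "clin (\<lambda>g. ev P (mapA const g))"
    by (rule clin_compose[OF clin_ev[OF P] clin_mapA[OF clin_const]])
  then show "Ev F (a * \<tau>) (b * \<tau>) = ev \<tau> (ev Q (mapA (\<lambda>g. ev P (mapA const g)) F))"
    by (simp add: chom_ev_commute[OF E Q] mapA_mapA chom_clin[OF E] 1 PQ Ev_def)
qed

text \<open>The parameter is oriented backwards, so that positive \<open>\<tau>\<close> lowers the
  ray parameter below \<open>s\<close>, the side on which equality will be known. The number
  \<open>k\<close> scales the direction \<open>q\<close> into the unit square.\<close>

lemma loc_an_ray:
  assumes f: "loc_an f (s *\<^sub>R q)"
  shows "\<exists>c>0. \<exists>W. \<forall>\<tau>. \<bar>\<tau>\<bar> \<le> 1 \<longrightarrow> f ((s - c * \<tau>) *\<^sub>R q) = ev \<tau> W"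
proof -
  obtain r F where r: "r > 0" and F: "\<And>a b. \<bar>a\<bar> \<le> 1 \<Longrightarrow> \<bar>b\<bar> \<le> 1 \<Longrightarrow>
      f (s * fst q + r * a, s * snd q + r * b) = Ev F a b"
    using f by (auto simp: loc_an_def)
  define k where "k = 1 + \<bar>fst q\<bar> + \<bar>snd q\<bar>"
  have k: "k > 0" "\<bar>- fst q / k\<bar> \<le> 1" "\<bar>- snd q / k\<bar> \<le> 1" by (auto simp: k_def)
  obtain W where W: "\<And>\<tau>. \<bar>\<tau>\<bar> \<le> 1 \<Longrightarrow> Ev F (- fst q / k * \<tau>) (- snd q / k * \<tau>) = ev \<tau> W"
    using Ev_line[OF k(2,3)] by blast
  have "f ((s - r / k * \<tau>) *\<^sub>R q) = ev \<tau> W" if \<tau>: "\<bar>\<tau>\<bar> \<le> 1" for \<tau>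
  proof -
    have "\<bar>- fst q / k * \<tau>\<bar> \<le> 1" "\<bar>- snd q / k * \<tau>\<bar> \<le> 1"
      unfolding abs_mult using k \<tau> by (intro mult_le_one; simp)+
    from F[OF this] W[OF \<tau>] show ?thesis
      by (cases q) (simp add: algebra_simps)
  qed
  then show ?thesis using r k by (intro exI[of _ "r / k"]) auto
qed

text \<open>Let \<open>s\<close> be the infimum of the bad parameters on the segment from 0 to
  \<open>q\<close>; it is positive because of the equality near 0. The expansions of both functions
  at \<open>s\<close> agree for parameters below \<open>s\<close>, hence coincide, hence agree also
  slightly beyond \<open>s\<close>. But a bad parameter occurs in \<open>[s, s + m)\<close>.\<close>

lemma loc_an_eq_on_ball:
  fixes f g :: "real \<times> real \<Rightarrow> real"
  assumes an: "\<And>p. norm p < R \<Longrightarrow> loc_an f p" "\<And>p. norm p < R \<Longrightarrow> loc_an g p"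
    and \<delta>: "\<delta> > 0" and eq: "\<And>p. norm p < \<delta> \<Longrightarrow> f p = g p" and q: "norm q < R"
  shows "f q = g q"
proof (rule ccontr)
  assume ne: "f q \<noteq> g q"
  define B where "B = {t. 0 \<le> t \<and> t \<le> 1 \<and> f (t *\<^sub>R q) \<noteq> g (t *\<^sub>R q)}"
  define s where "s = Inf B"
  have B: "1 \<in> B" "bdd_below B" using ne by (auto simp: B_def)
  have s1: "s \<le> 1" unfolding s_def using B by (intro cInf_lower)
  define e where "e = min 1 (\<delta> / (1 + norm q))"
  have e: "e > 0" using \<delta> by (auto simp: e_def add_pos_nonneg)
  have "e \<le> b" if "b \<in> B" for b
  proof (rule ccontr)
    assume "\<not> e \<le> b"
    then have b: "0 \<le> b" "b < \<delta> / (1 + norm q)" using that by (auto simp: B_def e_def)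
    have "norm (b *\<^sub>R q) \<le> b * (1 + norm q)" using b by (simp add: mult_left_mono)
    also have "\<dots> < \<delta>" using b(2) by (simp add: pos_less_divide_eq add_pos_nonneg)
    finally show False using that eq by (auto simp: B_def)
  qed
  then have "e \<le> s" unfolding s_def using B by (intro cInf_greatest) auto
  have sq: "norm (s *\<^sub>R q) < R"
    using q s1 \<open>e \<le> s\<close> e by (auto intro: le_less_trans[of _ "norm q"] simp: mult_left_le_one_le)
  obtain c W where c: "c > 0" and W: "\<And>\<tau>. \<bar>\<tau>\<bar> \<le> 1 \<Longrightarrow> f ((s - c * \<tau>) *\<^sub>R q) = ev \<tau> W"
    using loc_an_ray[OF an(1)[OF sq]] by blast
  obtain c' W' where c': "c' > 0" and W': "\<And>\<tau>. \<bar>\<tau>\<bar> \<le> 1 \<Longrightarrow> g ((s - c' * \<tau>) *\<^sub>R q) = ev \<tau> W'"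
    using loc_an_ray[OF an(2)[OF sq]] by blast
  define m where "m = min c c'"
  have m: "m > 0" "0 \<le> m / c" "m / c \<le> 1" "0 \<le> m / c'" "m / c' \<le> 1" using c c' by (auto simp: m_def)
  \<comment> \<open>The two expansions have different scales \<open>c\<close> and \<open>c'\<close>;
    evaluating each at a multiple of \<open>var\<close> brings both to the common scale
    \<open>m\<close> before they are subtracted.\<close>
  define V where "V = ev ((m / c) *\<^sub>R var) (mapA const W) - ev ((m / c') *\<^sub>R var) (mapA const W')"
  have V: "ev \<tau> V = f ((s - m * \<tau>) *\<^sub>R q) - g ((s - m * \<tau>) *\<^sub>R q)" if \<tau>: "\<bar>\<tau>\<bar> \<le> 1" for \<tau>
  proof -
    have E: "chom (ev \<tau>)" using \<tau> by (simp add: chom_ev)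
    have "ev \<tau> (ev (a *\<^sub>R var) (mapA const U)) = ev (a * \<tau>) U" if "0 \<le> a" "a \<le> 1" for a U
      using that by (simp add: chom_ev_commute[OF E] norm_var mapA_mapA chom_clin[OF E] clin_const ev_const mapA_id
          chom_scaleR[OF E] ev_var)
    then have "ev \<tau> V = ev (m / c * \<tau>) W - ev (m / c' * \<tau>) W'"
      unfolding V_def using m by (simp add: chom_diff[OF E])
    moreover have "\<bar>m / c * \<tau>\<bar> \<le> 1" "\<bar>m / c' * \<tau>\<bar> \<le> 1"
      unfolding abs_mult using m \<tau> by (intro mult_le_one; simp)+
    ultimately show ?thesis
      using W[of "m / c * \<tau>"] W'[of "m / c' * \<tau>"] c c' by (simp add: field_simps)
  qed
  have "V = 0"
  proof (rule aps_eq_0I)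
    show "min 1 (s / m) > 0" using m \<open>e \<le> s\<close> e by simp
    fix \<tau> assume \<tau>: "0 < \<tau>" "\<tau> < min 1 (s / m)"
    have t: "0 \<le> s - m * \<tau>" "s - m * \<tau> < s" using \<tau> m by (auto simp: field_simps)
    then have "s - m * \<tau> \<notin> B" using cInf_lower[OF _ B(2)] unfolding s_def by (metis not_le)
    then show "ev \<tau> V = 0" using V[of \<tau>] \<tau> t s1 by (auto simp: B_def)
  qed
  have "\<exists>b\<in>B. b < s + m" unfolding s_def using B m by (intro cInf_lessD) auto
  then obtain b where b: "b \<in> B" "b < s + m" by blast
  have "s \<le> b" unfolding s_def using b B by (intro cInf_lower)
  define \<tau> where "\<tau> = (s - b) / m"
  have "\<bar>\<tau>\<bar> \<le> 1" "s - m * \<tau> = b" using b \<open>s \<le> b\<close> m by (auto simp: \<tau>_def field_simps)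
  then have "f (b *\<^sub>R q) = g (b *\<^sub>R q)" using V[of \<tau>] \<open>V = 0\<close> by (simp add: clin_zero[OF clin_ev])
  then show False using b by (simp add: B_def)
qed

text \<open>Shrinking the square is a substitution. Every smaller \<open>r\<close> is provided so
  that the six components of two solutions can be expanded on one common square.\<close>

lemma loc_an_shrink:
  assumes "loc_an f 0"
  obtains r0 where "r0 > 0"
    "\<And>r. 0 < r \<Longrightarrow> r \<le> r0 \<Longrightarrow> \<exists>F. rep f r F"
proof -
  obtain r0 F where r0: "r0 > 0" and F: "\<And>s t. \<bar>s\<bar> \<le> 1 \<Longrightarrow> \<bar>t\<bar> \<le> 1 \<Longrightarrow> f (r0 * s, r0 * t) = Ev F s t"
    using assms by (auto simp: loc_an_def)
  show thesis
  proof (rule that[OF r0])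
    fix r assume r: "0 < r" "r \<le> r0"
    define c where "c = r / r0"
    have c: "0 \<le> c" "c \<le> 1" using r by (auto simp: c_def)
    have "f (r * s, r * t) = Ev (subst2 (c *\<^sub>R const var) (c *\<^sub>R var) F) s t" if st: "\<bar>s\<bar> \<le> 1" "\<bar>t\<bar> \<le> 1" for s t
    proof -
      have st': "norm s \<le> 1" "norm t \<le> 1" using st by auto
      have "\<bar>c * s\<bar> \<le> 1" "\<bar>c * t\<bar> \<le> 1"
        unfolding abs_mult using c st by (intro mult_le_one; simp)+
      from F[OF this] have "f (r * s, r * t) = Ev F (c * s) (c * t)" using r by (simp add: c_def)
      also have "\<dots> = Ev (subst2 (c *\<^sub>R const var) (c *\<^sub>R var) F) s t"
        using c st' by (simp add: Ev_subst2 norm_const norm_var chom_scaleR[OF chom_Ev] Ev_var_inner Ev_var_outer)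
      finally show ?thesis .
    qed
    then show "\<exists>F. rep f r F" by blast
  qed
qed

text \<open>Each use of \<open>der\<close> halves the admissible radius, hence 1 / 4 for second
  derivatives. The factor 2 in the last formula is the one left out of \<open>E_lap\<close>.\<close>

lemma rep_derivatives:
  assumes r: "r > 0" and F: "\<And>s t. \<bar>s\<bar> \<le> 1 \<Longrightarrow> \<bar>t\<bar> \<le> 1 \<Longrightarrow> f (r * s, r * t) = Ev F s t"
    and st: "\<bar>\<sigma>\<bar> < 1/4" "\<bar>t\<bar> < 1/4"
  shows "pu f (r * \<sigma>, r * t) = E_s F \<sigma> t / r"
    and "pv f (r * \<sigma>, r * t) = E_t F \<sigma> t / r"
    and "lap f (r * \<sigma>, r * t) = 2 * (E_lap F \<sigma> t) / r\<^sup>2"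
proof -
  have chain: "((\<lambda>s. h (k * s / r)) has_real_derivative d * (k / r)) (at (r * \<sigma>))"
    if "(h has_real_derivative d) (at (k * \<sigma>))" for h d k \<sigma>
  proof -
    have 1: "((\<lambda>s. k * s / r) has_real_derivative k / r) (at (r * \<sigma>))"
      using r by (auto intro!: derivative_eq_intros)
    have "(h has_real_derivative d) (at (k * (r * \<sigma>) / r))" using that r by simp
    from DERIV_chain2[OF this 1] show ?thesis .
  qed
  have op: "open {x::real. \<bar>x\<bar> < k}" for k by (intro open_Collect_less continuous_intros)
  have mem: "r * \<sigma> \<in> {x. \<bar>x\<bar> < r * k}" if "\<bar>\<sigma>\<bar> < k" for \<sigma> k
    using that r by (simp add: abs_mult)
  have sc: "\<bar>s / r\<bar> < k" if "s \<in> {x. \<bar>x\<bar> < r * k}" for s k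
    using that r by (simp add: field_simps)
  have pu1: "pu f (r * \<sigma>, r * t) = E_s F \<sigma> t / r" if "\<bar>\<sigma>\<bar> < 1/2" "\<bar>t\<bar> \<le> 1" for \<sigma> t
  proof (rule pu_eqI, unfold fst_conv snd_conv, rule has_field_derivative_transform_within_open)
    show "((\<lambda>s. Ev F (1 * s / r) t) has_real_derivative E_s F \<sigma> t / r) (at (r * \<sigma>))"
      using chain[of "\<lambda>s. Ev F s t" _ 1 \<sigma>] Ev_der_inner[of \<sigma> t F] that by simp
    show "Ev F (1 * s / r) t = f (s, r * t)" if "s \<in> {x. \<bar>x\<bar> < r * 1}" for s
      using F[of "s / r" t] sc[OF that] \<open>\<bar>t\<bar> \<le> 1\<close> r by simp
  qed (rule op, rule mem, use that in simp)
  have pv1: "pv f (r * \<sigma>, r * t) = E_t F \<sigma> t / r" if "\<bar>\<sigma>\<bar> \<le> 1" "\<bar>t\<bar> < 1/2" for \<sigma> t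
  proof (rule pv_eqI, unfold fst_conv snd_conv, rule has_field_derivative_transform_within_open)
    show "((\<lambda>s. Ev F \<sigma> (1 * s / r)) has_real_derivative E_t F \<sigma> t / r) (at (r * t))"
      using chain[of "\<lambda>s. Ev F \<sigma> s" _ 1 t] Ev_der_outer[of \<sigma> t F] that by simp
    show "Ev F \<sigma> (1 * s / r) = f (r * \<sigma>, s)" if "s \<in> {x. \<bar>x\<bar> < r * 1}" for s
      using F[of \<sigma> "s / r"] sc[OF that] \<open>\<bar>\<sigma>\<bar> \<le> 1\<close> r by simp
  qed (rule op, rule mem, use that in simp)
  show "pu f (r * \<sigma>, r * t) = E_s F \<sigma> t / r" using st by (intro pu1) auto
  show "pv f (r * \<sigma>, r * t) = E_t F \<sigma> t / r" using st by (intro pv1) auto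
  have "pu (pu f) (r * \<sigma>, r * t) = Ev (mapA der (mapA der F)) (4 * \<sigma>) t * (2 / r) / r"
  proof (rule pu_eqI, unfold fst_conv snd_conv, rule has_field_derivative_transform_within_open)
    show "((\<lambda>s. Ev (mapA der F) (2 * s / r) t / r) has_real_derivative
       Ev (mapA der (mapA der F)) (4 * \<sigma>) t * (2 / r) / r) (at (r * \<sigma>))"
      using chain[of "\<lambda>s. Ev (mapA der F) s t" _ 2 \<sigma>] Ev_der_inner[of "2 * \<sigma>" t "mapA der F"] st
      by (intro DERIV_cdivide) simp
    show "Ev (mapA der F) (2 * s / r) t / r = pu f (s, r * t)" if "s \<in> {x. \<bar>x\<bar> < r * (1/2)}" for s
      using pu1[of "s / r" t] sc[OF that] st r by simp
  qed (rule op, rule mem, use st in simp)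
  moreover have "pv (pv f) (r * \<sigma>, r * t) = Ev (der (der F)) \<sigma> (4 * t) * (2 / r) / r"
  proof (rule pv_eqI, unfold fst_conv snd_conv, rule has_field_derivative_transform_within_open)
    show "((\<lambda>s. Ev (der F) \<sigma> (2 * s / r) / r) has_real_derivative
       Ev (der (der F)) \<sigma> (4 * t) * (2 / r) / r) (at (r * t))"
      using chain[of "\<lambda>s. Ev (der F) \<sigma> s" _ 2 t] Ev_der_outer[of \<sigma> "2 * t" "der F"] st
      by (intro DERIV_cdivide) simp
    show "Ev (der F) \<sigma> (2 * s / r) / r = pv f (r * \<sigma>, s)" if "s \<in> {x. \<bar>x\<bar> < r * (1/2)}" for s
      using pv1[of \<sigma> "s / r"] sc[OF that] st r by simp
  qed (rule op, rule mem, use st in simp)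
  ultimately show "lap f (r * \<sigma>, r * t) = 2 * (E_lap F \<sigma> t) / r\<^sup>2"
    using r by (simp add: lap_def field_simps power2_eq_square)
qed

text \<open>The quadratic terms of the system; the components \<open>x\<close>, \<open>y\<close>, \<open>z\<close> carry the indices 1, 2, 3.\<close>
definition quad :: "nat \<Rightarrow> (nat \<Rightarrow> real) \<Rightarrow> (nat \<Rightarrow> real) \<Rightarrow> real" where
  "quad i a b = (if i = 3 then (- (a 1 * a 1 + b 1 * b 1) - (a 2 * a 2 + b 2 * b 2) + (a 3 * a 3 + b 3 * b 3)) / 2
     else a i * a 3 + b i * b 3)"

text \<open>Index 3 decides the constants: half a sum of six products, each bounded by
  \<open>N * N\<close> and changing by at most \<open>2 * (N * e)\<close>.\<close>

lemma quad_diff: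
  assumes N: "\<And>j. j \<in> {1,2,3} \<Longrightarrow> \<bar>a j\<bar> \<le> N" "\<And>j. j \<in> {1,2,3} \<Longrightarrow> \<bar>b j\<bar> \<le> N"
     "\<And>j. j \<in> {1,2,3} \<Longrightarrow> \<bar>a' j\<bar> \<le> N" "\<And>j. j \<in> {1,2,3} \<Longrightarrow> \<bar>b' j\<bar> \<le> N"
    and d: "\<And>j. j \<in> {1,2,3} \<Longrightarrow> \<bar>a' j - a j\<bar> \<le> e" "\<And>j. j \<in> {1,2,3} \<Longrightarrow> \<bar>b' j - b j\<bar> \<le> e"
    and i: "i \<in> {1,2,3}"
  shows "\<bar>quad i a b\<bar> \<le> 3 * (N * N)" and "\<bar>quad i a' b' - quad i a b\<bar> \<le> 6 * (N * e)"
proof -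
  have "\<bar>a 1\<bar> \<le> N" "\<bar>a' 1 - a 1\<bar> \<le> e" using N d by auto
  then have N0: "N \<ge> 0" "e \<ge> 0" by linarith+
  have p: "\<bar>a j * a k\<bar> \<le> N * N" "\<bar>b j * b k\<bar> \<le> N * N" if "j \<in> {1,2,3}" "k \<in> {1,2,3}" for j k
    unfolding abs_mult by (intro mult_mono N that abs_ge_zero N0)+
  have bl: "\<bar>x * y - x' * y'\<bar> \<le> 2 * (N * e)"
    if "\<bar>y\<bar> \<le> N" "\<bar>x'\<bar> \<le> N" "\<bar>x - x'\<bar> \<le> e" "\<bar>y - y'\<bar> \<le> e" for x y x' y' :: real
    using mult_diff_bound[of y N x' N x e y' e] that by (simp add: mult.commute)
  have dp: "\<bar>a' j * a' k - a j * a k\<bar> \<le> 2 * (N * e)" "\<bar>b' j * b' k - b j * b k\<bar> \<le> 2 * (N * e)"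
    if "j \<in> {1,2,3}" "k \<in> {1,2,3}" for j k
    by (intro bl N d that)+
  have nn: "0 \<le> N * N" "0 \<le> N * e" using N0 by auto
  have m: "1 \<in> {1,2,3::nat}" "2 \<in> {1,2,3::nat}" "3 \<in> {1,2,3::nat}" by auto
  have q3: "2 * quad 3 a b = - (a 1 * a 1 + b 1 * b 1) - (a 2 * a 2 + b 2 * b 2) + (a 3 * a 3 + b 3 * b 3)" for a b
    by (simp add: quad_def)
  have qi: "i \<noteq> 3 \<Longrightarrow> quad i a b = a i * a 3 + b i * b 3" for a b
    by (simp add: quad_def)
  show "\<bar>quad i a b\<bar> \<le> 3 * (N * N)"
  proof (cases "i = 3")
    case True
    have "\<bar>a j * a j + b j * b j\<bar> \<le> 2 * (N * N)" if "j \<in> {1,2,3}" for j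
      using p[OF that that] by linarith
    from this[OF m(1)] this[OF m(2)] this[OF m(3)] q3[of a b] show ?thesis unfolding True by linarith
  next
    case False
    show ?thesis unfolding qi[OF False] using p[OF i m(3)] nn by linarith
  qed
  show "\<bar>quad i a' b' - quad i a b\<bar> \<le> 6 * (N * e)"
  proof (cases "i = 3")
    case True
    have "\<bar>(a' j * a' j + b' j * b' j) - (a j * a j + b j * b j)\<bar> \<le> 4 * (N * e)" if "j \<in> {1,2,3}" for j
      using dp[OF that that] by linarith
    from this[OF m(1)] this[OF m(2)] this[OF m(3)] q3[of a b] q3[of a' b'] show ?thesis unfolding True by linarith
  next
    case False
    show ?thesis unfolding qi[OF False] using dp[OF i m(3)] nn by linarith
  qed
qed

lemma local_uniqueness:
  fixes u u' :: "nat \<Rightarrow> real \<times> real \<Rightarrow> real"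
  assumes an: "\<And>i. i \<in> {1,2,3} \<Longrightarrow> loc_an (u i) 0" "\<And>i. i \<in> {1,2,3} \<Longrightarrow> loc_an (u' i) 0"
    and \<delta>: "\<delta> > 0" and r0: "r0 > 0" and D: "summable (\<lambda>n. real n * norm (coef D n))"
    and f: "\<And>c. \<bar>c - u 3 0\<bar> \<le> r0 \<Longrightarrow> f c = ev ((c - u 3 0) / r0) D"
    and pde: "\<And>i q. i \<in> {1,2,3} \<Longrightarrow> norm q < \<delta> \<Longrightarrow> lap (u i) q = - f (u 3 q) * quad i (\<lambda>j. pu (u j) q) (\<lambda>j. pv (u j) q)"
    and pde': "\<And>i q. i \<in> {1,2,3} \<Longrightarrow> norm q < \<delta> \<Longrightarrow> lap (u' i) q = - f (u' 3 q) * quad i (\<lambda>j. pu (u' j) q) (\<lambda>j. pv (u' j) q)"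
    and init: "\<And>i s. i \<in> {1,2,3} \<Longrightarrow> \<bar>s\<bar> < \<delta> \<Longrightarrow> u i (s, 0) = u' i (s, 0)"
      "\<And>i s. i \<in> {1,2,3} \<Longrightarrow> \<bar>s\<bar> < \<delta> \<Longrightarrow> pv (u i) (s, 0) = pv (u' i) (s, 0)"
  shows "\<exists>\<delta>'>0. \<forall>q. norm q < \<delta>' \<longrightarrow> (\<forall>i\<in>{1,2,3}. u i q = u' i q)"
proof -
  define J where "J = {1, 2, 3 :: nat}"
  have "\<exists>\<rho>>0. \<forall>i\<in>J. \<forall>r. 0 < r \<longrightarrow> r \<le> \<rho> \<longrightarrow>
      (\<exists>F. rep (u i) r F) \<and>
      (\<exists>F. rep (u' i) r F)"
  proof -
    have "\<exists>\<rho>>0. \<forall>r. 0 < r \<longrightarrow> r \<le> \<rho> \<longrightarrow>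
      (\<exists>F. rep (u i) r F) \<and>
      (\<exists>F. rep (u' i) r F)" if "i \<in> J" for i
    proof -
      have i: "i \<in> {1,2,3}" using that by (simp add: J_def)
      obtain r1 where r1: "r1 > 0" "\<And>r. 0 < r \<Longrightarrow> r \<le> r1 \<Longrightarrow> \<exists>F. rep (u i) r F"
        using loc_an_shrink[OF an(1)[OF i]] by metis
      obtain r2 where r2: "r2 > 0" "\<And>r. 0 < r \<Longrightarrow> r \<le> r2 \<Longrightarrow> \<exists>F. rep (u' i) r F"
        using loc_an_shrink[OF an(2)[OF i]] by metis
      show ?thesis
        by (rule exI[of _ "min r1 r2"]) (use r1 r2 in simp)
    qed
    then obtain \<rho> where \<rho>: "\<And>i. i \<in> J \<Longrightarrow> \<rho> i > 0" "\<And>i r. i \<in> J \<Longrightarrow> 0 < r \<Longrightarrow> r \<le> \<rho> i \<Longrightarrow>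
      (\<exists>F. rep (u i) r F) \<and>
      (\<exists>F. rep (u' i) r F)" by metis
    show ?thesis
    proof (intro exI[of _ "Min (\<rho> ` J)"] conjI ballI allI impI)
      show "Min (\<rho> ` J) > 0" using \<rho>(1) by (auto simp: J_def)
      fix i r assume "i \<in> J" "0 < r" "r \<le> Min (\<rho> ` J)"
      then have "r \<le> \<rho> i" by (auto simp: J_def)
      with \<rho>(2)[OF \<open>i \<in> J\<close> \<open>0 < r\<close>]
      show "\<exists>F. rep (u i) r F"
        "\<exists>F. rep (u' i) r F" by auto
    qed
  qed
  then obtain \<rho> where \<rho>: "\<rho> > 0" "\<And>i r. i \<in> J \<Longrightarrow> 0 < r \<Longrightarrow> r \<le> \<rho> \<Longrightarrow>
      (\<exists>F. rep (u i) r F) \<and>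
      (\<exists>F. rep (u' i) r F)" by blast
  define r where "r = min \<rho> \<delta>"
  have r: "r > 0" "r \<le> \<rho>" "r \<le> \<delta>" using \<rho> \<delta> by (auto simp: r_def)
  obtain F where F: "\<And>i s t. i \<in> J \<Longrightarrow> \<bar>s\<bar> \<le> 1 \<Longrightarrow> \<bar>t\<bar> \<le> 1 \<Longrightarrow> u i (r * s, r * t) = Ev (F i) s t"
    using \<rho>(2)[OF _ r(1,2)] by metis
  obtain F' where F': "\<And>i s t. i \<in> J \<Longrightarrow> \<bar>s\<bar> \<le> 1 \<Longrightarrow> \<bar>t\<bar> \<le> 1 \<Longrightarrow> u' i (r * s, r * t) = Ev (F' i) s t"
    using \<rho>(2)[OF _ r(1,2)] by metis
  define E where "E = (\<lambda>i. F' i - F i)"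
  have J3: "3 \<in> J" by (simp add: J_def)
  have base: "Ev (F 3) 0 0 = u 3 0" "Ev (F' 3) 0 0 = u 3 0"
    using F[OF J3, of 0 0] F'[OF J3, of 0 0] init(1)[of 3 0] \<delta> by (simp_all add: zero_prod_def)
  \<comment> \<open>Keeps both heights within \<open>r0\<close> of the base height, where
    \<open>f\<close> is given by its series.\<close>
  have cont: "\<exists>\<theta>>0. \<forall>\<sigma> t. \<bar>\<sigma>\<bar> < \<theta> \<longrightarrow> \<bar>t\<bar> < \<theta> \<longrightarrow> \<bar>Ev H \<sigma> t - Ev H 0 0\<bar> \<le> r0" for H :: "real aps aps"
  proof -
    have "continuous (at (0, 0) within cball 0 1 \<times> cball 0 1) (\<lambda>(s, t). Ev H s t)"
      using continuous_on_Ev[of H] by (simp add: continuous_on_eq_continuous_within)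
    then obtain d where d: "d > 0" "\<And>x. x \<in> cball 0 1 \<times> cball 0 1 \<Longrightarrow> dist x (0, 0) < d \<Longrightarrow>
        dist ((\<lambda>(s, t). Ev H s t) x) (Ev H 0 0) < r0"
      unfolding continuous_within_eps_delta using r0 by fastforce
    have "\<bar>Ev H \<sigma> t - Ev H 0 0\<bar> \<le> r0" if "\<bar>\<sigma>\<bar> < min 1 (d / 2)" "\<bar>t\<bar> < min 1 (d / 2)" for \<sigma> t
    proof -
      have "norm (\<sigma>, t) \<le> \<bar>\<sigma>\<bar> + \<bar>t\<bar>" using norm_Pair_le[of \<sigma> t] by simp
      then have "dist (\<sigma>, t) (0, 0) < d" using that by (simp add: dist_norm)
      then show ?thesis using d(2)[of "(\<sigma>, t)"] that by (simp add: dist_real_def)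
    qed
    then show ?thesis using d(1) by (intro exI[of _ "min 1 (d / 2)"]) auto
  qed
  obtain \<theta>1 where \<theta>1: "\<theta>1 > 0" "\<And>\<sigma> t. \<bar>\<sigma>\<bar> < \<theta>1 \<Longrightarrow> \<bar>t\<bar> < \<theta>1 \<Longrightarrow> \<bar>Ev (F 3) \<sigma> t - u 3 0\<bar> \<le> r0"
    using cont[of "F 3"] unfolding base by blast
  obtain \<theta>2 where \<theta>2: "\<theta>2 > 0" "\<And>\<sigma> t. \<bar>\<sigma>\<bar> < \<theta>2 \<Longrightarrow> \<bar>t\<bar> < \<theta>2 \<Longrightarrow> \<bar>Ev (F' 3) \<sigma> t - u 3 0\<bar> \<le> r0"
    using cont[of "F' 3"] unfolding base by blast
  define \<theta> where "\<theta> = min (1/4) (min \<theta>1 \<theta>2)"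
  have \<theta>: "\<theta> > 0" "\<theta> \<le> 1/4" "\<theta> \<le> \<theta>1" "\<theta> \<le> \<theta>2" using \<theta>1 \<theta>2 by (auto simp: \<theta>_def)
  define N where "N = (\<Sum>j\<in>J. norm (F j) + norm (F' j))"
  define L where "L = (\<Sum>n. real n * norm (coef D n))"
  have L: "L \<ge> 0" unfolding L_def using D by (intro suminf_nonneg) auto
  have N0: "N \<ge> 0" unfolding N_def by (intro sum_nonneg) auto
  have FN: "norm (F j) \<le> N" "norm (F' j) \<le> N" if "j \<in> J" for j
  proof -
    have "norm (F j) + norm (F' j) \<le> N"
      unfolding N_def using that by (intro member_le_sum) (auto simp: J_def)
    then show "norm (F j) \<le> N" "norm (F' j) \<le> N"
      using norm_ge_zero[of "F j"] norm_ge_zero[of "F' j"] by linarith+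
  qed
  have "E i = 0" if "i \<in> J" for i
  \<comment> \<open>The constant comes from the product rule for differences: \<open>L / r0\<close>
    is a Lipschitz constant of \<open>f\<close> and \<open>3 * (N * N)\<close> a bound of the
    quadratic terms, while \<open>norm D\<close> bounds \<open>f\<close> and \<open>6 * N\<close> is
    a Lipschitz constant of the quadratic terms. The division by 2 reflects that
    \<open>E_lap\<close> is half a Laplacian; the powers of \<open>r\<close> cancel because both
    sides scale like second derivatives.\<close>
  proof (rule unique_continuation[of J \<theta> E "(L / r0 * (3 * (N * N)) + norm D * (6 * N)) / 2"])
    show "finite J" "i \<in> J" using that by (simp_all add: J_def)
    show "0 \<le> (L / r0 * (3 * (N * N)) + norm D * (6 * N)) / 2" using L N0 r0 by simp
  next
    fix j assume j: "j \<in> J"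
    then have j': "j \<in> {1,2,3}" by (simp add: J_def)
    have in_ball: "\<bar>r * \<sigma>\<bar> < \<delta>" if "\<bar>\<sigma>\<bar> < 1" for \<sigma>
    proof -
      have "\<bar>r * \<sigma>\<bar> = r * \<bar>\<sigma>\<bar>" using r by (simp add: abs_mult)
      also have "\<dots> < r * 1" using r that by (intro mult_strict_left_mono) auto
      finally show ?thesis using r by simp
    qed
    show "coef (E j) 0 = 0"
    proof (rule aps_eq_0I[of 1])
      fix \<sigma> :: real assume \<sigma>: "0 < \<sigma>" "\<sigma> < 1"
      have "Ev (E j) \<sigma> 0 = 0"
        using F[OF j, of \<sigma> 0] F'[OF j, of \<sigma> 0] init(1)[OF j' in_ball] \<sigma> by (simp add: E_def chom_diff[OF chom_Ev])
      then show "ev \<sigma> (coef (E j) 0) = 0"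
        using \<sigma> by (simp add: Ev_def ev_0 coef_mapA clin_ev)
    qed simp
    show "coef (E j) 1 = 0"
    proof (rule aps_eq_0I[of "1/4"])
      fix \<sigma> :: real assume \<sigma>: "0 < \<sigma>" "\<sigma> < 1/4"
      have "pv (u j) (r * \<sigma>, r * 0) = pv (u' j) (r * \<sigma>, r * 0)"
        using init(2)[OF j' in_ball] \<sigma> by simp
      then have "Ev (der (F j)) \<sigma> 0 = Ev (der (F' j)) \<sigma> 0"
        using rep_derivatives(2)[OF r(1) F[OF j], of \<sigma> 0] rep_derivatives(2)[OF r(1) F'[OF j], of \<sigma> 0] \<sigma> r by simp
      then have "Ev (der (E j)) \<sigma> 0 = 0"
        using \<sigma> by (simp add: E_def clin_diff[OF clin_der] chom_diff[OF chom_Ev])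
      then show "ev \<sigma> (coef (E j) 1) = 0"
        using \<sigma> by (simp add: Ev_def ev_0 coef_mapA clin_ev coef_der)
    qed simp
    fix \<sigma> t assume st: "\<bar>\<sigma>\<bar> < \<theta>" "\<bar>t\<bar> < \<theta>"
    then have st4: "\<bar>\<sigma>\<bar> < 1/4" "\<bar>t\<bar> < 1/4" using \<theta> by auto
    then have nst: "norm \<sigma> \<le> 1" "norm t \<le> 1" "norm (2 * \<sigma>) \<le> 1" "norm (2 * t) \<le> 1" "norm (4 * \<sigma>) \<le> 1" "norm (4 * t) \<le> 1"
      by auto
    define q where "q = (r * \<sigma>, r * t)"
    have "norm q \<le> \<bar>r * \<sigma>\<bar> + \<bar>r * t\<bar>" unfolding q_def using norm_Pair_le[of "r * \<sigma>" "r * t"] by simp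
    also have "\<dots> = r * (\<bar>\<sigma>\<bar> + \<bar>t\<bar>)" using r by (simp add: abs_mult distrib_left)
    also have "\<dots> < r * 1" using r st4 by (intro mult_strict_left_mono) auto
    finally have q: "norm q < \<delta>" using r by simp
    define e where "e = (\<Sum>j\<in>J. \<bar>Ev (E j) \<sigma> t\<bar> + \<bar>E_s (E j) \<sigma> t\<bar> + \<bar>E_t (E j) \<sigma> t\<bar>)"
    have e: "\<bar>Ev (E j) \<sigma> t\<bar> \<le> e" "\<bar>E_s (E j) \<sigma> t\<bar> \<le> e" "\<bar>E_t (E j) \<sigma> t\<bar> \<le> e" if "j \<in> J" for j
    proof -
      have "\<bar>Ev (E j) \<sigma> t\<bar> + \<bar>E_s (E j) \<sigma> t\<bar> + \<bar>E_t (E j) \<sigma> t\<bar> \<le> e"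
        unfolding e_def using that by (intro member_le_sum) (auto simp: J_def)
      then show "\<bar>Ev (E j) \<sigma> t\<bar> \<le> e" "\<bar>E_s (E j) \<sigma> t\<bar> \<le> e" "\<bar>E_t (E j) \<sigma> t\<bar> \<le> e"
        by linarith+
    qed
    define a b where "a = (\<lambda>j. E_s (F j) \<sigma> t)" and "b = (\<lambda>j. E_t (F j) \<sigma> t)"
    define a' b' where "a' = (\<lambda>j. E_s (F' j) \<sigma> t)" and "b' = (\<lambda>j. E_t (F' j) \<sigma> t)"
    have bnd: "\<bar>E_s H \<sigma> t\<bar> \<le> N" "\<bar>E_t H \<sigma> t\<bar> \<le> N" if "norm H \<le> N" for H
    proof -
      have "norm (mapA der H) \<le> N" "norm (der H) \<le> N"
        using that clin_norm[OF clin_mapA[OF clin_der], of H] clin_norm[OF clin_der, of H] by linarith+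
      then show "\<bar>E_s H \<sigma> t\<bar> \<le> N" "\<bar>E_t H \<sigma> t\<bar> \<le> N"
        using chom_norm[OF chom_Ev, OF nst(3,2), of "mapA der H"] chom_norm[OF chom_Ev, OF nst(1,4), of "der H"] by simp_all
    qed
    have pu: "pu (u j) q = a j / r" "pv (u j) q = b j / r" "pu (u' j) q = a' j / r" "pv (u' j) q = b' j / r" if "j \<in> J" for j
      unfolding q_def a_def b_def a'_def b'_def
      using rep_derivatives[OF r(1) F[OF that] st4] rep_derivatives[OF r(1) F'[OF that] st4] by simp_all
    have qs: "quad i (\<lambda>j. pu (u j) q) (\<lambda>j. pv (u j) q) = quad i a b / r\<^sup>2"
      "quad i (\<lambda>j. pu (u' j) q) (\<lambda>j. pv (u' j) q) = quad i a' b' / r\<^sup>2" if "i \<in> J" for i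
      using that r by (auto simp: quad_def pu J_def field_simps power2_eq_square)
    have z: "u 3 q = Ev (F 3) \<sigma> t" "u' 3 q = Ev (F' 3) \<sigma> t"
      unfolding q_def using F[OF J3] F'[OF J3] nst by auto
    define k where "k = f (u 3 q)"
    define k' where "k' = f (u' 3 q)"
    have k: "k = ev ((u 3 q - u 3 0) / r0) D" "k' = ev ((u' 3 q - u 3 0) / r0) D"
      unfolding k_def k'_def z using st \<theta> by (intro f \<theta>1(2) \<theta>2(2); simp)+
    have zn: "norm ((u 3 q - u 3 0) / r0) \<le> 1" "norm ((u' 3 q - u 3 0) / r0) \<le> 1"
      using \<theta>1(2)[of \<sigma> t] \<theta>2(2)[of \<sigma> t] st \<theta> r0 by (auto simp: z)
    have kM: "\<bar>k'\<bar> \<le> norm D" "\<bar>k\<bar> \<le> norm D"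
      unfolding k using clin_norm[OF clin_ev[OF zn(1)], of D] clin_norm[OF clin_ev[OF zn(2)], of D] by simp_all
    have "\<bar>k' - k\<bar> \<le> L * norm ((u' 3 q - u 3 0) / r0 - (u 3 q - u 3 0) / r0)"
      unfolding k L_def using ev_lipschitz[OF D zn(2) zn(1)] by simp
    also have "norm ((u' 3 q - u 3 0) / r0 - (u 3 q - u 3 0) / r0) = \<bar>Ev (E 3) \<sigma> t\<bar> / r0"
      using r0 nst by (simp add: z E_def chom_diff[OF chom_Ev] flip: diff_divide_distrib)
    also have "L * (\<bar>Ev (E 3) \<sigma> t\<bar> / r0) \<le> L * (e / r0)"
      using L r0 e(1)[OF J3] by (intro mult_left_mono divide_right_mono) auto
    finally have dk: "\<bar>k' - k\<bar> \<le> L / r0 * e" by simp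
    have Ed: "a' j - a j = E_s (E j) \<sigma> t" "b' j - b j = E_t (E j) \<sigma> t" for j
      using nst by (simp_all add: a_def a'_def b_def b'_def E_def clin_diff clin_mapA clin_der chom_diff[OF chom_Ev])
    have N1: "\<bar>a i\<bar> \<le> N" "\<bar>b i\<bar> \<le> N" "\<bar>a' i\<bar> \<le> N" "\<bar>b' i\<bar> \<le> N" if "i \<in> {1,2,3}" for i
      unfolding a_def b_def a'_def b'_def using that by (intro bnd FN; simp add: J_def)+
    have N2: "\<bar>a' i - a i\<bar> \<le> e" "\<bar>b' i - b i\<bar> \<le> e" if "i \<in> {1,2,3}" for i
      unfolding Ed using that by (intro e; simp add: J_def)+
    have N2': "\<bar>a i - a' i\<bar> \<le> e" "\<bar>b i - b' i\<bar> \<le> e" if "i \<in> {1,2,3}" for i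
      using N2[OF that] by (simp_all only: abs_minus_commute)
    have qb: "\<bar>quad j a' b'\<bar> \<le> 3 * (N * N)" "\<bar>quad j a' b' - quad j a b\<bar> \<le> 6 * (N * e)"
      using quad_diff(1)[OF N1(3,4) N1(1,2) N2' j'] quad_diff(2)[OF N1 N2 j'] by simp_all
    have kq: "\<bar>k' * quad j a' b' - k * quad j a b\<bar> \<le> (L / r0 * e) * (3 * (N * N)) + norm D * (6 * (N * e))"
      using mult_diff_bound[of "quad j a' b'" "3 * (N * N)" k "norm D" k' "L / r0 * e" "quad j a b" "6 * (N * e)"] qb kM dk by simp
    define l where "l = E_lap (F j) \<sigma> t"
    define l' where "l' = E_lap (F' j) \<sigma> t"
    have "2 * l / r\<^sup>2 = - k * (quad j a b / r\<^sup>2)"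
      using pde[OF j' q] rep_derivatives(3)[OF r(1) F[OF j] st4] by (simp add: qs[OF j] k_def q_def[symmetric] l_def)
    then have "2 * l = - (k * quad j a b)" using r(1) by (simp add: divide_eq_eq)
    moreover have "2 * l' / r\<^sup>2 = - k' * (quad j a' b' / r\<^sup>2)"
      using pde'[OF j' q] rep_derivatives(3)[OF r(1) F'[OF j] st4] by (simp add: qs[OF j] k'_def q_def[symmetric] l'_def)
    then have "2 * l' = - (k' * quad j a' b')" using r(1) by (simp add: divide_eq_eq)
    ultimately have "2 * (l' - l) = - (k' * quad j a' b' - k * quad j a b)" by simp
    from arg_cong[OF this, of abs] kq
    have "2 * \<bar>l' - l\<bar> \<le> (L / r0 * e) * (3 * (N * N)) + norm D * (6 * (N * e))"
      by (simp only: abs_minus_cancel abs_mult abs_numeral)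
    moreover have "E_lap (E j) \<sigma> t = l' - l"
      using nst by (simp add: E_def clin_diff clin_mapA clin_der chom_diff[OF chom_Ev] l_def l'_def)
    ultimately have "2 * \<bar>E_lap (E j) \<sigma> t\<bar>
      \<le> (L / r0 * e) * (3 * (N * N)) + norm D * (6 * (N * e))"
      by simp
    also have "\<dots> = (L / r0 * (3 * (N * N)) + norm D * (6 * N)) * e" by (simp add: algebra_simps)
    finally show "\<bar>E_lap (E j) \<sigma> t\<bar>
      \<le> (L / r0 * (3 * (N * N)) + norm D * (6 * N)) / 2 * (\<Sum>j\<in>J. \<bar>Ev (E j) \<sigma> t\<bar> + \<bar>E_s (E j) \<sigma> t\<bar> + \<bar>E_t (E j) \<sigma> t\<bar>)"
      unfolding e_def[symmetric] by simp
  qed (use \<theta> in auto)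
  then have FF: "F' i = F i" if "i \<in> J" for i using that by (simp add: E_def)
  have "u i q = u' i q" if "norm q < r" "i \<in> {1,2,3}" for i q
  proof -
    have i: "i \<in> J" using that by (simp add: J_def)
    have "\<bar>fst q\<bar> < r" "\<bar>snd q\<bar> < r"
      using that norm_fst_le[of "fst q" "snd q"] norm_snd_le[of "snd q" "fst q"] by auto
    then have "\<bar>fst q / r\<bar> \<le> 1" "\<bar>snd q / r\<bar> \<le> 1" using r by auto
    from F[OF i this] F'[OF i this] FF[OF i] r show ?thesis by simp
  qed
  then show ?thesis using r(1) by blast
qed

section \<open>Cauchy data and the angle function\<close>

lemma loc_an_add_const: "loc_an f q \<Longrightarrow> loc_an (\<lambda>q. c + f q) q"
proof -
  assume "loc_an f q"
  then obtain r F where r: "r > 0" and F: "\<And>s t. \<bar>s\<bar> \<le> 1 \<Longrightarrow> \<bar>t\<bar> \<le> 1 \<Longrightarrow> f (fst q + r * s, snd q + r * t) = Ev F s t"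
    by (auto simp: loc_an_def)
  have "c + f (fst q + r * s, snd q + r * t) = Ev (const (const c) + F) s t" if "\<bar>s\<bar> \<le> 1" "\<bar>t\<bar> \<le> 1" for s t
    using F[OF that] that by (simp add: chom_add[OF chom_Ev] Ev_const ev_const)
  then show ?thesis using r unfolding loc_an_def by blast
qed

text \<open>Lagrange's identity: the squared norm of a cross product is the product of the squared
  norms minus the squared inner product, which conformality turns into a perfect square under the
  root.\<close>

lemma angle_fn_conformal:
  assumes "(pu x q)\<^sup>2 + (pu y q)\<^sup>2 + (pu z q)\<^sup>2 = (pv x q)\<^sup>2 + (pv y q)\<^sup>2 + (pv z q)\<^sup>2"
    and "pu x q * pv x q + pu y q * pv y q + pu z q * pv z q = 0"
  shows "angle_fn x y z q = (pu x q * pv y q - pu y q * pv x q) / ((pu x q)\<^sup>2 + (pu y q)\<^sup>2 + (pu z q)\<^sup>2)"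
proof -
  have "(pu y q * pv z q - pu z q * pv y q)\<^sup>2 + (pu z q * pv x q - pu x q * pv z q)\<^sup>2 + (pu x q * pv y q - pu y q * pv x q)\<^sup>2
    = ((pu x q)\<^sup>2 + (pu y q)\<^sup>2 + (pu z q)\<^sup>2) * ((pv x q)\<^sup>2 + (pv y q)\<^sup>2 + (pv z q)\<^sup>2)
      - (pu x q * pv x q + pu y q * pv y q + pu z q * pv z q)\<^sup>2"
    by (simp add: power2_eq_square algebra_simps)
  also have "\<dots> = ((pu x q)\<^sup>2 + (pu y q)\<^sup>2 + (pu z q)\<^sup>2)\<^sup>2"
    unfolding assms(2) assms(1)[symmetric] by (simp add: power2_eq_square)
  finally show ?thesis
    unfolding angle_fn_def by simp
qed

lemma (in char_solution) loc_an_X: "norm q < \<rho> \<Longrightarrow> loc_an (X p i) q"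
  unfolding X_def[abs_def] by (intro loc_an_add_const loc_an_Rf \<rho>)

text \<open>The prescribed \<open>\<psi>\<^sub>s\<close> on the diagonal is \<open>\<gamma>\<close> times \<open>(sin, cos, - \<i>)\<close> with \<open>\<gamma> = (B + \<i> A) / 2\<close>,
  up to the scale \<open>\<rho>\<close> of the coordinates.\<close>
locale cauchy_char = char_solution +
  fixes \<gamma> :: "complex aps" and A B :: "real \<Rightarrow> real" and p :: "nat \<Rightarrow> real"
  assumes \<alpha>: "\<And>t. norm t < 1 \<Longrightarrow> ev t (\<alpha> 1) = ev t \<gamma> * sin (of_real \<rho> * t)"
      "\<And>t. norm t < 1 \<Longrightarrow> ev t (\<alpha> 2) = ev t \<gamma> * cos (of_real \<rho> * t)"
      "\<And>t. norm t < 1 \<Longrightarrow> ev t (\<alpha> 3) = - \<i> * ev t \<gamma>"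
    and \<gamma>: "\<And>u. \<bar>u\<bar> < \<rho> \<Longrightarrow> ev (of_real (u / \<rho>)) \<gamma> = of_real (\<rho> / 2) * Complex (B u) (A u)"
    and cA: "continuous_on {-\<rho><..<\<rho>} A" and cB: "continuous_on {-\<rho><..<\<rho>} B"
begin

lemma a_axis:
  assumes u: "\<bar>u\<bar> < \<rho>"
  shows "a 1 (u, 0) = of_real (\<rho> / 2 * sin u) * Complex (B u) (A u)"
    and "a 2 (u, 0) = of_real (\<rho> / 2 * cos u) * Complex (B u) (A u)"
    and "a 3 (u, 0) = of_real (\<rho> / 2) * Complex (A u) (- B u)"
proof -
  have n: "norm (of_real (u / \<rho>) :: complex) < 1" using u \<rho> by (simp add: norm_divide)
  have r: "of_real \<rho> * of_real (u / \<rho>) = (of_real u :: complex)" using \<rho> by simp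
  show "a 1 (u, 0) = of_real (\<rho> / 2 * sin u) * Complex (B u) (A u)"
    "a 2 (u, 0) = of_real (\<rho> / 2 * cos u) * Complex (B u) (A u)"
    "a 3 (u, 0) = of_real (\<rho> / 2) * Complex (A u) (- B u)"
    unfolding a_real[OF u] \<alpha>[OF n] r \<gamma>[OF u] sin_of_real cos_of_real
    by (simp_all add: complex_eq_iff)
qed

lemma norm_axis: "\<bar>u\<bar> < \<rho> \<Longrightarrow> norm (u, 0::real) < \<rho>"
  by (simp add: norm_prod_def)

lemma derivatives_axis:
  assumes u: "\<bar>u\<bar> < \<rho>"
  shows "pu (X p 1) (u, 0) = B u * sin u" "pu (X p 2) (u, 0) = B u * cos u" "pu (X p 3) (u, 0) = A u"
    and "pv (X p 1) (u, 0) = - A u * sin u" "pv (X p 2) (u, 0) = - A u * cos u" "pv (X p 3) (u, 0) = B u"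
proof -
  note n = norm_axis[OF u]
  have m: "1 \<in> {1, 2, 3 :: nat}" "2 \<in> {1, 2, 3 :: nat}" "3 \<in> {1, 2, 3 :: nat}" by auto
  show "pu (X p 1) (u, 0) = B u * sin u" "pu (X p 2) (u, 0) = B u * cos u" "pu (X p 3) (u, 0) = A u"
    and "pv (X p 1) (u, 0) = - A u * sin u" "pv (X p 2) (u, 0) = - A u * cos u" "pv (X p 3) (u, 0) = B u"
    unfolding pu_X[OF n m(1)] pu_X[OF n m(2)] pu_X[OF n m(3)] pv_X[OF n m(1)] pv_X[OF n m(2)] pv_X[OF n m(3)]
      a_axis[OF u] using \<rho> by simp_all
qed

text \<open>The fundamental theorem of calculus; the value at the origin is \<open>p i\<close>
  because \<open>sol\<close> vanishes there. The interval is written with \<open>min\<close> and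
  \<open>max\<close> since \<open>u\<close> may be negative.\<close>

lemma X_axis:
  assumes u: "\<bar>u\<bar> < \<rho>" and i: "i \<in> {1, 2, 3}" and f: "continuous_on {-\<rho><..<\<rho>} f"
    and d: "\<And>s. \<bar>s\<bar> < \<rho> \<Longrightarrow> pu (X p i) (s, 0) = f s"
  shows "X p i (u, 0) = p i + (LBINT t=ereal 0..ereal u. f t)"
proof -
  have sub: "\<bar>s\<bar> < \<rho>" if "min 0 u \<le> s" "s \<le> max 0 u" for s
    using that u by (auto simp: min_def max_def split: if_splits)
  have "(LBINT t=ereal 0..ereal u. f t) = X p i (u, 0) - X p i (0, 0)"
  proof (rule interval_integral_FTC_finite)
    show "continuous_on {min 0 u..max 0 u} f"
      by (rule continuous_on_subset[OF f]) (use u in \<open>auto simp: min_def max_def abs_less_iff split: if_splits\<close>)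
    fix s assume "min 0 u \<le> s" "s \<le> max 0 u"
    then have s: "\<bar>s\<bar> < \<rho>" by (rule sub)
    have "((\<lambda>s. X p i (s, 0)) has_real_derivative pu (X p i) (s, 0)) (at s)"
      unfolding pu_X[OF norm_axis[OF s] i] using X_derivatives(1)[OF norm_axis[OF s] i] by simp
    then show "((\<lambda>s. X p i (s, 0)) has_vector_derivative f s) (at s within {min 0 u..max 0 u})"
      using d[OF s] by (simp add: has_real_derivative_iff_has_vector_derivative has_vector_derivative_at_within)
  qed
  then show ?thesis by (simp add: X_0)
qed

lemma cauchy_solution_X:
  assumes R: "R \<le> \<rho>"
    and I: "\<And>c. \<bar>c - p 3\<bar> \<le> r \<Longrightarrow> c \<in> I"
    and \<phi>: "\<And>c. \<bar>c - p 3\<bar> \<le> r \<Longrightarrow> deriv \<phi> c = ev ((c - p 3) / r) D"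
  shows "cauchy_solution \<phi> I A B (p 1) (p 2) (p 3) R (X p 1) (X p 2) (X p 3)"
proof -
  have z: "\<bar>X p 3 q - p 3\<bar> \<le> r" if "norm q < \<rho>" for q
    using Rf_S_bound[OF that] by (simp add: X_def)
  have g: "deriv \<phi> (X p 3 q) = g q" if "norm q < \<rho>" for q
    unfolding \<phi>[OF z[OF that]] g_def by (simp add: X_def)
  have "continuous_on {-\<rho><..<\<rho>} (\<lambda>t. B t * sin t)" "continuous_on {-\<rho><..<\<rho>} (\<lambda>t. B t * cos t)"
    by (intro continuous_intros cB)+
  note ax = X_axis[OF _ _ this(1), of _ 1] X_axis[OF _ _ this(2), of _ 2] X_axis[OF _ _ cA, of _ 3]
  show ?thesis
    unfolding cauchy_solution_def real_analytic2_on_iff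
  proof (intro conjI ballI allI impI)
    fix q :: "real \<times> real" assume "q \<in> ball 0 R"
    then have q: "norm q < \<rho>" using R by simp
    show "loc_an (X p 1) q" "loc_an (X p 2) q" "loc_an (X p 3) q" using q by (simp_all add: loc_an_X)
    show "X p 3 q \<in> I" by (rule I[OF z[OF q]])
    show "lap (X p 1) q = - deriv \<phi> (X p 3 q) * gdot (X p 1) (X p 3) q"
      "lap (X p 2) q = - deriv \<phi> (X p 3 q) * gdot (X p 2) (X p 3) q"
      "lap (X p 3) q = - deriv \<phi> (X p 3 q) *
        ((- gdot (X p 1) (X p 1) q - gdot (X p 2) (X p 2) q + gdot (X p 3) (X p 3) q) / 2)"
      unfolding g[OF q] by (fact pde[OF q])+
  next
    fix u assume "\<bar>u\<bar> < R"
    then have u: "\<bar>u\<bar> < \<rho>" using R by simp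
    show "X p 1 (u, 0) = p 1 + (LBINT t=ereal 0..ereal u. B t * sin t)"
      "X p 2 (u, 0) = p 2 + (LBINT t=ereal 0..ereal u. B t * cos t)"
      "X p 3 (u, 0) = p 3 + (LBINT t=ereal 0..ereal u. A t)"
      by (rule ax; simp add: u derivatives_axis[simplified])+
    show "pv (X p 1) (u, 0) = - A u * sin u" "pv (X p 2) (u, 0) = - A u * cos u" "pv (X p 3) (u, 0) = B u"
      by (rule derivatives_axis[OF u])+
  qed
qed

definition "metric_factor q = (pu (X p 1) q)\<^sup>2 + (pu (X p 2) q)\<^sup>2 + (pu (X p 3) q)\<^sup>2"

lemma metric_factor_axis:
  assumes u: "\<bar>u\<bar> < \<rho>" shows "metric_factor (u, 0) = (A u)\<^sup>2 + (B u)\<^sup>2"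
proof -
  have "metric_factor (u, 0) = (B u)\<^sup>2 * ((sin u)\<^sup>2 + (cos u)\<^sup>2) + (A u)\<^sup>2"
    unfolding metric_factor_def derivatives_axis[OF u] by (simp only: power_mult_distrib distrib_left)
  then show ?thesis by simp
qed

lemma metric_factor_Rf:
  assumes "norm q < \<rho>"
  shows "metric_factor q = 4 / \<rho>\<^sup>2 * ((Rf \<rho> (da 1) q)\<^sup>2 + (Rf \<rho> (da 2) q)\<^sup>2 + (Rf \<rho> (da 3) q)\<^sup>2)"
  using assms by (simp add: metric_factor_def pu_X Rf_def a_def power_divide add_divide_distrib power_mult_distrib)

lemma continuous_metric_factor: "continuous_on (ball 0 \<rho>) metric_factor"
proof -
  have "continuous_on (ball 0 \<rho>) (\<lambda>q. 4 / \<rho>\<^sup>2 * ((Rf \<rho> (da 1) q)\<^sup>2 + (Rf \<rho> (da 2) q)\<^sup>2 + (Rf \<rho> (da 3) q)\<^sup>2))"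
    by (intro continuous_intros continuous_on_Rf \<rho>)
  then show ?thesis
    by (rule continuous_on_eq) (simp add: metric_factor_Rf)
qed

lemma nrm_axis: "\<bar>u\<bar> < \<rho> \<Longrightarrow> Rf \<rho> nrm (u, 0) = 0"
  using Rf_nrm[OF norm_axis, of u p] \<rho> by (simp add: derivatives_axis[simplified])

text \<open>The derivative \<open>k\<close> of \<open>\<gamma>\<close> enters only through the real
  part of \<open>k * cnj c - c * cnj k\<close>, which is 0. What remains comes from differentiating
  sine and cosine: the squared modulus of \<open>c\<close>, where \<open>c\<close> is
  \<open>\<rho> / 2\<close> times \<open>B + \<i> * A\<close>.\<close>

lemma nrm_derivative_axis':
  assumes u: "\<bar>u\<bar> < \<rho>"
  shows "((\<lambda>s. Rf \<rho> nrm (u, s)) has_real_derivative \<rho>\<^sup>2 / 4 * ((A u)\<^sup>2 + (B u)\<^sup>2)) (at 0)"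
proof -
  define t :: complex where "t = of_real (u / \<rho>)"
  have n: "norm t < 1" using u \<rho> by (simp add: norm_divide t_def)
  have r: "of_real \<rho> * t = of_real u" using \<rho> by (simp add: t_def)
  define k where "k = (\<Sum>n. diffs (coef \<gamma>) n * t ^ n)"
  have k: "((\<lambda>t. ev t \<gamma>) has_field_derivative k) (at t)"
    unfolding k_def by (rule ev_has_derivative_diffs[OF n])
  define c where "c = ev t \<gamma>"
  have c: "c = of_real (\<rho> / 2) * Complex (B u) (A u)" unfolding c_def t_def by (rule \<gamma>[OF u])
  have "((\<lambda>t. ev t \<gamma> * sin (of_real \<rho> * t)) has_field_derivative
      (k * sin (of_real u) + of_real \<rho> * cos (of_real u) * c)) (at t)"
    by (rule derivative_eq_intros k refl | simp add: r c_def)+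
  then have d1: "((\<lambda>t. ev t (\<alpha> 1)) has_field_derivative (k * sin (of_real u) + of_real \<rho> * cos (of_real u) * c)) (at t)"
    by (rule has_field_derivative_transform_ball[OF _ n]) (simp add: \<alpha>[simplified])
  have "((\<lambda>t. ev t \<gamma> * cos (of_real \<rho> * t)) has_field_derivative
      (k * cos (of_real u) + - (of_real \<rho> * sin (of_real u)) * c)) (at t)"
    by (rule derivative_eq_intros k refl | simp add: r c_def)+
  then have d2: "((\<lambda>t. ev t (\<alpha> 2)) has_field_derivative (k * cos (of_real u) + - (of_real \<rho> * sin (of_real u)) * c)) (at t)"
    by (rule has_field_derivative_transform_ball[OF _ n]) (simp add: \<alpha>)
  have ga: "Re (a i (u, 0) * cnj (a 3 (u, 0))) = 0" if "i \<in> {1,2}" for i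
  proof -
    from that consider "i = 1" | "i = 2" by auto
    then show ?thesis
    proof cases
      case 1 show ?thesis unfolding 1 a_axis[OF u] by simp
    next
      case 2 show ?thesis unfolding 2 a_axis[OF u] by simp
    qed
  qed
  have "Re ((k * sin (of_real u) + of_real \<rho> * cos (of_real u) * c) * cnj (a 2 (u, 0))
      - a 1 (u, 0) * cnj (k * cos (of_real u) + - (of_real \<rho> * sin (of_real u)) * c)) / \<rho>
    = ((sin u)\<^sup>2 + (cos u)\<^sup>2) * ((Re c)\<^sup>2 + (Im c)\<^sup>2)"
  proof -
    have 1: "a 1 (u, 0) = of_real (sin u) * c" "a 2 (u, 0) = of_real (cos u) * c"
      unfolding a_axis[OF u] c by (simp_all only: of_real_mult mult_ac)
    have "Re ((k * of_real s + of_real \<rho> * of_real e * c) * cnj (of_real e * c)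
        - of_real s * c * cnj (k * of_real e + - (of_real \<rho> * of_real s) * c)) / \<rho>
      = (s\<^sup>2 + e\<^sup>2) * ((Re c)\<^sup>2 + (Im c)\<^sup>2)" for s e :: real
      using \<rho> by (simp add: field_simps power2_eq_square)
    then show ?thesis unfolding 1 sin_of_real cos_of_real .
  qed
  also have "\<dots> = \<rho>\<^sup>2 / 4 * ((A u)\<^sup>2 + (B u)\<^sup>2)"
    unfolding c by (simp add: power2_eq_square algebra_simps)
  finally have eq: "Re ((k * sin (of_real u) + of_real \<rho> * cos (of_real u) * c) * cnj (a 2 (u, 0))
      - a 1 (u, 0) * cnj (k * cos (of_real u) + - (of_real \<rho> * sin (of_real u)) * c)) / \<rho>
    = \<rho>\<^sup>2 / 4 * ((A u)\<^sup>2 + (B u)\<^sup>2)" .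
  show ?thesis
    by (rule DERIV_cong[OF nrm_derivative_axis[OF u _ d1[unfolded t_def] d2[unfolded t_def]] eq]) (rule ga)
qed

lemma angle_X:
  assumes "norm q < \<rho>"
  shows "angle_fn (X p 1) (X p 2) (X p 3) q = 4 / \<rho>\<^sup>2 * Rf \<rho> nrm q / metric_factor q"
  unfolding angle_fn_conformal[OF conformal[OF assms]] Rf_nrm[OF assms] metric_factor_def ..

text \<open>The numerator vanishes on the axis, so the quotient rule multiplies the derivative
  \<open>m\<close> of the denominator by 0; the surviving term is the quotient of
  \<open>(A u)\<^sup>2 + (B u)\<^sup>2\<close> by itself.\<close>

lemma angle_axis:
  assumes u: "\<bar>u\<bar> < \<rho>" and pos: "(A u)\<^sup>2 + (B u)\<^sup>2 > 0"
  shows "angle_fn (X p 1) (X p 2) (X p 3) (u, 0) = 0"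
    and "pv (angle_fn (X p 1) (X p 2) (X p 3)) (u, 0) = 1"
proof -
  show "angle_fn (X p 1) (X p 2) (X p 3) (u, 0) = 0"
    by (simp add: angle_X[OF norm_axis[OF u], simplified] nrm_axis[OF u])
  have z: "norm (Zc \<rho> (u, 0)) < 1" "norm (cnj (Zc \<rho> (u, 0))) < 1"
    using norm_Zc_less[OF \<rho> norm_axis[OF u]] by auto
  have "\<exists>d. ((\<lambda>s. Rf \<rho> (da i) (u, s)) has_real_derivative d) (at 0)" for i
  proof -
    obtain e where "((\<lambda>s. Ev (da i) s (cnj (Zc \<rho> (u, 0)))) has_field_derivative e) (at (Zc \<rho> (u, 0)))"
      "((\<lambda>t. Ev (da i) (Zc \<rho> (u, 0)) t) has_field_derivative Ez \<rho> (w i) (u, 0)) (at (cnj (Zc \<rho> (u, 0))))"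
      using da_partials[OF z] by metis
    from Rf_derivatives(2)[OF \<rho> norm_axis[OF u] this] show ?thesis by auto
  qed
  then obtain d where d: "\<And>i. ((\<lambda>s. Rf \<rho> (da i) (u, s)) has_real_derivative d i) (at 0)" by metis
  define M where "M = (\<lambda>s. 4 / \<rho>\<^sup>2 * ((Rf \<rho> (da 1) (u, s))\<^sup>2 + (Rf \<rho> (da 2) (u, s))\<^sup>2 + (Rf \<rho> (da 3) (u, s))\<^sup>2))"
  have "\<exists>m. (M has_real_derivative m) (at 0)"
    unfolding M_def by (rule exI) (rule derivative_eq_intros d refl)+
  then obtain m where m: "(M has_real_derivative m) (at 0)" by blast
  have M0: "M 0 = (A u)\<^sup>2 + (B u)\<^sup>2"
    using metric_factor_Rf[OF norm_axis[OF u]] metric_factor_axis[OF u] by (simp add: M_def)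
  have "((\<lambda>s. 4 / \<rho>\<^sup>2 * Rf \<rho> nrm (u, s) / M s) has_real_derivative 1) (at 0)"
  proof (rule DERIV_cong)
    show "((\<lambda>s. 4 / \<rho>\<^sup>2 * Rf \<rho> nrm (u, s) / M s) has_real_derivative
      ((4 / \<rho>\<^sup>2 * (\<rho>\<^sup>2 / 4 * ((A u)\<^sup>2 + (B u)\<^sup>2))) * M 0 - 4 / \<rho>\<^sup>2 * Rf \<rho> nrm (u, 0) * m) / (M 0 * M 0)) (at 0)"
      by (intro DERIV_divide DERIV_cmult nrm_derivative_axis' u m) (use pos in \<open>auto simp: M0\<close>)
  qed (use pos \<rho> in \<open>auto simp: M0 nrm_axis[OF u]\<close>)
  then have "((\<lambda>s. angle_fn (X p 1) (X p 2) (X p 3) (u, s)) has_real_derivative 1) (at 0)"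
  proof (rule has_field_derivative_transform_within_open)
    show "open {s. norm (u, s) < \<rho>}" by (intro open_Collect_less continuous_intros)
    show "4 / \<rho>\<^sup>2 * Rf \<rho> nrm (u, s) / M s = angle_fn (X p 1) (X p 2) (X p 3) (u, s)" if "s \<in> {s. norm (u, s) < \<rho>}" for s
      using that angle_X metric_factor_Rf by (simp add: M_def)
  qed (use norm_axis[OF u] in simp)
  then show "pv (angle_fn (X p 1) (X p 2) (X p 3)) (u, 0) = 1"
    by (intro pv_eqI) simp
qed

text \<open>\<open>N\<close> is the \<open>v\<close>-derivative of the numerator, and 1 / 2 is the
  range of \<open>der\<close>. The vertical segment from the axis to a point of a disk about 0 stays
  in that disk, so positivity of \<open>N\<close> on the disk makes the numerator strictly
  increasing along the segment, starting from 0 on the axis.\<close>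

lemma good_radius:
  assumes pos: "(A 0)\<^sup>2 + (B 0)\<^sup>2 > 0"
  obtains R where "0 < R" "R \<le> \<rho>"
    "\<And>q. norm q < R \<Longrightarrow> metric_factor q > 0"
    "\<And>q. norm q < R \<Longrightarrow> snd q \<noteq> 0 \<Longrightarrow> Rf \<rho> nrm q \<noteq> 0"
proof -
  define N where "N = (\<lambda>q. Re (\<i> * (Ev (mapA der nrm) (2 * Zc \<rho> q) (cnj (Zc \<rho> q)) - Ev (der nrm) (Zc \<rho> q) (2 * cnj (Zc \<rho> q)))) / \<rho>)"
  have \<rho>2: "\<rho> / 2 > 0" "0 \<in> ball (0 :: real \<times> real) (\<rho> / 2)" "0 \<in> ball (0 :: real \<times> real) \<rho>" using \<rho> by auto
  have zero: "(0, 0) = (0 :: real \<times> real)" by (simp add: zero_prod_def)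
  have "((\<lambda>s. Rf \<rho> nrm (0, s)) has_real_derivative N 0) (at 0)"
    using nrm_derivative[of 0] \<rho> by (simp add: N_def)
  then have N0: "N 0 = \<rho>\<^sup>2 / 4 * ((A 0)\<^sup>2 + (B 0)\<^sup>2)"
    using nrm_derivative_axis'[of 0] \<rho> by (intro DERIV_unique) auto
  have Npos: "N 0 > 0" unfolding N0 using pos \<rho> by simp
  have Mpos: "metric_factor 0 > 0"
    using metric_factor_axis[of 0] pos \<rho> by (simp add: zero)
  have cZ: "continuous_on (ball 0 (\<rho> / 2)) (Zc \<rho>)"
    unfolding Zc_def[abs_def] Complex_eq using \<rho> by (intro continuous_intros) auto
  have nZ: "norm (Zc \<rho> q) < 1 / 2" if "norm q < \<rho> / 2" for q
    using that \<rho> by (simp add: norm_Zc field_simps)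
  have c1: "continuous_on (ball 0 (\<rho> / 2)) (\<lambda>q. (\<lambda>(s, t). Ev F s t) (2 * Zc \<rho> q, cnj (Zc \<rho> q)))" for F :: "complex aps aps"
    by (rule continuous_on_compose2[OF continuous_on_Ev], intro continuous_on_Pair continuous_on_cnj cZ continuous_on_mult continuous_on_const)
       (use nZ in \<open>force simp: norm_mult\<close>)
  have c2: "continuous_on (ball 0 (\<rho> / 2)) (\<lambda>q. (\<lambda>(s, t). Ev F s t) (Zc \<rho> q, 2 * cnj (Zc \<rho> q)))" for F :: "complex aps aps"
    by (rule continuous_on_compose2[OF continuous_on_Ev], intro continuous_on_Pair continuous_on_cnj cZ continuous_on_mult continuous_on_const)
       (use nZ in \<open>force simp: norm_mult\<close>)
  have cN: "continuous_on (ball 0 (\<rho> / 2)) N"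
    unfolding N_def using \<rho> c1[of "mapA der nrm"] c2[of "der nrm"]
    by (intro continuous_on_divide continuous_on_Re continuous_on_mult continuous_on_diff continuous_on_const) auto
  have "\<forall>\<^sub>F q in nhds 0. N q > 0"
  proof -
    have "isCont N 0" using cN \<rho>2(2) by (simp add: continuous_on_eq_continuous_at)
    then have "(N \<longlongrightarrow> N 0) (nhds 0)" by (simp add: isCont_def tendsto_at_iff_tendsto_nhds)
    then show ?thesis using Npos by (rule order_tendstoD)
  qed
  moreover have "\<forall>\<^sub>F q in nhds 0. metric_factor q > 0"
  proof -
    have "isCont metric_factor 0" using continuous_metric_factor \<rho>2(3) by (simp add: continuous_on_eq_continuous_at)
    then have "(metric_factor \<longlongrightarrow> metric_factor 0) (nhds 0)" by (simp add: isCont_def tendsto_at_iff_tendsto_nhds)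
    then show ?thesis using Mpos by (rule order_tendstoD)
  qed
  ultimately have "\<forall>\<^sub>F q in nhds 0. N q > 0 \<and> metric_factor q > 0" by (rule eventually_conj)
  then obtain d where d: "d > 0" "\<And>q. dist q 0 < d \<Longrightarrow> N q > 0 \<and> metric_factor q > 0"
    unfolding eventually_nhds_metric by blast
  define R where "R = min d (\<rho> / 2)"
  have R: "0 < R" "R \<le> \<rho> / 2" "R \<le> d" using d \<rho> by (auto simp: R_def)
  show thesis
  proof (rule that[OF R(1)])
    show "R \<le> \<rho>" using R \<rho> by simp
    show "metric_factor q > 0" if "norm q < R" for q using d(2)[of q] that R by simp
    fix q :: "real \<times> real" assume q: "norm q < R" "snd q \<noteq> 0"
    obtain u v where uv: "q = (u, v)" by (cases q)
    have small: "norm (u, s) < R" if "\<bar>s\<bar> \<le> \<bar>v\<bar>" for s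
    proof -
      have "s\<^sup>2 \<le> v\<^sup>2" using that by (simp only: abs_le_square_iff)
      then have "norm (u, s) \<le> norm (u, v)" by (simp add: norm_prod_def)
      then show ?thesis using q uv by simp
    qed
    have der: "\<exists>y. ((\<lambda>s. Rf \<rho> nrm (u, s)) has_real_derivative y) (at s) \<and> 0 < y" if "\<bar>s\<bar> \<le> \<bar>v\<bar>" for s
    proof (intro exI conjI)
      show "((\<lambda>s. Rf \<rho> nrm (u, s)) has_real_derivative N (u, s)) (at s)"
        using nrm_derivative[of "(u, s)"] small[OF that] R by (simp add: N_def)
      show "0 < N (u, s)" using d(2)[of "(u, s)"] small[OF that] R by simp
    qed
    have "\<bar>u\<bar> < \<rho>" using small[of 0] R \<rho> by (simp add: norm_prod_def)
    then have 0: "Rf \<rho> nrm (u, 0) = 0" by (rule nrm_axis)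
    show "Rf \<rho> nrm q \<noteq> 0"
    proof (cases "v > 0")
      case True
      then have "Rf \<rho> nrm (u, 0) < Rf \<rho> nrm (u, v)"
        using der by (intro DERIV_pos_imp_increasing[of 0 v "\<lambda>s. Rf \<rho> nrm (u, s)"]) auto
      then show ?thesis by (simp add: 0 uv)
    next
      case False
      then have "v < 0" using q uv by simp
      then have "Rf \<rho> nrm (u, v) < Rf \<rho> nrm (u, 0)"
        using der by (intro DERIV_pos_imp_increasing[of v 0 "\<lambda>s. Rf \<rho> nrm (u, s)"]) auto
      then show ?thesis by (simp add: 0 uv)
    qed
  qed
qed

end

section \<open>From the power series of the data to a characteristic solution\<close>

lemma real_analytic_on_imp_sums:
  assumes "real_analytic_on f S" "a \<in> S"
  obtains c r where "r > 0" "\<And>t. \<bar>t\<bar> < r \<Longrightarrow> (\<lambda>n. c n * t ^ n) sums f (a + t)"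
proof -
  obtain c r where "r > 0" and c: "\<forall>t. \<bar>t - a\<bar> < r \<longrightarrow> (\<lambda>n. c n * (t - a) ^ n) sums f t"
    using assms unfolding real_analytic_on_def by blast
  show thesis
  proof (rule that[OF \<open>r > 0\<close>])
    show "(\<lambda>n. c n * t ^ n) sums f (a + t)" if "\<bar>t\<bar> < r" for t
      using c[rule_format, of "a + t"] that by simp
  qed
qed

text \<open>The same power series in the coordinate divided by \<open>\<rho>\<close>, so that the
  disc of radius \<open>\<rho>\<close> becomes the unit disc.\<close>

definition dilate :: "(nat \<Rightarrow> real) \<Rightarrow> real \<Rightarrow> real aps" where
  "dilate c \<rho> = Aps (\<lambda>n. c n * \<rho> ^ n)"

lemma
  fixes c :: "nat \<Rightarrow> real"
  assumes c: "\<And>t. \<bar>t\<bar> < r \<Longrightarrow> summable (\<lambda>n. c n * t ^ n)" and \<rho>: "0 \<le> \<rho>" "\<rho> < r"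
  shows summable_dilate: "summable (\<lambda>n. norm (c n * \<rho> ^ n))"
    and coef_dilate: "coef (dilate c \<rho>) n = c n * \<rho> ^ n"
proof -
  have "summable (\<lambda>n. c n * ((\<rho> + r) / 2) ^ n)" using \<rho> by (intro c) auto
  then show s: "summable (\<lambda>n. norm (c n * \<rho> ^ n))"
    by (rule powser_insidea) (use \<rho> in auto)
  show "coef (dilate c \<rho>) n = c n * \<rho> ^ n"
    unfolding dilate_def by (rule coef_Aps) (rule s)
qed

text \<open>Bounds all smaller dilations by the one at a fixed \<open>\<rho>0\<close>, so that
  \<open>\<rho>\<close> may be chosen after the constants it has to beat.\<close>

lemma norm_dilate_mono:
  assumes c: "\<And>t. \<bar>t\<bar> < r \<Longrightarrow> summable (\<lambda>n. c n * t ^ n)" and \<rho>: "0 \<le> \<rho>" "\<rho> \<le> \<rho>0" "\<rho>0 < r"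
  shows "norm (dilate c \<rho>) \<le> norm (dilate c \<rho>0)"
proof -
  have r: "\<rho> < r" "0 \<le> \<rho>0" using \<rho> by auto
  have d: "coef (dilate c \<rho>) n = c n * \<rho> ^ n" "coef (dilate c \<rho>0) n = c n * \<rho>0 ^ n" for n
    by (rule coef_dilate[OF c \<rho>(1) r(1)] coef_dilate[OF c r(2) \<rho>(3)]; assumption)+
  have "norm (coef (dilate c \<rho>) n) \<le> norm (coef (dilate c \<rho>0) n)" for n
    unfolding d using \<rho> by (simp add: abs_mult mult_left_mono power_mono)
  then show ?thesis
    unfolding norm_aps_def by (intro suminf_le summable_norm_coef)
qed

lemma ev_dilate:
  assumes c: "\<And>t. \<bar>t\<bar> < r \<Longrightarrow> summable (\<lambda>n. c n * t ^ n)" and \<rho>: "0 \<le> \<rho>" "\<rho> < r"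
  shows "ev t (mapA of_real (dilate c \<rho>)) = (\<Sum>n. of_real (c n) * (of_real \<rho> * t) ^ n)"
  by (simp add: ev_def coef_mapA clin_of_real coef_dilate[OF c \<rho>] power_mult_distrib mult.assoc)

lemma ev_dilate_real:
  assumes c: "\<And>t. \<bar>t\<bar> < r \<Longrightarrow> summable (\<lambda>n. c n * t ^ n)" and \<rho>: "0 \<le> \<rho>" "\<rho> < r"
  shows "ev t (dilate c \<rho>) = (\<Sum>n. c n * (\<rho> * t) ^ n)"
  by (simp add: ev_def coef_dilate[OF c \<rho>] power_mult_distrib mult.assoc)

text \<open>Staying within half the radius \<open>r1\<close> leaves room for absolute convergence at
  \<open>r\<close> itself. The weighted coefficient sum is \<open>r\<close> times the absolutely
  convergent series of the second derivative of \<open>\<phi>\<close> at distance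
  \<open>r\<close>.\<close>

lemma real_analytic_on_deriv_series:
  assumes an: "real_analytic_on \<phi> I" and I: "open I" and x0: "x0 \<in> I"
  obtains r D where "r > 0" "summable (\<lambda>n. real n * \<bar>coef D n\<bar>)"
    "\<And>x. \<bar>x - x0\<bar> \<le> r \<Longrightarrow> x \<in> I" "\<And>x. \<bar>x - x0\<bar> \<le> r \<Longrightarrow> deriv \<phi> x = ev ((x - x0) / r) D"
proof -
  obtain e r1 where r1: "r1 > 0" and e: "\<And>t. \<bar>t\<bar> < r1 \<Longrightarrow> (\<lambda>n. e n * t ^ n) sums \<phi> (x0 + t)"
    by (rule real_analytic_on_imp_sums[OF an x0]) blast
  obtain r2 where r2: "r2 > 0" "cball x0 r2 \<subseteq> I"
    using I x0 open_contains_cball by blast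
  define r where "r = min (r1 / 2) r2"
  have r: "0 < r" "r < r1" "r \<le> r2" using r1 r2 by (auto simp: r_def)
  have s0: "summable (\<lambda>n. e n * t ^ n)" if "norm t < r1" for t
    using e that by (auto simp: sums_iff)
  have s1: "summable (\<lambda>n. diffs e n * t ^ n)" if "\<bar>t\<bar> < r1" for t
    by (rule termdiff_converges[of _ r1]) (use that s0 in auto)
  have s2: "summable (\<lambda>n. diffs (diffs e) n * t ^ n)" if "\<bar>t\<bar> < r1" for t
    by (rule termdiff_converges[of _ r1]) (use that s1 in auto)
  define D where "D = dilate (diffs e) r"
  have D: "coef D n = diffs e n * r ^ n" for n
    unfolding D_def by (rule coef_dilate[OF s1]) (use r in auto)
  show thesis
  proof (rule that[OF r(1)])
    have "summable (\<lambda>n. r * norm (diffs (diffs e) n * r ^ n))"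
      by (intro summable_mult summable_dilate[OF s2]) (use r in auto)
    also have "(\<lambda>n. r * norm (diffs (diffs e) n * r ^ n)) = (\<lambda>n. real (Suc n) * \<bar>coef D (Suc n)\<bar>)"
      using r by (simp add: fun_eq_iff D diffs_def abs_mult mult_ac)
    finally show "summable (\<lambda>n. real n * \<bar>coef D n\<bar>)" by (subst (asm) summable_Suc_iff)
    fix x assume x: "\<bar>x - x0\<bar> \<le> r"
    show "x \<in> I" using x r r2 by (intro subsetD[OF r2(2)]) (simp add: dist_real_def abs_minus_commute)
    have "((\<lambda>t. \<Sum>n. e n * t ^ n) has_field_derivative (\<Sum>n. diffs e n * (x - x0) ^ n)) (at (x - x0))"
      by (rule termdiffs_strong'[OF s0]) (use x r in auto)
    then have "((\<lambda>t. \<Sum>n. e n * t ^ n) has_field_derivative (\<Sum>n. diffs e n * (x - x0) ^ n)) (at (x + - x0))"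
      by simp
    from DERIV_shift[THEN iffD1, OF this]
    have "((\<lambda>x. \<Sum>n. e n * (x + - x0) ^ n) has_field_derivative (\<Sum>n. diffs e n * (x - x0) ^ n)) (at x)" .
    then have "(\<phi> has_field_derivative (\<Sum>n. diffs e n * (x - x0) ^ n)) (at x)"
    proof (rule has_field_derivative_transform_within_open)
      show "x \<in> ball x0 r1" using x r by (simp add: dist_real_def abs_minus_commute)
      show "(\<Sum>n. e n * (y + - x0) ^ n) = \<phi> y" if "y \<in> ball x0 r1" for y
        using e[of "y - x0"] that by (simp add: dist_real_def abs_minus_commute sums_iff)
    qed simp
    then have "deriv \<phi> x = (\<Sum>n. diffs e n * (x - x0) ^ n)" by (rule DERIV_imp_deriv)
    also have "\<dots> = ev ((x - x0) / r) D"
      unfolding D_def using r by (subst ev_dilate_real[OF s1]) auto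
    finally show "deriv \<phi> x = ev ((x - x0) / r) D" .
  qed
qed

text \<open>Order of the choices: \<open>r\<close> and \<open>D\<close> depend on
  \<open>\<phi>\<close> only, \<open>m\<close> on them, and \<open>\<rho>\<close> comes last.
  Through \<open>\<gamma>\<close> the data carry a factor \<open>\<rho>\<close>, while the other
  norms are bounded by their values at \<open>\<rho>0\<close>; a small \<open>\<rho>\<close>
  therefore brings the data below \<open>m\<close>.\<close>

lemma cauchy_char_exists:
  assumes an: "real_analytic_on \<phi> I" "open I" "p 3 \<in> I"
    and A: "real_analytic_on A {-\<epsilon><..<\<epsilon>}" and B: "real_analytic_on B {-\<epsilon><..<\<epsilon>}" and \<epsilon>: "\<epsilon> > 0"
  obtains \<rho> r D \<alpha> w \<gamma> where "cauchy_char \<rho> r D \<alpha> w \<gamma> A B" "\<rho> \<le> \<epsilon>"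
    "summable (\<lambda>n. real n * \<bar>coef D n\<bar>)"
    "\<And>x. \<bar>x - p 3\<bar> \<le> r \<Longrightarrow> x \<in> I" "\<And>x. \<bar>x - p 3\<bar> \<le> r \<Longrightarrow> deriv \<phi> x = ev ((x - p 3) / r) D"
proof -
  obtain r D where r: "r > 0" and D: "summable (\<lambda>n. real n * \<bar>coef D n\<bar>)"
    and rI: "\<And>x. \<bar>x - p 3\<bar> \<le> r \<Longrightarrow> x \<in> I"
    and rD: "\<And>x. \<bar>x - p 3\<bar> \<le> r \<Longrightarrow> deriv \<phi> x = ev ((x - p 3) / r) D"
    by (rule real_analytic_on_deriv_series[OF an]) blast
  have 0: "0 \<in> {-\<epsilon><..<\<epsilon>}" using \<epsilon> by simp
  obtain ca ra where ra: "ra > 0" and "\<And>t. \<bar>t\<bar> < ra \<Longrightarrow> (\<lambda>n. ca n * t ^ n) sums A (0 + t)"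
    by (rule real_analytic_on_imp_sums[OF A 0]) blast
  then have ca: "\<And>t. \<bar>t\<bar> < ra \<Longrightarrow> (\<lambda>n. ca n * t ^ n) sums A t" by simp
  obtain cb rb where rb: "rb > 0" and "\<And>t. \<bar>t\<bar> < rb \<Longrightarrow> (\<lambda>n. cb n * t ^ n) sums B (0 + t)"
    by (rule real_analytic_on_imp_sums[OF B 0]) blast
  then have cb: "\<And>t. \<bar>t\<bar> < rb \<Longrightarrow> (\<lambda>n. cb n * t ^ n) sums B t" by simp
  define r1 where "r1 = min 1 (min \<epsilon> (min ra rb))"
  have r1: "r1 > 0" "r1 \<le> 1" "r1 \<le> \<epsilon>" "r1 \<le> ra" "r1 \<le> rb" using ra rb \<epsilon> by (auto simp: r1_def)
  define \<rho>0 where "\<rho>0 = r1 / 2"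
  have \<rho>0: "\<rho>0 > 0" "\<rho>0 < r1" using r1 by (auto simp: \<rho>0_def)
  have sums: "summable (\<lambda>n. ca n * t ^ n)" "summable (\<lambda>n. cb n * t ^ n)"
      "summable (\<lambda>n. sin_coeff n * t ^ n)" "summable (\<lambda>n. cos_coeff n * t ^ n)" if "\<bar>t\<bar> < r1" for t :: real
    using ca[of t] cb[of t] that r1 sin_converges[of t] cos_converges[of t] by (auto simp: sums_iff)
  \<comment> \<open>The summand 1 covers the third component of the data, which has no trigonometric
    factor.\<close>
  define K where "K = (norm (dilate ca \<rho>0) + norm (dilate cb \<rho>0)) * (1 + norm (dilate sin_coeff \<rho>0) + norm (dilate cos_coeff \<rho>0))"
  have K: "K \<ge> 0" by (simp add: K_def)
  define L where "L = 41 * ((\<Sum>n. real n * \<bar>coef D n\<bar>) / r) + 18 * norm D"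
  have L: "L \<ge> 0"
    unfolding L_def using r D by (intro add_nonneg_nonneg mult_nonneg_nonneg divide_nonneg_pos suminf_nonneg) auto
  \<comment> \<open>The bounds are the conditions of \<open>rhs_fixed_point\<close>; adding 1 keeps
    the denominators positive even if \<open>D\<close> is 0.\<close>
  define m where "m = min (min 1 (r / 5)) (min (1 / (1 + 42 * norm D)) (1 / (1 + 6 * L)))"
  have dn: "1 + 42 * norm D > 0" "1 + 6 * L > 0" using L by (auto simp: add_pos_nonneg)
  have m0: "m > 0" unfolding m_def using r dn by simp
  have m: "5 * m \<le> r" "m \<le> 1" by (auto simp: m_def min_def)
  have "m \<le> 1 / (1 + 42 * norm D)" "m \<le> 1 / (1 + 6 * L)" by (simp_all add: m_def)
  then have "m * (1 + 42 * norm D) \<le> 1" "m * (1 + 6 * L) \<le> 1"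
    using dn by (simp_all only: pos_le_divide_eq)
  then have m': "42 * norm D * m \<le> 1" "6 * L * m \<le> 1" using m0 by (simp_all add: algebra_simps)
  define \<rho> where "\<rho> = min \<rho>0 (m / (1 + K))"
  have \<rho>: "\<rho> > 0" "\<rho> \<le> \<rho>0" "\<rho> * K \<le> m" "0 \<le> \<rho>" "\<rho> < r1"
  proof -
    show "\<rho> > 0" "\<rho> \<le> \<rho>0" using \<rho>0 m0 K by (auto simp: \<rho>_def add_pos_nonneg)
    then show "0 \<le> \<rho>" "\<rho> < r1" using \<rho>0 by auto
    have "\<rho> * (1 + K) \<le> m" using K by (simp add: \<rho>_def add_pos_nonneg flip: pos_le_divide_eq)
    then show "\<rho> * K \<le> m" using \<open>\<rho> > 0\<close> by (simp add: algebra_simps)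
  qed
  define em :: "real aps \<Rightarrow> complex aps" where "em = mapA of_real"
  have em: "clin em" unfolding em_def[abs_def] by (intro clin_mapA clin_of_real)
  define a b where "a = em (dilate ca \<rho>)" and "b = em (dilate cb \<rho>)"
  define s c where "s = em (dilate sin_coeff \<rho>)" and "c = em (dilate cos_coeff \<rho>)"
  define \<gamma> where "\<gamma> = (\<rho> / 2) *\<^sub>R (b + const \<i> * a)"
  define \<alpha> where "\<alpha> = (\<lambda>i::nat. if i = 1 then \<gamma> * s else if i = 2 then \<gamma> * c else if i = 3 then - (const \<i> * \<gamma>) else 0)"
  have dl: "norm (em (dilate f \<rho>)) \<le> norm (dilate f \<rho>0)" if "\<And>t. \<bar>t\<bar> < r1 \<Longrightarrow> summable (\<lambda>n. f n * t ^ n)" for f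
    by (rule order_trans[OF clin_norm[OF em] norm_dilate_mono[OF that \<rho>(4,2) \<rho>0(2)]])
  have ni: "norm (const \<i> * x) \<le> norm x" for x :: "complex aps"
    by (rule order_trans[OF norm_mult_ineq]) (simp add: norm_const)
  have n\<gamma>: "norm \<gamma> \<le> \<rho> * (norm (dilate ca \<rho>0) + norm (dilate cb \<rho>0))"
  proof -
    have "norm (b + const \<i> * a) \<le> norm (dilate ca \<rho>0) + norm (dilate cb \<rho>0)"
      using norm_triangle_ineq[of b "const \<i> * a"] ni[of a] dl[OF sums(1)] dl[OF sums(2)] unfolding a_def b_def by linarith
    then have "norm \<gamma> \<le> (\<rho> / 2) * (norm (dilate ca \<rho>0) + norm (dilate cb \<rho>0))"
      unfolding \<gamma>_def using \<rho> by (simp add: mult_left_mono)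
    also have "\<dots> \<le> \<rho> * (norm (dilate ca \<rho>0) + norm (dilate cb \<rho>0))"
      using \<rho> by (intro mult_right_mono) auto
    finally show ?thesis .
  qed
  have n\<alpha>: "norm (\<alpha> i) \<le> m" for i
  proof -
    define Q where "Q = 1 + norm (dilate sin_coeff \<rho>0) + norm (dilate cos_coeff \<rho>0)"
    have sc: "norm s \<le> Q" "norm c \<le> Q" "1 \<le> Q"
      using dl[OF sums(3)] dl[OF sums(4)] norm_ge_zero[of "dilate sin_coeff \<rho>0"] norm_ge_zero[of "dilate cos_coeff \<rho>0"]
      unfolding s_def c_def Q_def by linarith+
    have "norm (\<alpha> i) \<le> norm \<gamma> * Q"
    proof -
      have "norm (\<gamma> * s) \<le> norm \<gamma> * Q" "norm (\<gamma> * c) \<le> norm \<gamma> * Q"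
        using sc by (auto intro!: order_trans[OF norm_mult_ineq] mult_left_mono)
      moreover have "norm \<gamma> \<le> norm \<gamma> * Q" using sc by (simp add: mult_le_cancel_left1)
      ultimately show ?thesis
        using ni[of \<gamma>] sc by (auto simp: \<alpha>_def)
    qed
    also have "\<dots> \<le> (\<rho> * (norm (dilate ca \<rho>0) + norm (dilate cb \<rho>0))) * Q"
      using n\<gamma> sc by (intro mult_right_mono) auto
    also have "\<dots> = \<rho> * K" by (simp add: K_def Q_def)
    also note \<rho>(3)
    finally show ?thesis .
  qed
  have n\<beta>: "norm (mapA cnj (\<alpha> i)) \<le> m" for i
    using clin_norm[OF clin_mapA[OF chom_clin[OF chom_cnj]], of "\<alpha> i"] n\<alpha>[of i] by linarith
  have "\<exists>w. \<forall>i\<in>{1,2,3}. symr (w i) (w i) \<and> norm (w i) \<le> m \<and> w i = rhs D r \<alpha> (\<lambda>i. mapA cnj (\<alpha> i)) i w"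
    by (rule rhs_fixed_point[OF D r m0 m m'(1) m'(2)[unfolded L_def] n\<alpha> n\<beta> symc_mapA_cnj])
  then obtain w where W: "\<forall>i\<in>{1,2,3}. symr (w i) (w i) \<and> norm (w i) \<le> m \<and> w i = rhs D r \<alpha> (\<lambda>i. mapA cnj (\<alpha> i)) i w"
    by (elim exE)
  have w: "symr (w i) (w i)" "norm (w i) \<le> m" "w i = rhs D r \<alpha> (\<lambda>i. mapA cnj (\<alpha> i)) i w" if "i \<in> {1,2,3}" for i
    by (rule bspec[OF W that, THEN conjunct1] bspec[OF W that, THEN conjunct2, THEN conjunct1]
        bspec[OF W that, THEN conjunct2, THEN conjunct2])+
  have evs: "ev t s = sin (of_real \<rho> * t)" "ev t c = cos (of_real \<rho> * t)" for t :: complex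
  proof -
    have "ev t s = (\<Sum>n. sin_coeff n *\<^sub>R (of_real \<rho> * t) ^ n)"
      unfolding s_def em_def by (subst ev_dilate[OF sums(3) \<rho>(4,5)]) (auto simp: scaleR_conv_of_real)
    then show "ev t s = sin (of_real \<rho> * t)" by (simp add: sums_unique[OF sin_converges])
    have "ev t c = (\<Sum>n. cos_coeff n *\<^sub>R (of_real \<rho> * t) ^ n)"
      unfolding c_def em_def by (subst ev_dilate[OF sums(4) \<rho>(4,5)]) (auto simp: scaleR_conv_of_real)
    then show "ev t c = cos (of_real \<rho> * t)" by (simp add: sums_unique[OF cos_converges])
  qed
  have al: "ev t (\<alpha> 1) = ev t \<gamma> * sin (of_real \<rho> * t)" "ev t (\<alpha> 2) = ev t \<gamma> * cos (of_real \<rho> * t)"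
    "ev t (\<alpha> 3) = - \<i> * ev t \<gamma>" if "norm t < 1" for t :: complex
    using that by (simp_all add: \<alpha>_def chom_mult[OF chom_ev] chom_minus[OF chom_ev] ev_const evs)
  have evA: "ev x (dilate ca \<rho>) = A (\<rho> * x)" "ev x (dilate cb \<rho>) = B (\<rho> * x)" if "\<bar>x\<bar> \<le> 1" for x
  proof -
    have "\<bar>\<rho> * x\<bar> \<le> \<rho> * 1" unfolding abs_mult using \<rho> that by (intro mult_mono) auto
    then have l: "\<bar>\<rho> * x\<bar> < ra" "\<bar>\<rho> * x\<bar> < rb" using \<rho> r1 by auto
    show "ev x (dilate ca \<rho>) = A (\<rho> * x)" "ev x (dilate cb \<rho>) = B (\<rho> * x)"
      using ca[OF l(1)] cb[OF l(2)]
      by (simp_all add: ev_dilate_real[OF sums(1) \<rho>(4,5)] ev_dilate_real[OF sums(2) \<rho>(4,5)] sums_iff)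
  qed
  have "cauchy_char \<rho> r D \<alpha> w \<gamma> A B"
  proof
    show "\<rho> > 0" "r > 0" by fact+
    show "w i = rhs D r \<alpha> (\<lambda>i. mapA cnj (\<alpha> i)) i w" "symr (w i) (w i)" if "i \<in> {1,2,3}" for i
      by (rule w[OF that])+
    show "norm (sol (\<alpha> 3) (mapA cnj (\<alpha> 3)) (w 3)) \<le> r"
      using norm_sol[of "\<alpha> 3" "mapA cnj (\<alpha> 3)" "w 3"] n\<alpha>[of 3] n\<beta>[of 3] w(2)[of 3] m by simp
    show "(ev t (\<alpha> 1))\<^sup>2 + (ev t (\<alpha> 2))\<^sup>2 + (ev t (\<alpha> 3))\<^sup>2 = 0" if "norm t < 1" for t
    proof -
      have "(ev t (\<alpha> 1))\<^sup>2 + (ev t (\<alpha> 2))\<^sup>2 =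
          (ev t \<gamma>)\<^sup>2 * ((sin (of_real \<rho> * t))\<^sup>2 + (cos (of_real \<rho> * t))\<^sup>2)"
        unfolding al[OF that] by (simp only: power_mult_distrib distrib_left)
      moreover have "(ev t (\<alpha> 3))\<^sup>2 = - (ev t \<gamma>)\<^sup>2"
        unfolding al[OF that] by (simp add: power_mult_distrib)
      ultimately show ?thesis by simp
    qed
    show "ev t (\<alpha> 1) = ev t \<gamma> * sin (of_real \<rho> * t)" "ev t (\<alpha> 2) = ev t \<gamma> * cos (of_real \<rho> * t)"
      "ev t (\<alpha> 3) = - \<i> * ev t \<gamma>" if "norm t < 1" for t
      by (rule al[OF that])+
    show "ev (of_real (u / \<rho>)) \<gamma> = of_real (\<rho> / 2) * Complex (B u) (A u)" if u: "\<bar>u\<bar> < \<rho>" for u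
    proof -
      have x: "\<bar>u / \<rho>\<bar> \<le> 1" using u \<rho> by simp
      then have n: "norm (of_real (u / \<rho>) :: complex) \<le> 1" by (simp add: norm_divide)
      have "ev (of_real (u / \<rho>)) a = (of_real (A u) :: complex)" "ev (of_real (u / \<rho>)) b = (of_real (B u) :: complex)"
        unfolding a_def b_def em_def ev_of_real[OF x] evA[OF x] using \<rho> by simp_all
      then show ?thesis
        unfolding \<gamma>_def chom_scaleR[OF chom_ev[OF n]] chom_add[OF chom_ev[OF n]] chom_mult[OF chom_ev[OF n]] ev_const
        by (simp add: complex_eq_iff)
    qed
    have cn: "continuous_on {-\<rho><..<\<rho>} (\<lambda>u. ev (u / \<rho>) f)" for f :: "real aps"
      by (rule continuous_on_compose2[OF continuous_on_ev]) (use \<rho> in \<open>auto intro!: continuous_intros simp: abs_le_iff divide_simps\<close>)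
    show "continuous_on {-\<rho><..<\<rho>} A"
      by (rule continuous_on_eq[OF cn[of "dilate ca \<rho>"]]) (use \<rho> in \<open>simp add: evA abs_le_iff divide_simps\<close>)
    show "continuous_on {-\<rho><..<\<rho>} B"
      by (rule continuous_on_eq[OF cn[of "dilate cb \<rho>"]]) (use \<rho> in \<open>simp add: evA abs_le_iff divide_simps\<close>)
  qed
  then show thesis
    by (rule that[OF _ _ D rI rD]) (use \<rho> r1 in auto)
qed

section \<open>Uniqueness on the disk, minimality and assembly\<close>

lemma cauchy_solution_quad:
  assumes "cauchy_solution \<phi> I A B p1 p2 p3 R x y z" and u: "u 1 = x" "u 2 = y" "u 3 = z"
    and q: "norm q < R" and i: "i \<in> {1,2,3}"
  shows "loc_an (u i) q"
    and "lap (u i) q = - deriv \<phi> (u 3 q) * quad i (\<lambda>j. pu (u j) q) (\<lambda>j. pv (u j) q)"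
proof -
  have qb: "q \<in> ball 0 R" using q by simp
  have "loc_an x q" "loc_an y q" "loc_an z q"
    using assms(1) qb unfolding cauchy_solution_def real_analytic2_on_iff by blast+
  then show "loc_an (u i) q" using i u by auto
  have "lap x q = - deriv \<phi> (z q) * gdot x z q" "lap y q = - deriv \<phi> (z q) * gdot y z q"
    "lap z q = - deriv \<phi> (z q) * ((- gdot x x q - gdot y y q + gdot z z q) / 2)"
    using assms(1) qb unfolding cauchy_solution_def by blast+
  then show "lap (u i) q = - deriv \<phi> (u 3 q) * quad i (\<lambda>j. pu (u j) q) (\<lambda>j. pv (u j) q)"
    using i u unfolding quad_def gdot_def by auto
qed

text \<open>The integral from 0 to 0 gives every solution the height \<open>p3\<close> at the
  origin, so one expansion of \<open>deriv \<phi>\<close> about \<open>p3\<close> serves both. Local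
  uniqueness then spreads to the whole disk along rays, componentwise.\<close>

lemma cauchy_solution_unique:
  assumes s: "cauchy_solution \<phi> I A B p1 p2 p3 R x y z" and s': "cauchy_solution \<phi> I A B p1 p2 p3 R x' y' z'"
    and R: "R > 0" and r: "r > 0" and D: "summable (\<lambda>n. real n * norm (coef D n))"
    and \<phi>: "\<And>c. \<bar>c - p3\<bar> \<le> r \<Longrightarrow> deriv \<phi> c = ev ((c - p3) / r) D"
    and q: "norm q < R"
  shows "x' q = x q \<and> y' q = y q \<and> z' q = z q"
proof -
  define u where "u = (\<lambda>i::nat. if i = 1 then x else if i = 2 then y else z)"
  define u' where "u' = (\<lambda>i::nat. if i = 1 then x' else if i = 2 then y' else z')"
  have u: "u 1 = x" "u 2 = y" "u 3 = z" and u': "u' 1 = x'" "u' 2 = y'" "u' 3 = z'"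
    by (simp_all add: u_def u'_def)
  note S = cauchy_solution_quad[OF s u] and S' = cauchy_solution_quad[OF s' u']
  have z0: "z (0, 0) = p3"
  proof -
    have "z (0, 0) = p3 + (LBINT t=ereal 0..ereal 0. A t)"
      using s R unfolding cauchy_solution_def by (metis abs_zero)
    then show ?thesis by simp
  qed
  have 0: "norm (0 :: real \<times> real) < R" using R by simp
  have "\<exists>\<delta>>0. \<forall>q. norm q < \<delta> \<longrightarrow> (\<forall>i\<in>{1,2,3}. u i q = u' i q)"
  proof (rule local_uniqueness[of u u' R r D "deriv \<phi>"])
    show "loc_an (u i) 0" "loc_an (u' i) 0" if "i \<in> {1,2,3}" for i
      by (rule S(1)[OF 0 that] S'(1)[OF 0 that])+
    show "deriv \<phi> c = ev ((c - u 3 0) / r) D" if "\<bar>c - u 3 0\<bar> \<le> r" for c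
      using \<phi>[of c] that z0 by (simp add: u zero_prod_def)
    show "lap (u i) q = - deriv \<phi> (u 3 q) * quad i (\<lambda>j. pu (u j) q) (\<lambda>j. pv (u j) q)"
      "lap (u' i) q = - deriv \<phi> (u' 3 q) * quad i (\<lambda>j. pu (u' j) q) (\<lambda>j. pv (u' j) q)"
      if "i \<in> {1,2,3}" "norm q < R" for i q
      by (rule S(2)[OF that(2,1)] S'(2)[OF that(2,1)])+
    fix i :: nat and t :: real assume i: "i \<in> {1,2,3}" and t: "\<bar>t\<bar> < R"
    show "u i (t, 0) = u' i (t, 0)" "pv (u i) (t, 0) = pv (u' i) (t, 0)"
      using i t s s' unfolding cauchy_solution_def by (auto simp: u_def u'_def)
  qed (use R r D in auto)
  then obtain \<delta> where \<delta>: "\<delta> > 0" "\<And>q i. norm q < \<delta> \<Longrightarrow> i \<in> {1,2,3} \<Longrightarrow> u i q = u' i q" by blast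
  have "u i q = u' i q" if i: "i \<in> {1,2,3}" for i
    by (rule loc_an_eq_on_ball[OF S(1)[OF _ i] S'(1)[OF _ i] \<delta>(1) \<delta>(2)[OF _ i] q])
  from this[of 1] this[of 2] this[of 3] show ?thesis by (simp add: u_def u'_def)
qed

text \<open>Multiplied by 2, the minimality equations for the parameter \<open>u + \<i> v\<close>
  are the Cauchy system itself; for the third one this rests on the factor 1 / 2 in
  \<open>cauchy_solution\<close>. The immersion condition is positivity of
  \<open>metric_factor\<close>.\<close>

lemma (in cauchy_char) phi_e3_minimal_X:
  assumes R: "R \<le> \<rho>" and sol: "cauchy_solution \<phi> I A B (p 1) (p 2) (p 3) R (X p 1) (X p 2) (X p 3)"
    and pos: "\<And>q. norm q < R \<Longrightarrow> metric_factor q > 0"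
  shows "phi_e3_minimal_on \<phi> I (ball 0 R) (X p 1) (X p 2) (X p 3)"
  unfolding phi_e3_minimal_on_def conformal_immersion_on_def
proof (intro conjI ballI)
  fix q :: "real \<times> real" assume qb: "q \<in> ball 0 R"
  then have q: "norm q < \<rho>" and qR: "norm q < R" using R by simp_all
  show "(\<lambda>s. X p 1 (s, snd q)) differentiable at (fst q)" "(\<lambda>s. X p 2 (s, snd q)) differentiable at (fst q)"
    "(\<lambda>s. X p 3 (s, snd q)) differentiable at (fst q)" "(\<lambda>s. X p 1 (fst q, s)) differentiable at (snd q)"
    "(\<lambda>s. X p 2 (fst q, s)) differentiable at (snd q)" "(\<lambda>s. X p 3 (fst q, s)) differentiable at (snd q)"
    unfolding real_differentiable_def using X_derivatives[OF q, of _ p] by blast+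
  show "(pu (X p 1) q)\<^sup>2 + (pu (X p 2) q)\<^sup>2 + (pu (X p 3) q)\<^sup>2 = (pv (X p 1) q)\<^sup>2 + (pv (X p 2) q)\<^sup>2 + (pv (X p 3) q)\<^sup>2"
    "pu (X p 1) q * pv (X p 1) q + pu (X p 2) q * pv (X p 2) q + pu (X p 3) q * pv (X p 3) q = 0"
    by (rule conformal[OF q])+
  show "(pu (X p 1) q)\<^sup>2 + (pu (X p 2) q)\<^sup>2 + (pu (X p 3) q)\<^sup>2 > 0"
    using pos[OF qR] unfolding metric_factor_def .
  have pde: "X p 3 q \<in> I" "lap (X p 1) q = - deriv \<phi> (X p 3 q) * gdot (X p 1) (X p 3) q"
    "lap (X p 2) q = - deriv \<phi> (X p 3 q) * gdot (X p 2) (X p 3) q"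
    "lap (X p 3) q = - deriv \<phi> (X p 3 q) * ((- gdot (X p 1) (X p 1) q - gdot (X p 2) (X p 2) q + gdot (X p 3) (X p 3) q) / 2)"
    using sol qb unfolding cauchy_solution_def by blast+
  have gc: "gdot (X p 3) (X p 1) q = gdot (X p 1) (X p 3) q" "gdot (X p 3) (X p 2) q = gdot (X p 2) (X p 3) q"
    by (simp_all add: gdot_def mult.commute)
  show "X p 3 q \<in> I" by (rule pde)
  show "2 * (lap (X p 1) q / 4) + deriv \<phi> (X p 3 q) * (gdot (X p 3) (X p 1) q / 2) = 0"
    "2 * (lap (X p 2) q / 4) + deriv \<phi> (X p 3 q) * (gdot (X p 3) (X p 2) q / 2) = 0"
    "2 * (lap (X p 3) q / 4) - deriv \<phi> (X p 3 q) * (gdot (X p 1) (X p 1) q / 4 + gdot (X p 2) (X p 2) q / 4 - gdot (X p 3) (X p 3) q / 4) = 0"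
    unfolding pde(2-4) gc by (simp_all add: field_simps)
qed

theorem theorem5:
  fixes \<phi> A B :: "real \<Rightarrow> real" and I :: "real set" and \<epsilon> p1 p2 p3 :: real
  assumes "open I" and "is_interval I" and "real_analytic_on \<phi> I"
    and "\<epsilon> > 0"
    and "real_analytic_on A {-\<epsilon><..<\<epsilon>}" and "real_analytic_on B {-\<epsilon><..<\<epsilon>}"
    and "\<forall>t\<in>{-\<epsilon><..<\<epsilon>}. (A t)\<^sup>2 + (B t)\<^sup>2 > 0"
    and "p3 \<in> I"
  shows "\<exists>R0>0. \<forall>R. 0 < R \<and> R \<le> R0 \<longrightarrow>
    (\<exists>x y z. cauchy_solution \<phi> I A B p1 p2 p3 R x y z \<and>
      (\<forall>x' y' z'. cauchy_solution \<phi> I A B p1 p2 p3 R x' y' z' \<longrightarrow>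
          (\<forall>q\<in>ball 0 R. x' q = x q \<and> y' q = y q \<and> z' q = z q)) \<and>
      phi_e3_minimal_on \<phi> I (ball 0 R) x y z \<and>
      (\<forall>q\<in>ball 0 R. snd q \<noteq> 0 \<longrightarrow> angle_fn x y z q \<noteq> 0) \<and>
      (\<forall>u. \<bar>u\<bar> < R \<longrightarrow> angle_fn x y z (u, 0) = 0 \<and> pv (angle_fn x y z) (u, 0) = 1))"
proof -
  define p where "p = (\<lambda>i::nat. if i = 1 then p1 else if i = 2 then p2 else p3)"
  have p: "p 1 = p1" "p 2 = p2" "p 3 = p3" by (simp_all add: p_def)
  obtain \<rho> r D \<alpha> w \<gamma> where C: "cauchy_char \<rho> r D \<alpha> w \<gamma> A B" and \<rho>\<epsilon>: "\<rho> \<le> \<epsilon>"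
    and D: "summable (\<lambda>n. real n * \<bar>coef D n\<bar>)"
    and rI: "\<And>x. \<bar>x - p 3\<bar> \<le> r \<Longrightarrow> x \<in> I"
    and rD: "\<And>x. \<bar>x - p 3\<bar> \<le> r \<Longrightarrow> deriv \<phi> x = ev ((x - p 3) / r) D"
    using cauchy_char_exists[of \<phi> I p A \<epsilon> B thesis] assms by (auto simp: p)
  interpret cauchy_char \<rho> r D \<alpha> w \<gamma> A B p by (rule C)
  have pos: "(A u)\<^sup>2 + (B u)\<^sup>2 > 0" if "\<bar>u\<bar> < \<rho>" for u
    using assms(7) that \<rho>\<epsilon> by (auto simp: abs_less_iff)
  obtain R0 where R0: "0 < R0" "R0 \<le> \<rho>" and mf: "\<And>q. norm q < R0 \<Longrightarrow> metric_factor q > 0"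
    and nz: "\<And>q. norm q < R0 \<Longrightarrow> snd q \<noteq> 0 \<Longrightarrow> Rf \<rho> nrm q \<noteq> 0"
    using good_radius[OF pos] \<rho> by auto
  show ?thesis
  proof (intro exI[of _ R0] conjI allI impI R0(1))
    fix R assume "0 < R \<and> R \<le> R0"
    then have R: "0 < R" "R \<le> R0" "R \<le> \<rho>" using R0 by auto
    \<comment> \<open>One map, defined from the solution on the disk of radius
      \<open>\<rho>\<close>, serves every \<open>R\<close>; only the comparison with other solutions
      is made on the disk of radius \<open>R\<close>.\<close>
    have S: "cauchy_solution \<phi> I A B p1 p2 p3 R (X p 1) (X p 2) (X p 3)"
      using cauchy_solution_X[OF R(3) rI rD] by (simp only: p)
    show "\<exists>x y z. cauchy_solution \<phi> I A B p1 p2 p3 R x y z \<and>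
      (\<forall>x' y' z'. cauchy_solution \<phi> I A B p1 p2 p3 R x' y' z' \<longrightarrow>
          (\<forall>q\<in>ball 0 R. x' q = x q \<and> y' q = y q \<and> z' q = z q)) \<and>
      phi_e3_minimal_on \<phi> I (ball 0 R) x y z \<and>
      (\<forall>q\<in>ball 0 R. snd q \<noteq> 0 \<longrightarrow> angle_fn x y z q \<noteq> 0) \<and>
      (\<forall>u. \<bar>u\<bar> < R \<longrightarrow> angle_fn x y z (u, 0) = 0 \<and> pv (angle_fn x y z) (u, 0) = 1)"
    proof (rule exI[of _ "X p 1"], rule exI[of _ "X p 2"], rule exI[of _ "X p 3"], intro conjI allI impI ballI S)
      fix x' y' z' and q :: "real \<times> real"
      assume S': "cauchy_solution \<phi> I A B p1 p2 p3 R x' y' z'" and "q \<in> ball 0 R"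
      then have q: "norm q < R" by simp
      have D': "summable (\<lambda>n. real n * norm (coef D n))" using D by simp
      from cauchy_solution_unique[OF S S' R(1) r D' rD[unfolded p] q]
      show "x' q = X p 1 q" "y' q = X p 2 q" "z' q = X p 3 q" by simp_all
    next
      show "phi_e3_minimal_on \<phi> I (ball 0 R) (X p 1) (X p 2) (X p 3)"
        by (rule phi_e3_minimal_X[OF R(3)]) (use S mf R in \<open>simp_all add: p[simplified]\<close>)
    next
      fix q :: "real \<times> real" assume "q \<in> ball 0 R" "snd q \<noteq> 0"
      then have q: "norm q < R0" "norm q < \<rho>" using R R0 by simp_all
      show "angle_fn (X p 1) (X p 2) (X p 3) q \<noteq> 0"
        unfolding angle_X[OF q(2)] using nz[OF q(1) \<open>snd q \<noteq> 0\<close>] mf[OF q(1)] \<rho> by simp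
    next
      fix u assume "\<bar>u\<bar> < R"
      then have u: "\<bar>u\<bar> < \<rho>" using R by simp
      show "angle_fn (X p 1) (X p 2) (X p 3) (u, 0) = 0" "pv (angle_fn (X p 1) (X p 2) (X p 3)) (u, 0) = 1"
        by (rule angle_axis[OF u pos[OF u]])+
    qed
  qed
qed

end
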